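(* Let $h_3(z)=\eta^2(z)\eta^2(3z)$, and let $\nu_\pm$ be the multiplier systems on $\Gamma^*(3)$ defined below. (a) For every integer $d>0$ with $d\equiv1\pmod3$ and each choice of sign there is a unique form $f_d^{\pm}=q^{-d/3}+\sum_{n>0,\ n\equiv2\bmod3}a_d^\pm(n)q^{n/3}\in M_2^!(\Gamma^*(3),\bar\nu_\pm)$. (b) For every integer $d>0$ with $d\equiv2\pmod3$ there are unique forms $f_d^{+}=q^{-d/3}+\sum_{n>0,\ n\equiv1\bmod3}a_d^+(n)q^{n/3}\in M_2^!(\Gamma^*(3),\nu_+)$ and $f_d^{-}=q^{-d/3}+\sum_{n\ge4,\ n\equiv1\bmod3}a_d^-(n)q^{n/3}\in M_2^!(\Gamma^*(3),\nu_-)$. (c) Let $p\ge5$ be prime and $n\ge1$. Then $f_1^+|T_2^{(3)}(p^n)=p^nf^+_{p^n}$. If $p^n\equiv1\pmod3$ then $f_1^-|T_2^{(3)}(p^n)=p^nf^-_{p^n}$. If $p^n\equiv2\pmod3$ then $f_1^-|T_2^{(3)}(p^n)=p^nf^-_{p^n}+a_1^-(p^n)\,h_3$.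
   Context: $q=e^{2\pi iz}$, $\eta(z)=q^{1/24}\prod_{n\ge1}(1-q^n)$, $\zeta_3=e^{2\pi i/3}$. $\Gamma^*(3)$ is the Fricke group generated by $\Gamma_0(3)$ and $W_3=\begin{pmatrix}0&-1\\3&0\end{pmatrix}$ (equivalently by $\begin{pmatrix}1&1\\0&1\end{pmatrix}$ and $W_3$). $\nu_\pm$ is the character of $\Gamma^*(3)$ given by $\nu_\pm(\gamma)=\zeta_3^{\frac c3(a+d)+bd}$ for $\gamma=\begin{pmatrix}a&b\\c&d\end{pmatrix}\in\Gamma_0(3)$ (the multiplier system of $h_3$ on $\Gamma_0(3)$) and $\nu_\pm(W_3)=\pm1$; $\bar\nu_\pm$ is its complex conjugate. For $\gamma\in GL_2^+(\mathbb{Q})$, $f|_k\gamma(z)=(\det\gamma)^{k/2}(cz+d)^{-k}f(\gamma z)$. $M_k^!(\Gamma,\chi)$ is the space of holomorphic functions on the upper half-plane, meromorphic at the cusps, with $f|_k\gamma=\chi(\gamma)f$ for all $\gamma\in\Gamma$. For a prime $p$, $f|T_k^{(t)}(p)=p^{k/2-1}\left(\sum_{\lambda=0}^{p-1}f|_k\begin{pmatrix}1&t\lambda\\0&p\end{pmatrix}+f|_k\begin{pmatrix}p&0\\0&1\end{pmatrix}\right)$, acting on $f=\sum a(n)q^{n/t}$ by $\sum(a(pn)+p^{k-1}a(n/p))q^{n/t}$; $T_k^{(t)}(1)=\mathrm{id}$, $T_k^{(t)}(p^{n+1})=T_k^{(t)}(p^n)T_k^{(t)}(p)-p^{k-1}T_k^{(t)}(p^{n-1})$.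 In (c), $f^\pm_{p^n}$ are the forms from (a) or (b) according to $p^n\bmod3$, and $a_1^-(m)$ is the coefficient of $q^{m/3}$ in $f_1^-$. *)

theory Defs
  imports "HOL-Analysis.Analysis"
begin

definition upper_half :: "complex set" where
  "upper_half = {z. Im z > 0}"

definition zeta3 :: complex where
  "zeta3 = exp (2 * pi * \<i> / 3)"

definition qpow :: "nat \<Rightarrow> int \<Rightarrow> complex \<Rightarrow> complex" where
  "qpow N n z = exp (2 * pi * \<i> * of_int n * z / of_nat N)"

definition eta :: "complex \<Rightarrow> complex" where
  "eta z = exp (2 * pi * \<i> * z / 24) * (\<Prod>n. (1 - exp (2 * pi * \<i> * of_nat (Suc n) * z)))"

definition h3 :: "complex \<Rightarrow> complex" where
  "h3 z = (eta z)^2 * (eta (3 * z))^2"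

type_synonym imat = "int \<times> int \<times> int \<times> int"

definition mdet :: "imat \<Rightarrow> int" where
  "mdet g = (case g of (a,b,c,d) \<Rightarrow> a*d - b*c)"

definition SL2Z :: "imat set" where
  "SL2Z = {g. mdet g = 1}"

definition Gamma0_3 :: "imat set" where
  "Gamma0_3 = {(a,b,c,d). a*d - b*c = 1 \<and> 3 dvd c}"

definition W3 :: imat where
  "W3 = (0, -1, 3, 0)"

definition slash :: "int \<Rightarrow> imat \<Rightarrow> (complex \<Rightarrow> complex) \<Rightarrow> complex \<Rightarrow> complex" where
  "slash k g f z = (case g of (a,b,c,d) \<Rightarrow>
      complex_of_real (real_of_int (a*d - b*c) powr (real_of_int k / 2))
      * (of_int c * z + of_int d) powi (-k)
      * f ((of_int a * z + of_int b) / (of_int c * z + of_int d)))"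

text \<open>Restriction to Gamma_0(3): nu(gamma) = zeta3^((c/3)(a+d) + bd).\<close>
definition nu0 :: "imat \<Rightarrow> complex" where
  "nu0 g = (case g of (a,b,c,d) \<Rightarrow> zeta3 powi ((c div 3) * (a + d) + b * d))"

definition mero_at_cusps :: "int \<Rightarrow> (complex \<Rightarrow> complex) \<Rightarrow> bool" where
  "mero_at_cusps k f \<longleftrightarrow>
     (\<forall>g\<in>SL2Z. \<exists>N::nat. N > 0 \<and> (\<exists>b::int \<Rightarrow> complex.
        finite {n. n < 0 \<and> b n \<noteq> 0} \<and>
        (\<forall>z\<in>upper_half. ((\<lambda>n. b n * qpow N n z) has_sum slash k g f z) UNIV)))"

text \<open>M_k^!(Gamma^*(3), chi), where chi is given by its values chi0 on Gamma_0(3)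
  and chiW = chi(W_3); Gamma^*(3) is generated by Gamma_0(3) and W_3.\<close>
definition wmf_star3 :: "int \<Rightarrow> (imat \<Rightarrow> complex) \<Rightarrow> complex \<Rightarrow> (complex \<Rightarrow> complex) \<Rightarrow> bool" where
  "wmf_star3 k chi0 chiW f \<longleftrightarrow>
     f holomorphic_on upper_half \<and>
     (\<forall>g\<in>Gamma0_3. \<forall>z\<in>upper_half. slash k g f z = chi0 g * f z) \<and>
     (\<forall>z\<in>upper_half. slash k W3 f z = chiW * f z) \<and>
     mero_at_cusps k f"

definition has_qexp3 :: "(complex \<Rightarrow> complex) \<Rightarrow> (int \<Rightarrow> complex) \<Rightarrow> bool" where
  "has_qexp3 f a \<longleftrightarrow> finite {n. n < 0 \<and> a n \<noteq> 0} \<and>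
     (\<forall>z\<in>upper_half. ((\<lambda>n. a n * qpow 3 n z) has_sum f z) UNIV)"

text \<open>Coefficient of q^(m/3) (coefficients are unique when an expansion exists).\<close>
definition qcoeff3 :: "(complex \<Rightarrow> complex) \<Rightarrow> int \<Rightarrow> complex" where
  "qcoeff3 f m = (SOME a. has_qexp3 f a) m"

text \<open>Sign s is 1 (for +) or -1 (for -).  Character: conj(nu_s) if d = 1 mod 3,
  nu_s if d = 2 mod 3; in both cases the value at W_3 is s.\<close>
definition chi_d :: "nat \<Rightarrow> imat \<Rightarrow> complex" where
  "chi_d d g = (if d mod 3 = 1 then cnj (nu0 g) else nu0 g)"

text \<open>Admissible exponents n (with n/3 the exponent of q) besides the leading -d.\<close>
definition exps_d :: "nat \<Rightarrow> int \<Rightarrow> int \<Rightarrow> bool" where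
  "exps_d d s n \<longleftrightarrow>
     (if d mod 3 = 1 then n > 0 \<and> n mod 3 = 2
      else if s = 1 then n > 0 \<and> n mod 3 = 1
      else n \<ge> 4 \<and> n mod 3 = 1)"

definition is_f_d :: "nat \<Rightarrow> int \<Rightarrow> (complex \<Rightarrow> complex) \<Rightarrow> bool" where
  "is_f_d d s f \<longleftrightarrow>
     wmf_star3 2 (chi_d d) (of_int s) f \<and>
     (\<exists>a. has_qexp3 f a \<and> a (- int d) = 1 \<and>
          (\<forall>n. n \<noteq> - int d \<and> \<not> exps_d d s n \<longrightarrow> a n = 0))"

definition f_d :: "nat \<Rightarrow> int \<Rightarrow> complex \<Rightarrow> complex" where
  "f_d d s = (SOME f. is_f_d d s f)"

definition hecke_p :: "int \<Rightarrow> int \<Rightarrow> nat \<Rightarrow> (complex \<Rightarrow> complex) \<Rightarrow> complex \<Rightarrow> complex" where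
  "hecke_p k t p f z = complex_of_real (real p powr (real_of_int k / 2 - 1)) *
     ((\<Sum>l<p. slash k (1, t * int l, 0, int p) f z) + slash k (int p, 0, 0, 1) f z)"

fun hecke_pp :: "int \<Rightarrow> int \<Rightarrow> nat \<Rightarrow> nat \<Rightarrow> (complex \<Rightarrow> complex) \<Rightarrow> complex \<Rightarrow> complex" where
  "hecke_pp k t p 0 f = f"
| "hecke_pp k t p (Suc 0) f = hecke_p k t p f"
| "hecke_pp k t p (Suc (Suc n)) f =
     (\<lambda>z. hecke_p k t p (hecke_pp k t p (Suc n) f) z
          - complex_of_real (real p powr (real_of_int k - 1)) * hecke_pp k t p n f z)"

end

theory Submission
  imports Defs "HOL-Complex_Analysis.Complex_Analysis"
begin

text \<open>
  Everything is reduced to the two generators \<open>z \<mapsto> z + 1\<close> and \<open>W\<^sub>3\<close> of the Fricke group.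

  The eta function has \<open>\<eta>'/\<eta> = i G\<^sub>2 / 4\<pi>\<close>, and exchanging the order of summation in the lattice
  series \<open>G\<^sub>2\<close> after subtracting a telescoping series yields \<open>\<eta>(-1/z)\<^sup>2 = -i z \<eta>(z)\<^sup>2\<close>. Hence \<open>h\<^sub>3\<close> has
  weight 2 with character \<open>\<nu>\<^sub>-\<close>, it has no zeros, and \<open>t = (\<eta>(z)/\<eta>(3z))^12\<close> satisfies
  \<open>t | W\<^sub>3 = 729/t\<close>.

  Uniqueness: if all exponents of a form \<open>f\<close> are positive, then \<open>|f/h\<^sub>3|\<close> is invariant under the
  group and bounded at the cusp, so \<open>f\<close> is a multiple of \<open>h\<^sub>3\<close> by the maximum principle.
  Existence: with \<open>L = t'/t\<close>, the forms \<open>L\<^sup>2/h\<^sub>3\<close>, \<open>(L/h\<^sub>3)'\<close>, \<open>h\<^sub>3 (t - 729/t)\<close> and \<open>h\<^sub>3\<close> realise the four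
  combinations of character and sign; multiplying by powers of \<open>t + 729/t\<close> and eliminating gives
  every pole order. The Hecke operators exchange the characters and preserve the sign, so part (c)
  follows from uniqueness by comparing the coefficients with nonpositive exponent.
\<close>

subsection \<open>Partial fractions\<close>

text \<open>The double series for \<open>G_2\<close> converges only conditionally, so its two orders
  of summation differ. The subtracted terms \<open>1/(w - 1/2) - 1/(w + 1/2)\<close> make it
  absolutely convergent; they telescope to 0 along rows, but along columns they become differences
  of cotangents whose limits at the two ends are distinct. That discrepancy is the whole anomaly of
  \<open>G_2\<close> under inversion. Only the square of eta is transformed, so that no branch of a
  square root has to be chosen; \<open>h3\<close> and \<open>t\<close> contain even powers of eta
  only.

  A single function obstructs uniqueness: up to scalars \<open>h3\<close> is the only form without
  nonpositive exponents, and it occurs only for translation factor \<open>zeta3\<close> and sign -1.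
  Its leading exponent is 1, whence the bound \<open>n \<ge> 4\<close> in (b) and the correction by
  \<open>h3\<close> in (c).

  Since \<open>h3\<close> is free of zeros, quotients by it stay holomorphic. The invariant
  \<open>t + 729/t\<close> has a simple pole in \<open>q\<close> at the cusp, so it moves leading
  exponents in steps of 3, exactly the steps that a fixed translation factor allows.\<close>

lemma sin_pi_times_nonzero:
  fixes w :: complex
  assumes "Im w \<noteq> 0"
  shows "sin (of_real pi * w) \<noteq> 0"
proof
  assume "sin (of_real pi * w) = 0"
  then obtain n where "of_real pi * w = of_real (of_int n * pi)"
    by (auto simp: sin_eq_0)
  hence "Im (of_real pi * w) = 0" by simp
  thus False using assms by simp
qed

text \<open>Logarithmic differentiation of the reflection formula
  \<open>rGamma w * rGamma (1 - w) = sin (pi w) / pi\<close>.\<close>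

lemma Digamma_reflection:
  fixes w :: complex
  assumes "Im w \<noteq> 0"
  shows "Digamma (1 - w) - Digamma w = of_real pi * cot (of_real pi * w)"
proof -
  have nz: "w \<notin> \<int>\<^sub>\<le>\<^sub>0" "1 - w \<notin> \<int>\<^sub>\<le>\<^sub>0"
    using assms by (auto elim!: nonpos_Ints_cases simp: complex_eq_iff)
  note sin_nz = sin_pi_times_nonzero[OF assms]
  have "((\<lambda>w. rGamma w * rGamma (1 - w)) has_field_derivative
          (rGamma w * rGamma (1 - w)) * (Digamma (1 - w) - Digamma w)) (at w)"
    using nz by (auto intro!: derivative_eq_intros DERIV_chain'[of _ _ _ _ rGamma] simp: algebra_simps)
  moreover have "((\<lambda>w. sin (of_real pi * w) / of_real pi) has_field_derivative cos (of_real pi * w)) (at w)"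
    by (auto intro!: derivative_eq_intros)
  ultimately have "(rGamma w * rGamma (1 - w)) * (Digamma (1 - w) - Digamma w) = cos (of_real pi * w)"
    unfolding rGamma_reflection_complex by (rule DERIV_unique)
  thus ?thesis using sin_nz
    by (simp add: rGamma_reflection_complex cot_def field_simps)
qed

text \<open>A further derivative of the Digamma reflection. The two Polygamma values are the
  one-sided series of inverse squares over \<open>n \<ge> 0\<close> and \<open>n < 0\<close>, so
  this becomes a partial fraction expansion over all integers.\<close>

lemma Trigamma_reflection:
  fixes w :: complex
  assumes "Im w \<noteq> 0"
  shows "Polygamma 1 (1 - w) + Polygamma 1 w = (of_real pi / sin (of_real pi * w))\<^sup>2"
proof -
  have nz: "w \<notin> \<int>\<^sub>\<le>\<^sub>0" "1 - w \<notin> \<int>\<^sub>\<le>\<^sub>0"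
    using assms by (auto elim!: nonpos_Ints_cases simp: complex_eq_iff)
  have op: "open {w. Im w \<noteq> (0::real)}"
    by (intro open_Collect_neq continuous_intros)
  have "((\<lambda>w. Digamma (1 - w) - Digamma w) has_field_derivative
          - (Polygamma 1 (1 - w) + Polygamma 1 w)) (at w)"
    using nz by (auto intro!: derivative_eq_intros DERIV_chain'[of _ _ _ _ Digamma] simp: algebra_simps)
  moreover have "((\<lambda>w. of_real pi * cot (of_real pi * w)) has_field_derivative
           - (of_real pi / sin (of_real pi * w))\<^sup>2) (at w)"
  proof -
    have "((\<lambda>w. cot (of_real pi * w)) has_field_derivative (- inverse ((sin (of_real pi * w))\<^sup>2)) * of_real pi) (at w)"
      by (rule DERIV_chain2[where f = cot, OF DERIV_cot])
         (auto intro!: derivative_eq_intros sin_pi_times_nonzero assms)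
    from DERIV_cmult[OF this, of "of_real pi"] show ?thesis
      by (simp add: power2_eq_square divide_inverse algebra_simps)
  qed
  hence "((\<lambda>w. Digamma (1 - w) - Digamma w) has_field_derivative
           - (of_real pi / sin (of_real pi * w))\<^sup>2) (at w)"
    by (rule has_field_derivative_transform_within_open[OF _ op])
       (use assms Digamma_reflection in auto)
  ultimately have "- (Polygamma 1 (1 - w) + Polygamma 1 w) = - (of_real pi / sin (of_real pi * w))\<^sup>2"
    by (rule DERIV_unique)
  thus ?thesis by (metis neg_equal_iff_equal)
qed

section \<open>Series over all integers\<close>

lemma summable_on_int_inverse_square:
  "(\<lambda>n::int. 1 / (1 + (real_of_int n)\<^sup>2)) summable_on UNIV"
proof -
  let ?f = "\<lambda>n::int. 1 / (1 + (real_of_int n)\<^sup>2)"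
  have s: "(\<lambda>n::nat. 1 / (1 + (real n)\<^sup>2)) summable_on UNIV"
  proof (rule summable_nonneg_imp_summable_on)
    have s0: "summable (\<lambda>n::nat. 1 / real n ^ 2)"
      using inverse_power_summable[of 2] by (simp add: field_simps)
    show "summable (\<lambda>n::nat. 1 / (1 + (real n)\<^sup>2))"
      by (rule summable_comparison_test'[OF s0, of 1])
         (auto intro!: divide_left_mono mult_pos_pos add_pos_nonneg)
  qed auto
  have 1: "?f summable_on {0..}"
    using s by (subst summable_on_reindex_bij_witness[where i = int and j = nat and T = UNIV and h = "\<lambda>n. 1 / (1 + (real n)\<^sup>2)"]) auto
  have 2: "?f summable_on {..0}"
    using s by (subst summable_on_reindex_bij_witness[where i = "\<lambda>n. - int n" and j = "\<lambda>n. nat (- n)" and T = UNIV and h = "\<lambda>n. 1 / (1 + (real n)\<^sup>2)"]) auto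
  have "UNIV = {0::int..} \<union> {..0}" by auto
  thus ?thesis using summable_on_union[OF 1 2] by simp
qed

text \<open>Bridges ordered and unordered summation: the classical values are known as limits of
  one-sided partial sums, and unordered summability, which must be known beforehand, lets them be
  glued together.\<close>

lemma has_sum_int_split:
  fixes f :: "int \<Rightarrow> complex"
  assumes "f summable_on UNIV"
    and a: "(\<lambda>n::nat. f (int n)) sums a" and b: "(\<lambda>n::nat. f (- int n - 1)) sums b"
  shows "(f has_sum (a + b)) UNIV"
proof -
  have s: "f summable_on {0..}" "f summable_on {..<0}"
    using assms(1) summable_on_subset_banach by blast+
  have "(f has_sum a) {0..}"
  proof -
    have "((\<lambda>n::nat. f (int n)) has_sum infsum f {0..}) UNIV"
      using has_sum_infsum[OF s(1)]
      by (subst has_sum_reindex_bij_witness[of _ nat int]) auto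
    thus ?thesis using a s(1) has_sum_imp_sums sums_unique2 has_sum_infsum by metis
  qed
  moreover have "(f has_sum b) {..<0}"
  proof -
    have "((\<lambda>n::nat. f (- int n - 1)) has_sum infsum f {..<0}) UNIV"
      using has_sum_infsum[OF s(2)]
      by (subst has_sum_reindex_bij_witness[of _ "\<lambda>n. nat (- n - 1)" "\<lambda>n. - int n - 1"]) auto
    thus ?thesis using b s(2) has_sum_imp_sums sums_unique2 has_sum_infsum by metis
  qed
  ultimately have "(f has_sum (a + b)) ({0..} \<union> {..<0})"
    by (intro has_sum_Un_disjoint) auto
  moreover have "{0..} \<union> {..<0} = (UNIV :: int set)" by auto
  ultimately show ?thesis by simp
qed

text \<open>Completing the square: \<open>2 (x + n)^2 + 2 x^2 - n^2 = (2 x + n)^2\<close> is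
  nonnegative for \<open>x = Re w\<close>. The remaining constant \<open>1 + 2 x^2\<close> is a
  multiple \<open>K\<close> of \<open>(Im w)^2\<close>.\<close>

lemma norm_plus_int_lower_bound:
  fixes w :: complex
  assumes "Im w \<noteq> 0"
  obtains C where "C > 0" "\<And>n::int. 1 + (real_of_int n)\<^sup>2 \<le> C * (norm (w + of_int n))\<^sup>2"
proof
  define K where "K = (1 + 2 * (Re w)\<^sup>2) / (Im w)\<^sup>2"
  have K: "K \<ge> 0" by (simp add: K_def)
  let ?C = "2 + K"
  show "?C > 0" using K by simp
  fix n :: int
  have "2 * (Re w + n)\<^sup>2 + 2 * (Re w)\<^sup>2 - (real_of_int n)\<^sup>2 = (2 * Re w + n)\<^sup>2"
    by (simp add: power2_eq_square algebra_simps)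
  hence "1 + (real_of_int n)\<^sup>2 \<le> 2 * (Re w + n)\<^sup>2 + (1 + 2 * (Re w)\<^sup>2)"
    using zero_le_power2[of "2 * Re w + n"] by linarith
  also have "\<dots> = 2 * (Re w + n)\<^sup>2 + K * (Im w)\<^sup>2"
    using assms by (simp add: K_def)
  also have "\<dots> \<le> ?C * ((Re w + n)\<^sup>2 + (Im w)\<^sup>2)"
    using mult_nonneg_nonneg[OF K zero_le_power2[of "Re w + n"]] by (simp add: distrib_left distrib_right)
  also have "(Re w + n)\<^sup>2 + (Im w)\<^sup>2 = (norm (w + of_int n))\<^sup>2"
    by (simp add: cmod_power2)
  finally show "1 + (real_of_int n)\<^sup>2 \<le> ?C * (norm (w + of_int n))\<^sup>2" .
qed

lemma summable_on_int_inverse_shift_square: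
  fixes w :: complex
  assumes "Im w \<noteq> 0"
  shows "(\<lambda>n::int. inverse ((w + of_int n)\<^sup>2)) summable_on UNIV"
proof -
  obtain C where C: "C > 0" "\<And>n::int. 1 + (real_of_int n)\<^sup>2 \<le> C * (norm (w + of_int n))\<^sup>2"
    using norm_plus_int_lower_bound[OF assms] by blast
  show ?thesis
  proof (rule abs_summable_summable, rule Infinite_Sum.abs_summable_on_comparison_test')
    show "(\<lambda>n::int. C * (1 / (1 + (real_of_int n)\<^sup>2))) summable_on UNIV"
      by (intro summable_on_cmult_right summable_on_int_inverse_square)
    fix n :: int
    have "w + of_int n \<noteq> 0" using assms by (auto simp: complex_eq_iff)
    moreover have "1 + (real_of_int n)\<^sup>2 > 0" by (intro add_pos_nonneg) auto
    ultimately show "norm (inverse ((w + of_int n)\<^sup>2)) \<le> C * (1 / (1 + (real_of_int n)\<^sup>2))"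
      using C(2)[of n] unfolding norm_inverse norm_power by (simp add: field_simps)
  qed
qed

lemma has_sum_int_inverse_square:
  fixes w :: complex
  assumes "Im w \<noteq> 0"
  shows "((\<lambda>n::int. inverse ((w + of_int n)\<^sup>2)) has_sum (of_real pi / sin (of_real pi * w))\<^sup>2) UNIV"
proof -
  have nz: "w \<noteq> 0" "1 - w \<noteq> 0" using assms by auto
  have "(\<lambda>n::nat. inverse ((w + of_int (int n))\<^sup>2)) sums Polygamma 1 w"
    using Polygamma_LIMSEQ[of w 1] nz by (simp add: eval_nat_numeral)
  moreover have "(\<lambda>n::nat. inverse ((w + of_int (- int n - 1))\<^sup>2)) sums Polygamma 1 (1 - w)"
  proof -
    have "(w + of_int (- int n - 1))\<^sup>2 = ((1 - w) + of_nat n)\<^sup>2" for n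
      by (simp add: power2_eq_square algebra_simps)
    thus ?thesis using Polygamma_LIMSEQ[of "1 - w" 1] nz by (simp add: eval_nat_numeral)
  qed
  ultimately show ?thesis
    using has_sum_int_split[OF summable_on_int_inverse_shift_square[OF assms]]
    by (simp only: add.commute Trigamma_reflection[OF assms, symmetric])
qed

text \<open>The series of \<open>1/(u + n)\<close> alone is not absolutely convergent, but the
  difference is \<open>(v - u) / ((u + n) (v + n))\<close>, of order \<open>1/n^2\<close>. Its two
  halves are differences of Digamma values, combined by the reflection formula.\<close>

lemma has_sum_int_inverse_diff:
  fixes u v :: complex
  assumes "Im u \<noteq> 0" "Im v \<noteq> 0"
  shows "((\<lambda>n::int. inverse (u + of_int n) - inverse (v + of_int n)) has_sum
           of_real pi * cot (of_real pi * u) - of_real pi * cot (of_real pi * v)) UNIV"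
proof -
  let ?f = "\<lambda>n::int. inverse (u + of_int n) - inverse (v + of_int n)"
  obtain C where C: "C > 0" "\<And>n::int. 1 + (real_of_int n)\<^sup>2 \<le> C * (norm (u + of_int n))\<^sup>2"
    using norm_plus_int_lower_bound[OF assms(1)] by blast
  obtain D where D: "D > 0" "\<And>n::int. 1 + (real_of_int n)\<^sup>2 \<le> D * (norm (v + of_int n))\<^sup>2"
    using norm_plus_int_lower_bound[OF assms(2)] by blast
  have nz: "u + of_int n \<noteq> 0" "v + of_int n \<noteq> 0" for n
    using assms by (auto simp: complex_eq_iff)
  have summ: "?f summable_on UNIV"
  proof (rule abs_summable_summable, rule Infinite_Sum.abs_summable_on_comparison_test')
    show "(\<lambda>n::int. norm (v - u) * (C + D) * (1 / (1 + (real_of_int n)\<^sup>2))) summable_on UNIV"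
      by (intro summable_on_cmult_right summable_on_int_inverse_square)
    fix n :: int
    define a b c where "a = norm (u + of_int n)" and "b = norm (v + of_int n)" and "c = 1 + (real_of_int n)\<^sup>2"
    have pos: "a > 0" "b > 0" "c > 0"
      using nz by (auto simp: a_def b_def c_def intro!: add_pos_nonneg)
    \<comment> \<open>The product \<open>a * b\<close> is at least the square of the smaller factor,
      and either square bounds \<open>c\<close> up to a constant.\<close>
    have "c \<le> (C + D) * (a * b)"
    proof (cases "a \<le> b")
      case True
      have "c \<le> C * (a * a)" using C(2)[of n] by (simp add: a_def c_def power2_eq_square)
      also have "\<dots> \<le> (C + D) * (a * b)" using C(1) D(1) True pos by (intro mult_mono) auto
      finally show ?thesis .
    next
      case False
      have "c \<le> D * (b * b)" using D(2)[of n] by (simp add: b_def c_def power2_eq_square)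
      also have "\<dots> \<le> (C + D) * (a * b)" using C(1) D(1) False pos by (intro mult_mono) auto
      finally show ?thesis .
    qed
    hence "1 / (a * b) \<le> (C + D) * (1 / c)" using pos by (simp add: field_simps)
    moreover have "?f n = (v - u) / ((u + of_int n) * (v + of_int n))"
      using nz[of n] by (simp add: field_simps)
    hence "norm (?f n) = norm (v - u) * (1 / (a * b))"
      by (simp add: norm_divide norm_mult a_def b_def)
    ultimately show "norm (?f n) \<le> norm (v - u) * (C + D) * (1 / (1 + (real_of_int n)\<^sup>2))"
      unfolding c_def by (metis mult.assoc mult_left_mono norm_ge_zero)
  qed
  \<comment> \<open>The harmonic terms and the Euler-Mascheroni constants of the two Digamma series
    cancel.\<close>
  have dg: "(\<lambda>n. inverse (x + of_nat n) - inverse (y + of_nat n)) sums (Digamma y - Digamma x)"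
    if "x \<noteq> 0" "y \<noteq> 0" for x y :: complex
    using sums_diff[OF summable_sums[OF summable_Digamma[OF that(2)]] summable_sums[OF summable_Digamma[OF that(1)]]]
    by (simp add: Digamma_def)
  have "(\<lambda>n::nat. ?f (int n)) sums (Digamma v - Digamma u)"
    using dg[of u v] assms by (cases "u = 0"; cases "v = 0") auto
  moreover have "(\<lambda>n::nat. ?f (- int n - 1)) sums (Digamma (1 - u) - Digamma (1 - v))"
  proof -
    have "1 - u \<noteq> 0" "1 - v \<noteq> 0" using assms by auto
    hence "(\<lambda>n. inverse ((1 - v) + of_nat n) - inverse ((1 - u) + of_nat n)) sums (Digamma (1 - u) - Digamma (1 - v))"
      by (rule dg[rotated])
    moreover have "?f (- int n - 1) = inverse ((1 - v) + of_nat n) - inverse ((1 - u) + of_nat n)" for n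
    proof -
      have "x + of_int (- int n - 1) = - ((1 - x) + of_nat n)" for x :: complex by simp
      thus ?thesis by (simp only: inverse_minus_eq) simp
    qed
    ultimately show ?thesis by simp
  qed
  ultimately have "(?f has_sum (Digamma v - Digamma u + (Digamma (1 - u) - Digamma (1 - v)))) UNIV"
    by (rule has_sum_int_split[OF summ])
  moreover have "Digamma v - Digamma u + (Digamma (1 - u) - Digamma (1 - v)) =
      of_real pi * cot (of_real pi * u) - of_real pi * cot (of_real pi * v)"
    using Digamma_reflection[OF assms(1)] Digamma_reflection[OF assms(2)] by (simp add: algebra_simps)
  ultimately show ?thesis by simp
qed

subsection \<open>Inversion of the Eisenstein series of weight 2\<close>

text \<open>The squared norm of \<open>m + n z\<close> is a positive definite quadratic form in
  \<open>(m, n)\<close>; the square completed in the one-variable estimate, with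
  \<open>n * Re z\<close> as the shift, makes the constant explicit.\<close>

lemma norm_lattice_lower_bound:
  fixes z :: complex
  assumes "Im z \<noteq> 0"
  obtains C where "C \<ge> 2"
    "\<And>m n::int. (real_of_int m)\<^sup>2 + (real_of_int n)\<^sup>2 \<le> C * (norm (of_int m + of_int n * z))\<^sup>2"
proof
  define K where "K = (1 + 2 * (Re z)\<^sup>2) / (Im z)\<^sup>2"
  have K: "K \<ge> 0" by (simp add: K_def)
  let ?C = "2 + K"
  show "?C \<ge> 2" using K by simp
  fix m n :: int
  have "2 * (m + n * Re z)\<^sup>2 + 2 * (n * Re z)\<^sup>2 - (real_of_int m)\<^sup>2 = (m + 2 * n * Re z)\<^sup>2"
    by (simp add: power2_eq_square algebra_simps)
  hence "(real_of_int m)\<^sup>2 + (real_of_int n)\<^sup>2 \<le> 2 * (m + n * Re z)\<^sup>2 + (1 + 2 * (Re z)\<^sup>2) * (real_of_int n)\<^sup>2"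
    using zero_le_power2[of "m + 2 * n * Re z"] by (simp add: algebra_simps power_mult_distrib)
  also have "\<dots> = 2 * (m + n * Re z)\<^sup>2 + K * (n * Im z)\<^sup>2"
    using assms by (simp add: K_def power_mult_distrib)
  also have "\<dots> \<le> ?C * ((m + n * Re z)\<^sup>2 + (n * Im z)\<^sup>2)"
    using mult_nonneg_nonneg[OF K zero_le_power2[of "m + n * Re z"]] by (simp add: distrib_left distrib_right)
  also have "(m + n * Re z)\<^sup>2 + (n * Im z)\<^sup>2 = (norm (of_int m + of_int n * z))\<^sup>2"
    by (simp add: cmod_power2)
  finally show "(real_of_int m)\<^sup>2 + (real_of_int n)\<^sup>2 \<le> ?C * (norm (of_int m + of_int n * z))\<^sup>2" .
qed

lemma lattice_point_eq_0_iff: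
  fixes z :: complex and m n :: int
  assumes "Im z \<noteq> 0"
  shows "of_int m + of_int n * z = 0 \<longleftrightarrow> m = 0 \<and> n = 0"
proof
  assume "of_int m + of_int n * z = 0"
  hence "Im (of_int m + of_int n * z) = 0" "Re (of_int m + of_int n * z) = 0" by simp_all
  thus "m = 0 \<and> n = 0" using assms by auto
qed auto

text \<open>Eisenstein's regularisation: the subtracted term telescopes in both directions, and it is
  finite at the origin, where \<open>inverse 0 = 0\<close> removes the singular term of the first sum.\<close>
definition eis_term :: "complex \<Rightarrow> int \<Rightarrow> int \<Rightarrow> complex" where
  "eis_term z m n = inverse ((of_int m + of_int n * z)\<^sup>2) -
     (inverse (of_int m - 1/2 + of_int n * z) - inverse (of_int m + 1/2 + of_int n * z))"

text \<open>Away from the origin the term is \<open>-1/4\<close> divided by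
  \<open>w^2 (w^2 - 1/4)\<close>, hence \<open>O(1/N^2)\<close>. As
  \<open>(1 + m^2) (1 + n^2) \<le> N^2\<close>, a product of two convergent single series majorises
  it.\<close>

lemma eis_term_summable:
  assumes "Im z \<noteq> 0"
  shows "(\<lambda>(m, n). eis_term z m n) summable_on UNIV \<times> UNIV"
proof -
  obtain C where C: "C \<ge> 2"
    "\<And>m n::int. (real_of_int m)\<^sup>2 + (real_of_int n)\<^sup>2 \<le> C * (norm (of_int m + of_int n * z))\<^sup>2"
    using norm_lattice_lower_bound[OF assms] by blast
  define a where "a = (\<lambda>n::int. 1 / (1 + (real_of_int n)\<^sup>2))"
  have a: "a summable_on UNIV" unfolding a_def by (rule summable_on_int_inverse_square)
  have aa: "(\<lambda>(m, n). a m * a n) summable_on UNIV \<times> UNIV"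
  proof (rule summable_on_SigmaI)
    show "((\<lambda>n. case (m, n) of (m, n) \<Rightarrow> a m * a n) has_sum a m * infsum a UNIV) UNIV" for m
      using has_sum_cmult_right[OF has_sum_infsum[OF a], of "a m"] by simp
    show "(\<lambda>m. a m * infsum a UNIV) summable_on UNIV"
      by (intro summable_on_cmult_left a)
  qed (auto simp: a_def)
  show ?thesis
  proof (rule abs_summable_summable, rule Infinite_Sum.abs_summable_on_comparison_test')
    show "(\<lambda>(m, n). 4 * C\<^sup>2 * (a m * a n)) summable_on UNIV \<times> UNIV"
      using summable_on_cmult_right[OF aa, of "4 * C\<^sup>2"] by (simp add: case_prod_unfold)
    fix x :: "int \<times> int" assume "x \<in> UNIV \<times> UNIV"
    obtain m n where x: "x = (m, n)" by (cases x)
    define w where "w = of_int m + of_int n * z"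
    define N where "N = 1 + (real_of_int m)\<^sup>2 + (real_of_int n)\<^sup>2"
    have N: "N \<ge> 1" by (simp add: N_def)
    have bound: "4 * C\<^sup>2 / N\<^sup>2 \<le> 4 * C\<^sup>2 * (a m * a n)"
    proof -
      have "(1 + (real_of_int m)\<^sup>2) * (1 + (real_of_int n)\<^sup>2) \<le> N\<^sup>2"
        using zero_le_power2[of "real_of_int m"] zero_le_power2[of "real_of_int n"]
        unfolding N_def power2_eq_square[of "1 + _ + _"] by (intro mult_mono) auto
      moreover have "(1 + (real_of_int m)\<^sup>2) * (1 + (real_of_int n)\<^sup>2) > 0"
        by (intro mult_pos_pos add_pos_nonneg) auto
      ultimately have "1 / N\<^sup>2 \<le> 1 / ((1 + (real_of_int m)\<^sup>2) * (1 + (real_of_int n)\<^sup>2))"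
        by (intro divide_left_mono mult_pos_pos[of _ "N\<^sup>2"]) (use N in auto)
      from mult_left_mono[OF this, of "4 * C\<^sup>2"] show ?thesis by (simp add: a_def)
    qed
    \<comment> \<open>Twice the shifted point is the lattice point with coordinates
      \<open>2 m + e\<close> and \<open>2 n\<close>. The first is odd, so the point is never 0 and
      the lattice bound applies.\<close>
    have half: "N \<le> 8 * C * (norm (w + of_int e / 2))\<^sup>2" if e: "e = 1 \<or> e = -1" for e :: int
    proof -
      have "w + of_int e / 2 = (of_int (2 * m + e) + of_int (2 * n) * z) / 2"
        by (simp add: w_def field_simps)
      hence eq: "(norm (w + of_int e / 2))\<^sup>2 = (norm (of_int (2 * m + e) + of_int (2 * n) * z))\<^sup>2 / 4"
        by (simp only: norm_divide power_divide norm_numeral) simp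
      \<comment> \<open>With \<open>e^2 = 1\<close> this product equals
        \<open>2 (2 m + e)^2 - (1 + m^2)\<close>.\<close>
      have "0 \<le> (7 * m + e) * (m + e)"
        using e by (cases "m \<ge> 1"; cases "m \<le> -1") (auto intro: mult_nonneg_nonneg mult_nonpos_nonpos)
      hence "1 + m\<^sup>2 \<le> 2 * (2 * m + e)\<^sup>2"
        using e by (auto simp: power2_eq_square algebra_simps)
      hence "1 + m\<^sup>2 + n\<^sup>2 \<le> 2 * ((2 * m + e)\<^sup>2 + (2 * n)\<^sup>2)"
      proof -
        have "a \<le> 2 * b \<Longrightarrow> 0 \<le> c \<Longrightarrow> a + c \<le> 2 * (b + 4 * c)" for a b c :: int by presburger
        from this[OF \<open>1 + m\<^sup>2 \<le> 2 * (2 * m + e)\<^sup>2\<close> zero_le_power2[of n]] show ?thesis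
          by (simp add: power_mult_distrib)
      qed
      hence "real_of_int (1 + m\<^sup>2 + n\<^sup>2) \<le> real_of_int (2 * ((2 * m + e)\<^sup>2 + (2 * n)\<^sup>2))"
        by (simp only: of_int_le_iff)
      hence "N \<le> 2 * ((real_of_int (2 * m + e))\<^sup>2 + (real_of_int (2 * n))\<^sup>2)"
        by (simp add: N_def)
      also have "\<dots> \<le> 2 * (C * (norm (of_int (2 * m + e) + of_int (2 * n) * z))\<^sup>2)"
        by (intro mult_left_mono C(2)) auto
      finally show ?thesis by (simp add: eq)
    qed
    have Qn: "N \<le> 8 * C * (norm (w - 1/2) * norm (w + 1/2))"
    proof -
      have "N\<^sup>2 \<le> (8 * C * (norm (w - 1/2))\<^sup>2) * (8 * C * (norm (w + 1/2))\<^sup>2)"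
        unfolding power2_eq_square[of N] using half[of 1] half[of "-1"] N by (intro mult_mono) auto
      also have "\<dots> = (8 * C * (norm (w - 1/2) * norm (w + 1/2)))\<^sup>2"
        by (simp add: power2_eq_square)
      finally show ?thesis by (rule power2_le_imp_le) (use C(1) in auto)
    qed
    have nz: "w - 1/2 \<noteq> 0" "w + 1/2 \<noteq> 0"
    proof -
      have "norm (w - 1/2) * norm (w + 1/2) \<noteq> 0"
      proof
        assume "norm (w - 1/2) * norm (w + 1/2) = 0"
        hence "N \<le> 0" using Qn by (simp only: mult_zero_right)
        thus False using N by simp
      qed
      thus "w - 1/2 \<noteq> 0" "w + 1/2 \<noteq> 0" by (metis mult_eq_0_iff norm_eq_zero)+
    qed
    have et: "eis_term z m n = inverse (w\<^sup>2) - (inverse (w - 1/2) - inverse (w + 1/2))"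
      by (simp add: eis_term_def w_def algebra_simps)
    have "norm (eis_term z m n) \<le> 4 * C\<^sup>2 / N\<^sup>2"
    proof (cases "w = 0")
      \<comment> \<open>Here \<open>N = 1\<close> and the term equals 4: the first summand is
        \<open>inverse 0 = 0\<close>, and the half-shifted ones give \<open>2 + 2\<close>.\<close>
      case True
      hence "m = 0" "n = 0" using lattice_point_eq_0_iff[OF assms] by (auto simp: w_def)
      hence "N = 1" by (simp add: N_def)
      moreover have "4 \<le> 4 * C\<^sup>2" using C(1) power_mono[of 1 C 2] by simp
      ultimately show ?thesis using True by (simp add: et)
    next
      case False
      hence "\<not> (m = 0 \<and> n = 0)" using lattice_point_eq_0_iff[OF assms] by (auto simp: w_def)
      hence "m\<^sup>2 + n\<^sup>2 \<ge> 1"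
        by (metis add_nonneg_nonneg int_one_le_iff_zero_less order_less_le sum_power2_eq_zero_iff zero_le_power2)
      hence "real_of_int (m\<^sup>2 + n\<^sup>2) \<ge> 1" by linarith
      hence Pn: "N \<le> 2 * C * (norm w)\<^sup>2" using C(2)[of m n] by (simp add: N_def w_def)
      have "eis_term z m n = - (1/4) / (w\<^sup>2 * ((w - 1/2) * (w + 1/2)))"
      proof -
        have "inverse (w - 1/2) - inverse (w + 1/2) = 1 / ((w - 1/2) * (w + 1/2))"
        proof -
          have "inverse a - inverse b = (b - a) / (a * b)" if "a \<noteq> 0" "b \<noteq> 0" for a b :: complex
            using that by (simp add: field_simps)
          from this[OF nz] show ?thesis by simp
        qed
        moreover have "inverse (w\<^sup>2) - 1 / v = (v - w\<^sup>2) / (w\<^sup>2 * v)" if "v \<noteq> 0" for v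
          using that False by (simp add: field_simps)
        moreover have "(w - 1/2) * (w + 1/2) - w\<^sup>2 = - (1/4)"
          by (simp add: power2_eq_square algebra_simps)
        ultimately show ?thesis using nz unfolding et by simp
      qed
      hence "norm (eis_term z m n) = (1/4) / ((norm w)\<^sup>2 * (norm (w - 1/2) * norm (w + 1/2)))"
        by (simp add: norm_divide norm_mult norm_power)
      also have "\<dots> \<le> (1/4) / ((N / (2 * C)) * (N / (8 * C)))"
        using Pn Qn C(1) N by (intro divide_left_mono mult_mono mult_pos_pos) (auto simp: field_simps)
      also have "\<dots> = 4 * C\<^sup>2 / N\<^sup>2"
        using C(1) N by (simp add: field_simps power2_eq_square)
      finally show ?thesis .
    qed
    with bound show "norm (case x of (m, n) \<Rightarrow> eis_term z m n) \<le> (case x of (m, n) \<Rightarrow> 4 * C\<^sup>2 * (a m * a n))"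
      by (simp add: x)
  qed
qed

lemma has_sum_int_symmetric_partial_sums:
  fixes f :: "int \<Rightarrow> complex"
  assumes "(f has_sum s) UNIV"
  shows "(\<lambda>N::nat. \<Sum>n\<in>{-int N..int N}. f n) \<longlonglongrightarrow> s"
proof -
  have "filterlim (\<lambda>N::nat. {-int N..int N}) (finite_subsets_at_top UNIV) sequentially"
  proof (rule filterlim_finite_subsets_at_top[THEN iffD2], safe)
    fix X :: "int set" assume "finite X"
    then obtain b where b: "\<And>x. x \<in> X \<Longrightarrow> \<bar>x\<bar> \<le> b"
      by (metis finite_has_maximal finite_imageI image_is_empty imageI bdd_above_finite bdd_above_def)
    show "\<forall>\<^sub>F N in sequentially. finite {-int N..int N} \<and> X \<subseteq> {-int N..int N} \<and> {-int N..int N} \<subseteq> UNIV"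
      using eventually_ge_at_top[of "nat b"] by eventually_elim (use b in force)
  qed
  thus ?thesis using assms unfolding has_sum_def by (rule filterlim_compose[rotated])
qed

text \<open>Symmetric partial sums telescope. The two ends have separate limits because for the
  cotangents below they differ, and their difference is what matters.\<close>

lemma has_sum_int_telescope:
  fixes c :: "int \<Rightarrow> complex"
  assumes "(\<lambda>m. c m - c (m + 1)) summable_on UNIV"
    and a: "(\<lambda>N::nat. c (- int N)) \<longlonglongrightarrow> a" and b: "(\<lambda>N::nat. c (int N + 1)) \<longlonglongrightarrow> b"
  shows "((\<lambda>m. c m - c (m + 1)) has_sum (a - b)) UNIV"
proof -
  let ?f = "\<lambda>m. c m - c (m + 1)"
  have "(\<lambda>N::nat. \<Sum>n\<in>{-int N..int N}. ?f n) \<longlonglongrightarrow> infsum ?f UNIV"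
    by (intro has_sum_int_symmetric_partial_sums has_sum_infsum assms)
  moreover have "(\<Sum>n\<in>{-int N..int N}. ?f n) = c (- int N) - c (int N + 1)" for N
  proof (induction N)
    case (Suc N)
    have "{-int (Suc N)..int (Suc N)} = insert (int N + 1) (insert (- 1 - int N) {-int N..int N})"
      by auto
    thus ?case using Suc by (simp add: algebra_simps)
  qed simp
  ultimately have "(\<lambda>N. c (- int N) - c (int N + 1)) \<longlonglongrightarrow> infsum ?f UNIV" by simp
  hence "infsum ?f UNIV = a - b"
    using tendsto_diff[OF a b] LIMSEQ_unique by blast
  thus ?thesis using assms(1) has_sum_infsum by metis
qed

text \<open>The convention \<open>inverse 0 = 0\<close> removes the term \<open>m = 0\<close>, and
  each half contributes \<open>pi^2 / 6\<close>.\<close>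

lemma has_sum_int_inverse_squares:
  "((\<lambda>m::int. inverse ((of_int m)\<^sup>2 :: complex)) has_sum (of_real pi)\<^sup>2 / 3) UNIV"
proof -
  let ?f = "\<lambda>m::int. inverse ((of_int m)\<^sup>2 :: complex)"
  have summ: "?f summable_on UNIV"
  proof (rule abs_summable_summable, rule Infinite_Sum.abs_summable_on_comparison_test')
    show "(\<lambda>n::int. 2 * (1 / (1 + (real_of_int n)\<^sup>2))) summable_on UNIV"
      by (intro summable_on_cmult_right summable_on_int_inverse_square)
    fix n :: int
    show "norm (?f n) \<le> 2 * (1 / (1 + (real_of_int n)\<^sup>2))"
    proof (cases "n = 0")
      case False
      hence "n\<^sup>2 \<ge> 1" by (metis int_one_le_iff_zero_less zero_less_power2)
      hence "(real_of_int n)\<^sup>2 \<ge> 1"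
        by (metis of_int_1_le_iff of_int_power)
      thus ?thesis using False unfolding norm_inverse norm_power norm_of_int by (simp add: field_simps)
    qed simp
  qed
  have "(\<lambda>n. complex_of_real (1 / (real n + 1)\<^sup>2)) sums complex_of_real (pi\<^sup>2 / 6)"
    using inverse_squares_sums by (subst sums_of_real_iff) (simp add: add.commute)
  hence s: "(\<lambda>n::nat. inverse ((of_nat n + 1)\<^sup>2)) sums ((of_real pi)\<^sup>2 / 6 :: complex)"
    by (simp add: field_simps)
  have "(\<lambda>n::nat. ?f (int n)) sums ((of_real pi)\<^sup>2 / 6)"
    using sums_Suc[of "\<lambda>n. ?f (int n)"] s by (simp add: add.commute)
  moreover have "(\<lambda>n::nat. ?f (- int n - 1)) sums ((of_real pi)\<^sup>2 / 6)"
  proof -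
    have "(of_int (- int n - 1))\<^sup>2 = ((of_nat n + 1)\<^sup>2 :: complex)" for n
      by (simp add: power2_eq_square algebra_simps)
    thus ?thesis using s by simp
  qed
  ultimately have "(?f has_sum ((of_real pi)\<^sup>2 / 6 + (of_real pi)\<^sup>2 / 6)) UNIV"
    by (rule has_sum_int_split[OF summ])
  thus ?thesis by simp
qed

section \<open>Row and column sums of the lattice series\<close>

text \<open>The closed form of the sum of \<open>1/(m + n z)^2\<close> over \<open>m\<close>. For
  \<open>n = 0\<close> the origin is left out, so the value is twice zeta(2).\<close>

definition eis_row :: "complex \<Rightarrow> int \<Rightarrow> complex" where
  "eis_row z n = (if n = 0 then (of_real pi)\<^sup>2 / 3 else (of_real pi / sin (of_real pi * (of_int n * z)))\<^sup>2)"

lemma eis_row_has_sum: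
  assumes "Im z \<noteq> 0"
  shows "((\<lambda>m::int. inverse ((of_int m + of_int n * z)\<^sup>2)) has_sum eis_row z n) UNIV"
proof (cases "n = 0")
  case False
  hence "Im (of_int n * z) \<noteq> 0" using assms by simp
  from has_sum_int_inverse_square[OF this] show ?thesis using False
    by (simp add: eis_row_def add.commute)
qed (use has_sum_int_inverse_squares in \<open>simp add: eis_row_def\<close>)

lemma eis_row_minus_inverse:
  assumes "z \<noteq> 0"
  shows "eis_row (- 1 / z) m = (if m = 0 then (of_real pi)\<^sup>2 / 3 else (of_real pi / sin (of_real pi * (of_int m / z)))\<^sup>2)"
  by (simp add: eis_row_def power_divide)

text \<open>Taking out the factor \<open>z\<close> from \<open>m + n z = (m/z + n) z\<close> makes
  the column of \<open>z\<close> a row of \<open>-1/z\<close>; the sign disappears because the sine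
  is squared.\<close>

lemma eis_column_has_sum:
  assumes "Im z \<noteq> 0"
  shows "((\<lambda>n::int. inverse ((of_int m + of_int n * z)\<^sup>2)) has_sum eis_row (- 1 / z) m / z\<^sup>2) UNIV"
proof -
  have z: "z \<noteq> 0" using assms by auto
  have "((\<lambda>n::int. inverse ((of_int m / z + of_int n)\<^sup>2)) has_sum eis_row (- 1 / z) m) UNIV"
  proof (cases "m = 0")
    case False
    have "Im (of_int m / z) \<noteq> 0" using assms False by (simp add: Im_divide)
    from has_sum_int_inverse_square[OF this] show ?thesis using False z
      by (subst eis_row_minus_inverse) simp_all
  qed (use has_sum_int_inverse_squares in \<open>simp add: eis_row_def\<close>)
  from has_sum_divide_const[OF this, of "z\<^sup>2"]
  have "((\<lambda>n::int. inverse ((of_int m / z + of_int n)\<^sup>2) / z\<^sup>2) has_sum eis_row (- 1 / z) m / z\<^sup>2) UNIV" .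
  moreover have "inverse ((of_int m / z + of_int n)\<^sup>2) / z\<^sup>2 = inverse ((of_int m + of_int n * z)\<^sup>2)" for n
  proof -
    have "of_int m + of_int n * z = (of_int m / z + of_int n) * z" using z by (simp add: field_simps)
    thus ?thesis by (simp add: power_mult_distrib divide_inverse inverse_mult_distrib)
  qed
  ultimately show ?thesis by simp
qed

lemma inverse_add_of_nat_tendsto_0:
  fixes w :: complex
  shows "(\<lambda>N::nat. inverse (w + of_nat N)) \<longlonglongrightarrow> 0" "(\<lambda>N::nat. inverse (w - of_nat N)) \<longlonglongrightarrow> 0"
proof -
  have *: "(\<lambda>N::nat. inverse (w + of_nat N)) \<longlonglongrightarrow> 0" for w :: complex
    by (intro filterlim_compose[OF tendsto_inverse_0] tendsto_add_filterlim_at_infinity[OF tendsto_const] tendsto_of_nat)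
  show "(\<lambda>N::nat. inverse (w + of_nat N)) \<longlonglongrightarrow> 0" by (rule *)
  have "inverse (w - of_nat N) = - inverse (- w + of_nat N)" for N
    by (metis inverse_minus_eq minus_diff_eq uminus_add_conv_diff)
  thus "(\<lambda>N::nat. inverse (w - of_nat N)) \<longlonglongrightarrow> 0"
    using tendsto_minus[OF *[of "-w"]] by simp
qed

text \<open>Summing over \<open>m\<close> first, the correction telescopes with limit 0 at both
  ends. The row sums are therefore those of the original series, and absolute convergence identifies
  their total with the unordered double sum.\<close>

lemma eis_term_sum_rows:
  assumes "Im z \<noteq> 0"
  shows "(eis_row z has_sum infsum (\<lambda>(m, n). eis_term z m n) (UNIV \<times> UNIV)) UNIV"
proof (rule has_sum_SigmaD)
  let ?S = "infsum (\<lambda>(m, n). eis_term z m n) (UNIV \<times> UNIV)"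
  have "((\<lambda>(m, n). eis_term z m n) has_sum ?S) (UNIV \<times> UNIV)"
    by (intro has_sum_infsum eis_term_summable assms)
  hence S: "((\<lambda>(n, m). eis_term z m n) has_sum ?S) (UNIV \<times> UNIV)"
    by (subst (asm) has_sum_swap) (simp add: case_prod_unfold)
  thus "((\<lambda>(n, m). eis_term z m n) has_sum ?S) (Sigma UNIV (\<lambda>_. UNIV))" .
  fix n :: int
  have "(\<lambda>m. eis_term z m n) summable_on UNIV"
    using summable_on_SigmaD1[OF has_sum_imp_summable[OF S], of n] by simp
  from summable_on_add[OF has_sum_imp_summable[OF eis_row_has_sum[OF assms, of n]] summable_on_uminus[THEN iffD2, OF this]]
  have summ: "(\<lambda>m. inverse (of_int m - 1/2 + of_int n * z) - inverse (of_int (m + 1) - 1/2 + of_int n * z)) summable_on UNIV"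
    by (rule summable_on_cong[THEN iffD1, rotated]) (simp add: eis_term_def algebra_simps)
  have "((\<lambda>m. inverse (of_int m - 1/2 + of_int n * z) - inverse (of_int (m + 1) - 1/2 + of_int n * z)) has_sum (0 - 0)) UNIV"
  proof (rule has_sum_int_telescope[OF summ])
    show "(\<lambda>N. inverse (of_int (- int N) - 1/2 + of_int n * z)) \<longlonglongrightarrow> 0"
      using inverse_add_of_nat_tendsto_0(2)[of "- 1/2 + of_int n * z"] by (simp add: algebra_simps)
    show "(\<lambda>N. inverse (of_int (int N + 1) - 1/2 + of_int n * z)) \<longlonglongrightarrow> 0"
      using inverse_add_of_nat_tendsto_0(1)[of "1/2 + of_int n * z"] by (simp add: algebra_simps)
  qed
  from has_sum_add[OF eis_row_has_sum[OF assms, of n] has_sum_uminusI[OF this]]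
  have "((\<lambda>m. eis_term z m n) has_sum eis_row z n) UNIV"
    by (subst (asm) has_sum_cong[of _ _ "\<lambda>m. eis_term z m n"]) (simp_all add: eis_term_def algebra_simps)
  thus "((\<lambda>m. case (n, m) of (n, m) \<Rightarrow> eis_term z m n) has_sum eis_row z n) UNIV" by simp
qed

text \<open>For \<open>z\<close> in the upper half-plane \<open>1/z\<close> lies in the lower one,
  so the imaginary part of the argument tends to minus infinity, where the cotangent tends to
  \<open>\<i>\<close>. The number \<open>r\<close> is the geometric ratio of this
  convergence.\<close>

lemma cot_pi_scaled_tendsto:
  assumes "Im z > 0"
  shows "(\<lambda>N::nat. cot (of_real pi * ((of_nat N + 1/2) / z))) \<longlonglongrightarrow> \<i>"
proof -
  define r where "r = exp (- 2 * of_real pi * \<i> / z)"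
  have z: "z \<noteq> 0" using assms by auto
  have r: "norm r < 1"
  proof -
    have "Re (- 2 * of_real pi * \<i> / z) = - 2 * pi * Im z / (norm z)\<^sup>2"
      by (simp add: Re_divide cmod_power2)
    also have "\<dots> < 0" using assms z by (auto intro!: divide_neg_pos mult_pos_pos)
    finally show ?thesis by (simp add: r_def)
  qed
  have eq: "cot (of_real pi * ((of_nat N + 1/2) / z)) = \<i> * (1 + exp (- of_real pi * \<i> / z) * r ^ N) / (1 - exp (- of_real pi * \<i> / z) * r ^ N)" for N
  proof -
    define w where "w = of_real pi * ((of_nat N + 1/2) / z)"
    have "- of_real pi * \<i> / z + of_nat N * (- 2 * of_real pi * \<i> / z) = - 2 * \<i> * w"
      using z by (simp add: w_def divide_simps) (simp add: algebra_simps)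
    hence "exp (- of_real pi * \<i> / z) * r ^ N = exp (- 2 * \<i> * w)"
      unfolding r_def exp_of_nat_mult[symmetric] exp_add[symmetric] by (simp only:)
    moreover have "cot w = \<i> * (1 + exp (- 2 * \<i> * w)) / (1 - exp (- 2 * \<i> * w))"
    proof -
      have e: "exp (- 2 * \<i> * w) = exp (- (\<i> * w)) * exp (- (\<i> * w))" by (simp add: exp_add[symmetric] mult.assoc)
      have e1: "exp (\<i> * w) * exp (- (\<i> * w)) = 1" by (simp add: exp_add[symmetric])
      define a b where "a = exp (\<i> * w)" and "b = exp (- (\<i> * w))"
      have ab: "a * b = 1" using e1 by (simp add: a_def b_def)
      have nz: "b \<noteq> 0" by (simp add: b_def)
      have "cot w = ((a + b) / 2) / ((a - b) / (2 * \<i>))"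
        by (simp add: cot_def cos_exp_eq sin_exp_eq a_def b_def)
      also have "\<dots> = \<i> * (a + b) / (a - b)" unfolding divide_divide_eq_right by simp
      also have "\<dots> = \<i> * ((a + b) * b) / ((a - b) * b)" using nz by simp
      also have "\<dots> = \<i> * (1 + b * b) / (1 - b * b)" using ab by (simp add: algebra_simps)
      finally show ?thesis unfolding e b_def .
    qed
    ultimately show ?thesis by (simp add: w_def)
  qed
  have "(\<lambda>N. \<i> * (1 + exp (- of_real pi * \<i> / z) * r ^ N) / (1 - exp (- of_real pi * \<i> / z) * r ^ N)) \<longlonglongrightarrow>
     \<i> * (1 + exp (- of_real pi * \<i> / z) * 0) / (1 - exp (- of_real pi * \<i> / z) * 0)"
    by (intro tendsto_intros LIMSEQ_power_zero r) auto
  thus ?thesis unfolding eq by simp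
qed

text \<open>This is \<open>G\<^sub>2\<close>.\<close>
definition eis2 :: "complex \<Rightarrow> complex" where
  "eis2 z = infsum (eis_row z) UNIV"

lemma eis2_has_sum: "Im z \<noteq> 0 \<Longrightarrow> (eis_row z has_sum eis2 z) UNIV"
  using eis_term_sum_rows has_sum_imp_summable unfolding eis2_def by (intro has_sum_infsum) blast

text \<open>The same absolutely convergent array is summed by columns. There the correction is
  \<open>k m - k (m + 1)\<close>, and \<open>k\<close> tends to \<open>- pi \<i> / z\<close> and
  \<open>pi \<i> / z\<close> at the two ends; the difference of these limits is the extra
  term.\<close>

lemma eis2_inversion:
  assumes "Im z > 0"
  shows "eis2 (- 1 / z) / z\<^sup>2 = eis2 z - 2 * of_real pi * \<i> / z"
proof -
  have z: "z \<noteq> 0" and im: "Im z \<noteq> 0" using assms by auto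
  have im': "Im (- 1 / z) \<noteq> 0" using assms z by (simp add: Im_divide)
  define k where "k = (\<lambda>m::int. of_real pi * cot (of_real pi * ((of_int m - 1/2) / z)) / z)"
  let ?S = "infsum (\<lambda>(m, n). eis_term z m n) (UNIV \<times> UNIV)"
  have S_eq: "?S = eis2 z"
    using eis_term_sum_rows[OF im] eis2_has_sum[OF im] has_sum_unique by blast
  have S: "((\<lambda>(m, n). eis_term z m n) has_sum ?S) (UNIV \<times> UNIV)"
    by (intro has_sum_infsum eis_term_summable im)
  have cols: "((\<lambda>m. eis_row (- 1 / z) m / z\<^sup>2 - (k m - k (m + 1))) has_sum ?S) UNIV"
  proof (rule has_sum_SigmaD)
    show "((\<lambda>(m, n). eis_term z m n) has_sum ?S) (Sigma UNIV (\<lambda>_. UNIV))" by (rule S)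
    fix m :: int
    have imh: "Im ((of_int m - 1/2) / z) \<noteq> 0" "Im ((of_int (m + 1) - 1/2) / z) \<noteq> 0"
    proof -
      have "Im (of_real x / z) \<noteq> 0" if "x \<noteq> 0" for x
        using that assms z by (simp add: Im_divide)
      moreover have "real_of_int m - 1/2 \<noteq> 0" for m
      proof
        assume "real_of_int m - 1/2 = 0"
        hence "real_of_int (2 * m) = real_of_int 1" by simp
        hence "2 * m = 1" by (simp only: of_int_eq_iff)
        thus False by presburger
      qed
      ultimately have "Im (of_real (real_of_int m - 1/2) / z) \<noteq> 0" "Im (of_real (real_of_int (m + 1) - 1/2) / z) \<noteq> 0"
        by blast+
      thus "Im ((of_int m - 1/2) / z) \<noteq> 0" "Im ((of_int (m + 1) - 1/2) / z) \<noteq> 0" by simp_all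
    qed
    from has_sum_divide_const[OF has_sum_int_inverse_diff[OF imh], of z]
    have "((\<lambda>n. (inverse ((of_int m - 1/2) / z + of_int n) - inverse ((of_int (m + 1) - 1/2) / z + of_int n)) / z)
            has_sum (k m - k (m + 1))) UNIV"
      by (simp only: k_def diff_divide_distrib[of _ _ z])
    note sum = has_sum_add[OF eis_column_has_sum[OF im, of m] has_sum_uminusI[OF this]]
    have *: "inverse (x / z + of_int n) / z = inverse (x + of_int n * z)" for x and n :: int
    proof -
      have "x + of_int n * z = (x / z + of_int n) * z" using z by (simp add: field_simps)
      thus ?thesis by (simp add: divide_inverse inverse_mult_distrib)
    qed
    have "inverse ((of_int m + of_int n * z)\<^sup>2) + - ((inverse ((of_int m - 1/2) / z + of_int n) -
             inverse ((of_int (m + 1) - 1/2) / z + of_int n)) / z) = eis_term z m n" for n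
      unfolding diff_divide_distrib[of "inverse _" "inverse _"] * eis_term_def by (simp add: algebra_simps)
    with sum have "((\<lambda>n. eis_term z m n) has_sum (eis_row (- 1 / z) m / z\<^sup>2 - (k m - k (m + 1)))) UNIV"
      by (simp only: diff_conv_add_uminus[of "eis_row (- 1 / z) m / z\<^sup>2"])
    thus "((\<lambda>n. case (m, n) of (m, n) \<Rightarrow> eis_term z m n) has_sum (eis_row (- 1 / z) m / z\<^sup>2 - (k m - k (m + 1)))) UNIV"
      by simp
  qed
  have rows': "((\<lambda>m. eis_row (- 1 / z) m / z\<^sup>2) has_sum eis2 (- 1 / z) / z\<^sup>2) UNIV"
    by (intro has_sum_divide_const eis2_has_sum im')
  from has_sum_add[OF rows' has_sum_uminusI[OF cols]]
  have k_sum: "((\<lambda>m. k m - k (m + 1)) has_sum (eis2 (- 1 / z) / z\<^sup>2 - ?S)) UNIV"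
    by simp
  have "(\<lambda>N. of_real pi * cot (of_real pi * ((of_nat N + 1/2) / z)) / z) \<longlonglongrightarrow> of_real pi * \<i> / z"
    by (intro tendsto_intros cot_pi_scaled_tendsto assms z)
  hence k_lim: "(\<lambda>N. k (int N + 1)) \<longlonglongrightarrow> of_real pi * \<i> / z"
    by (simp add: k_def algebra_simps)
  \<comment> \<open>The shift by a half is symmetric: \<open>- N - 1/2\<close> is the negative of
    \<open>(N + 1) - 1/2\<close>. Since the cotangent is odd, one limit gives the other.\<close>
  have "k (- int N) = - k (int N + 1)" for N
  proof -
    have "of_int (- int N) - 1/2 = - (of_int (int N + 1) - 1/2 :: complex)" by simp
    hence "of_real pi * ((of_int (- int N) - 1/2) / z) = - (of_real pi * ((of_int (int N + 1) - 1/2) / z))"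
      by (simp only: minus_divide_left[symmetric] mult_minus_right)
    thus ?thesis unfolding k_def by (simp only: cot_minus) simp
  qed
  hence k_lim': "(\<lambda>N. k (- int N)) \<longlonglongrightarrow> - (of_real pi * \<i> / z)"
    using tendsto_minus[OF k_lim] by simp
  have "((\<lambda>m. k m - k (m + 1)) has_sum (- (of_real pi * \<i> / z) - of_real pi * \<i> / z)) UNIV"
    by (rule has_sum_int_telescope[OF has_sum_imp_summable[OF k_sum] k_lim' k_lim])
  with k_sum have "eis2 (- 1 / z) / z\<^sup>2 - ?S = - (of_real pi * \<i> / z) - of_real pi * \<i> / z"
    by (rule has_sum_unique)
  hence "eis2 (- 1 / z) / z\<^sup>2 - eis2 z = - (of_real pi * \<i> / z) - of_real pi * \<i> / z"
    unfolding S_eq .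
  thus ?thesis by (simp add: algebra_simps)
qed

subsection \<open>The Dedekind eta function\<close>

text \<open>Euler's function in the variable \<open>x = q\<close>. Unlike eta it is defined at the
  cusp \<open>x = 0\<close>, so statements about the cusp become statements about holomorphic
  functions on the disc.\<close>

definition euler_prod :: "complex \<Rightarrow> complex" where
  "euler_prod x = (\<Prod>n. 1 - x ^ Suc n)"

lemma convergent_euler_prod:
  assumes "norm (x::complex) < 1"
  shows "convergent_prod (\<lambda>n. 1 - x ^ Suc n)"
proof -
  have "summable (\<lambda>n. norm x ^ Suc n)"
    using assms by (subst summable_Suc_iff) (auto intro: summable_geometric)
  hence "abs_convergent_prod (\<lambda>n. 1 - x ^ Suc n)"
    unfolding abs_convergent_prod_conv_summable by (simp add: norm_mult norm_power)
  thus ?thesis by (rule abs_convergent_prod_imp_convergent_prod)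
qed

lemma norm_power_Suc_less_one:
  assumes "norm (x::'a::real_normed_div_algebra) < 1"
  shows "norm (x ^ Suc n) < 1"
proof -
  have "norm x ^ Suc n \<le> norm x ^ 1" using assms by (intro power_decreasing) auto
  thus ?thesis using assms by (simp add: norm_power del: power_Suc)
qed

lemma one_minus_power_nonzero:
  assumes "norm (x::complex) < 1"
  shows "1 - x ^ Suc n \<noteq> 0"
proof
  assume "1 - x ^ Suc n = 0"
  hence "norm (x ^ Suc n) = 1" by simp
  thus False using norm_power_Suc_less_one[OF assms, of n] by simp
qed

lemma euler_prod_nonzero: "norm x < 1 \<Longrightarrow> euler_prod x \<noteq> 0"
  unfolding euler_prod_def
  by (intro prodinf_nonzero convergent_euler_prod one_minus_power_nonzero)

text \<open>Weierstrass M-test with the majorant \<open>r^(n+1)\<close>. Uniformity on closed discs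
  yields both holomorphy and the termwise logarithmic derivative.\<close>

lemma uniform_limit_euler_prod:
  assumes "0 \<le> r" "r < 1"
  shows "uniform_limit (cball 0 r) (\<lambda>N x. \<Prod>n<N. 1 - x ^ Suc n) euler_prod sequentially"
proof -
  have "uniformly_convergent_on (cball 0 r) (\<lambda>N x::complex. \<Prod>n<N. 1 - x ^ Suc n)"
  proof (rule uniformly_convergent_on_prod')
    show "uniformly_convergent_on (cball 0 r) (\<lambda>N x::complex. \<Sum>n<N. norm (1 - x ^ Suc n - 1))"
    proof (rule Weierstrass_m_test'[where M = "\<lambda>n. \<bar>r\<bar> ^ Suc n"])
      fix n and x :: complex assume "x \<in> cball 0 r"
      hence "norm x \<le> \<bar>r\<bar>" by simp
      hence "norm x ^ Suc n \<le> \<bar>r\<bar> ^ Suc n" by (intro power_mono) auto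
      thus "norm (norm (1 - x ^ Suc n - 1)) \<le> \<bar>r\<bar> ^ Suc n" by (simp add: norm_mult norm_power)
    next
      show "summable (\<lambda>n. \<bar>r\<bar> ^ Suc n)"
        using assms by (subst summable_Suc_iff) (auto intro: summable_geometric)
    qed
  qed (auto intro!: continuous_intros)
  then obtain l where l: "uniform_limit (cball 0 r) (\<lambda>N x::complex. \<Prod>n<N. 1 - x ^ Suc n) l sequentially"
    by (auto simp: uniformly_convergent_on_def)
  have "l x = euler_prod x" if "x \<in> cball 0 r" for x
  proof (rule LIMSEQ_unique)
    show "(\<lambda>N. \<Prod>n<N. 1 - x ^ Suc n) \<longlonglongrightarrow> l x" by (rule tendsto_uniform_limitI[OF l that])
    have "norm x < 1" using that assms by simp
    thus "(\<lambda>N. \<Prod>n<N. 1 - x ^ Suc n) \<longlonglongrightarrow> euler_prod x"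
      unfolding euler_prod_def by (intro has_prod_imp_tendsto' convergent_prod_has_prod convergent_euler_prod)
  qed
  with l show ?thesis by (metis (mono_tags, lifting) uniform_limit_cong')
qed

lemma holomorphic_euler_prod: "euler_prod holomorphic_on ball 0 1"
proof (rule holomorphic_uniform_sequence)
  fix x :: complex assume x: "x \<in> ball 0 1"
  define d where "d = (1 - norm x) / 2"
  have d: "d > 0" "norm x + d < 1" "0 \<le> norm x + d" using x by (auto simp: d_def field_simps)
  have "cball x d \<subseteq> cball 0 (norm x + d)"
  proof
    fix y assume "y \<in> cball x d"
    thus "y \<in> cball 0 (norm x + d)"
      using norm_triangle_sub[of y x] by (simp add: dist_norm norm_minus_commute)
  qed
  moreover have "cball 0 (norm x + d) \<subseteq> ball 0 1" using d by auto
  ultimately show "\<exists>d>0. cball x d \<subseteq> ball 0 1 \<and>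
      uniform_limit (cball x d) (\<lambda>N x. \<Prod>n<N. 1 - x ^ Suc n) euler_prod sequentially"
    using d uniform_limit_euler_prod[OF d(3,2)] uniform_limit_on_subset by blast
qed (auto intro!: holomorphic_intros)

lemma euler_prod_logderiv_sums:
  assumes "norm x < 1"
  shows "(\<lambda>n. - (of_nat (Suc n) * x ^ n) / (1 - x ^ Suc n)) sums (deriv euler_prod x / euler_prod x)"
proof -
  obtain r where r: "norm x < r" "r < 1" "0 \<le> r" using assms dense norm_ge_zero order_le_less_trans order_less_imp_le by metis
  have "(\<lambda>n. deriv (\<lambda>x. 1 - x ^ Suc n) x / (1 - x ^ Suc n)) sums (deriv euler_prod x / euler_prod x)"
  proof (rule logderiv_prodinf_complex_uniform_limit)
    show "uniform_limit (ball 0 r) (\<lambda>N x. \<Prod>n<N. 1 - x ^ Suc n) euler_prod sequentially"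
      by (rule uniform_limit_on_subset[OF uniform_limit_euler_prod[OF r(3,2)]]) auto
  qed (use r assms in \<open>auto intro!: holomorphic_intros euler_prod_nonzero\<close>)
  moreover have "deriv (\<lambda>x. 1 - x ^ Suc n) x = - (of_nat (Suc n) * x ^ n)" for n
    by (rule DERIV_imp_deriv) (auto intro!: derivative_eq_intros simp del: power_Suc)
  ultimately show ?thesis by simp
qed

section \<open>Lambert series and the logarithmic derivative of eta\<close>

text \<open>Both series are iterated sums of the array \<open>(n+1) x^((n+1)(k+1))\<close>: summing
  over \<open>k\<close> is a geometric series, summing over \<open>n\<close> its derivative. The
  first shape comes from the rows of \<open>G_2\<close>, the second from the factors of the Euler
  product.\<close>

lemma lambert_series_swap:
  fixes x :: complex
  assumes "norm x < 1"
  shows "(\<lambda>n. x ^ Suc n / (1 - x ^ Suc n)\<^sup>2) sums S \<longleftrightarrow> (\<lambda>n. of_nat (Suc n) * x ^ Suc n / (1 - x ^ Suc n)) sums S"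
    and "summable (\<lambda>n. norm (x ^ Suc n / (1 - x ^ Suc n)\<^sup>2))"
proof -
  define f where "f = (\<lambda>n k. of_nat (Suc n) * x ^ (Suc n * Suc k))"
  have pw: "norm (x ^ Suc n) < 1" for n
    by (rule norm_power_Suc_less_one[OF assms])
  \<comment> \<open>Stated over a general field because it serves twice: for \<open>x\<close>
    itself, and for \<open>norm x\<close> to obtain absolute summability.\<close>
  have geo: "((\<lambda>k. of_nat (Suc n) * y ^ (Suc n * Suc k)) has_sum of_nat (Suc n) * y ^ Suc n / (1 - y ^ Suc n)) UNIV"
    if "norm y < 1" for n and y :: "'a :: {real_normed_field, banach}"
  proof -
    have "norm (y ^ Suc n) < 1"
      by (rule norm_power_Suc_less_one[OF that])
    from has_sum_geometric_from_1[OF this]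
    have "((\<lambda>k. (y ^ Suc n) ^ Suc k) has_sum y ^ Suc n / (1 - y ^ Suc n)) UNIV"
      by (subst has_sum_reindex_bij_witness[of _ "\<lambda>n. n - 1" Suc "{1..}" "\<lambda>k. (y ^ Suc n) ^ k"]) auto
    from has_sum_cmult_right[OF this, of "of_nat (Suc n)"] show ?thesis
      by (simp only: power_mult times_divide_eq_right)
  qed
  have der: "((\<lambda>n. of_nat (Suc n) * x ^ (Suc n * Suc k)) has_sum x ^ Suc k / (1 - x ^ Suc k)\<^sup>2) UNIV" for k
  proof -
    let ?y = "x ^ Suc k"
    have "(\<lambda>n. of_nat (Suc n) * ?y ^ n) sums (1 / (1 - ?y)\<^sup>2)"
      by (rule geometric_deriv_sums[OF pw])
    hence 1: "(\<lambda>n. ?y * (of_nat (Suc n) * ?y ^ n)) sums (?y * (1 / (1 - ?y)\<^sup>2))"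
      by (rule sums_mult)
    have "(\<lambda>n. of_nat (Suc n) * norm ?y ^ n) sums (1 / (1 - norm ?y)\<^sup>2)"
      by (rule geometric_deriv_sums) (use pw[of k] in simp)
    hence "summable (\<lambda>n. norm ?y * (of_nat (Suc n) * norm ?y ^ n))"
      by (intro summable_mult) (simp add: sums_iff)
    hence 2: "summable (\<lambda>n. norm (?y * (of_nat (Suc n) * ?y ^ n)))"
      by (simp add: norm_mult norm_power del: of_nat_Suc)
    have "((\<lambda>n. ?y * (of_nat (Suc n) * ?y ^ n)) has_sum (?y * (1 / (1 - ?y)\<^sup>2))) UNIV"
      by (rule norm_summable_imp_has_sum[OF 2 1])
    moreover have "?y * (of_nat (Suc n) * ?y ^ n) = of_nat (Suc n) * x ^ (Suc n * Suc k)" for n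
    proof -
      have "x ^ (Suc n * Suc k) = ?y * ?y ^ n" by (simp only: power_mult[symmetric] power_add[symmetric]) (simp add: algebra_simps)
      thus ?thesis by (simp only: mult.left_commute)
    qed
    ultimately show ?thesis by (simp only: times_divide_eq_right mult_1_right)
  qed
  have rsum: "(\<lambda>n. real (Suc n) * norm x ^ Suc n / (1 - norm x ^ Suc n)) summable_on UNIV"
  proof (rule summable_nonneg_imp_summable_on)
    have "(\<lambda>n. of_nat (Suc n) * norm x ^ n) sums (1 / (1 - norm x)\<^sup>2)"
      by (rule geometric_deriv_sums) (use assms in simp)
    hence "summable (\<lambda>n. (norm x / (1 - norm x)) * (of_nat (Suc n) * norm x ^ n))"
      by (intro summable_mult) (simp add: sums_iff)
    thus "summable (\<lambda>n. real (Suc n) * norm x ^ Suc n / (1 - norm x ^ Suc n))"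
    proof (rule summable_comparison_test'[where N = 0])
      fix n
      have "norm x ^ Suc n \<le> norm x ^ 1" using assms by (intro power_decreasing) auto
      hence le: "1 - norm x \<le> 1 - norm x ^ Suc n" by simp
      have "real (Suc n) * norm x ^ Suc n / (1 - norm x ^ Suc n) \<le> real (Suc n) * norm x ^ Suc n / (1 - norm x)"
        using assms le by (intro divide_left_mono mult_pos_pos) auto
      thus "norm (real (Suc n) * norm x ^ Suc n / (1 - norm x ^ Suc n)) \<le> (norm x / (1 - norm x)) * (of_nat (Suc n) * norm x ^ n)"
        using assms le by (subst real_norm_def, subst abs_of_nonneg) (auto simp: mult_ac intro!: divide_nonneg_pos)
    qed
  next
    fix n
    show "0 \<le> real (Suc n) * norm x ^ Suc n / (1 - norm x ^ Suc n)"
      using pw[of n] by (auto simp: norm_power simp del: power_Suc)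
  qed
  have "(\<lambda>(n, k). real (Suc n) * norm x ^ (Suc n * Suc k)) summable_on UNIV \<times> UNIV"
  proof (rule summable_on_SigmaI)
    show "((\<lambda>k. case (n, k) of (n, k) \<Rightarrow> real (Suc n) * norm x ^ (Suc n * Suc k)) has_sum
            real (Suc n) * norm x ^ Suc n / (1 - norm x ^ Suc n)) UNIV" for n
      using geo[of "norm x" n] assms by simp
  qed (use rsum in auto)
  hence "(\<lambda>(n, k). f n k) summable_on UNIV \<times> UNIV"
    by (intro abs_summable_summable[of "\<lambda>(n, k). f n k"])
       (simp add: case_prod_unfold f_def norm_mult norm_power del: of_nat_Suc mult_Suc mult_Suc_right)
  then obtain T where T: "((\<lambda>(n, k). f n k) has_sum T) (UNIV \<times> UNIV)" by (auto simp: summable_on_def)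
  have 1: "((\<lambda>n. of_nat (Suc n) * x ^ Suc n / (1 - x ^ Suc n)) has_sum T) UNIV"
    by (rule has_sum_SigmaD[OF T]) (use geo[OF assms] in \<open>simp add: f_def\<close>)
  have T': "((\<lambda>(k, n). f n k) has_sum T) (UNIV \<times> UNIV)"
    using T by (subst (asm) has_sum_swap) (simp add: case_prod_unfold)
  have 2: "((\<lambda>k. x ^ Suc k / (1 - x ^ Suc k)\<^sup>2) has_sum T) UNIV"
    by (rule has_sum_SigmaD[OF T']) (use der in \<open>simp add: f_def\<close>)
  show "(\<lambda>n. x ^ Suc n / (1 - x ^ Suc n)\<^sup>2) sums S \<longleftrightarrow> (\<lambda>n. of_nat (Suc n) * x ^ Suc n / (1 - x ^ Suc n)) sums S"
    (is "?A sums S \<longleftrightarrow> ?B sums S")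
  proof
    assume "?A sums S"
    hence "S = T" by (rule sums_unique2[OF _ has_sum_imp_sums[OF 2]])
    thus "?B sums S" using has_sum_imp_sums[OF 1] by (simp only:)
  next
    assume "?B sums S"
    hence "S = T" by (rule sums_unique2[OF _ has_sum_imp_sums[OF 1]])
    thus "?A sums S" using has_sum_imp_sums[OF 2] by (simp only:)
  qed
  from 2 have "(\<lambda>k. norm (x ^ Suc k / (1 - x ^ Suc k)\<^sup>2)) summable_on UNIV"
    by (rule summable_on_iff_abs_summable_on_complex[THEN iffD1, OF has_sum_imp_summable])
  thus "summable (\<lambda>n. norm (x ^ Suc n / (1 - x ^ Suc n)\<^sup>2))"
    by (rule summable_on_imp_summable)
qed

abbreviation qexp :: "complex \<Rightarrow> complex" where
  "qexp z \<equiv> exp (2 * of_real pi * \<i> * z)"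

lemma norm_qexp_less_1: "Im z > 0 \<Longrightarrow> norm (qexp z) < 1"
  by simp

lemma eta_altdef: "eta z = exp (2 * of_real pi * \<i> * z / 24) * euler_prod (qexp z)"
proof -
  have "exp (2 * of_real pi * \<i> * of_nat (Suc n) * z) = qexp z ^ Suc n" for n
    by (simp only: exp_of_nat_mult[symmetric]) (simp add: mult_ac)
  thus ?thesis by (simp add: eta_def euler_prod_def)
qed

lemma eta_nonzero: "Im z > 0 \<Longrightarrow> eta z \<noteq> 0"
  unfolding eta_altdef using euler_prod_nonzero[OF norm_qexp_less_1] by simp

lemma pi_over_sin_squared:
  "(of_real pi / sin (of_real pi * w))\<^sup>2 = - 4 * (of_real pi)\<^sup>2 * (qexp w / (1 - qexp w)\<^sup>2)"
proof -
  define E F where "E = exp (\<i> * (of_real pi * w))" and "F = exp (- (\<i> * (of_real pi * w)))"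
  have EF: "E * F = 1" by (simp add: E_def F_def exp_add[symmetric])
  have q: "qexp w = E\<^sup>2" unfolding E_def by (simp add: exp_double[symmetric] mult_ac)
  have "E \<noteq> 0" by (simp add: E_def)
  have "sin (of_real pi * w) = (E - F) / (2 * \<i>)" by (simp add: sin_exp_eq E_def F_def)
  hence "(sin (of_real pi * w))\<^sup>2 = - (E - F)\<^sup>2 / 4" by (simp add: power_divide power_mult_distrib)
  also have "(E - F)\<^sup>2 = ((E - F) * E)\<^sup>2 / E\<^sup>2" using \<open>E \<noteq> 0\<close> by (simp add: power_mult_distrib)
  also have "(E - F) * E = - (1 - E\<^sup>2)" using EF by (simp add: algebra_simps power2_eq_square)
  finally have S: "(sin (of_real pi * w))\<^sup>2 = - ((1 - E\<^sup>2)\<^sup>2 / E\<^sup>2) / 4" by (simp only: power2_minus)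
  \<comment> \<open>For \<open>d = 0\<close> both sides are 0 by the convention
    \<open>x / 0 = 0\<close>.\<close>
  have "p / (- (d / e) / 4) = - 4 * p * (e / d)" if "e \<noteq> 0" for p d e :: complex
    using that by (cases "d = 0") (simp_all add: field_simps)
  thus ?thesis unfolding power_divide[of "of_real pi"] q S using \<open>E \<noteq> 0\<close> by simp
qed

text \<open>The rows \<open>n\<close> and \<open>-n\<close> agree since the sine enters squared, so
  the total is the row 0 plus twice the sum over positive rows, each rewritten in powers of
  \<open>q\<close>.\<close>

lemma eis2_eq_lambert:
  assumes "Im z > 0"
  obtains T where "(\<lambda>n. of_nat (Suc n) * qexp z ^ Suc n / (1 - qexp z ^ Suc n)) sums T"
    "eis2 z = (of_real pi)\<^sup>2 / 3 - 8 * (of_real pi)\<^sup>2 * T"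
proof -
  let ?x = "qexp z"
  note x = norm_qexp_less_1[OF assms]
  have "summable (\<lambda>n. ?x ^ Suc n / (1 - ?x ^ Suc n)\<^sup>2)"
    by (rule summable_norm_cancel[OF lambert_series_swap(2)[OF x]])
  then obtain T where T: "(\<lambda>n. ?x ^ Suc n / (1 - ?x ^ Suc n)\<^sup>2) sums T" by (auto simp: summable_def)
  have row: "eis_row z (int n + 1) = - 4 * (of_real pi)\<^sup>2 * (?x ^ Suc n / (1 - ?x ^ Suc n)\<^sup>2)" for n
  proof -
    have "qexp (of_int (int n + 1) * z) = ?x ^ Suc n"
      by (simp only: exp_of_nat_mult[symmetric]) (simp add: algebra_simps)
    moreover have "int n + 1 \<noteq> 0" by presburger
    ultimately show ?thesis unfolding eis_row_def pi_over_sin_squared by (simp only: if_False)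
  qed
  have row': "eis_row z (- int n - 1) = eis_row z (int n + 1)" for n
  proof -
    have "of_real pi * (of_int (- int n - 1) * z) = - (of_real pi * (of_int (int n + 1) * z))"
      by (simp add: algebra_simps)
    moreover have "int n + 1 \<noteq> 0" "- int n - 1 \<noteq> 0" by presburger+
    ultimately show ?thesis unfolding eis_row_def by (simp only: sin_minus if_False) (simp add: power_divide)
  qed
  have pos: "(\<lambda>n. eis_row z (int n + 1)) sums (- 4 * (of_real pi)\<^sup>2 * T)"
    unfolding row by (rule sums_mult[OF T])
  have nonneg: "(\<lambda>n. eis_row z (int n)) sums (- 4 * (of_real pi)\<^sup>2 * T + (of_real pi)\<^sup>2 / 3)"
  proof -
    have "(\<lambda>n. eis_row z (int (Suc n))) sums (- 4 * (of_real pi)\<^sup>2 * T)"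
      using pos by (simp add: add.commute)
    from sums_Suc[OF this] show ?thesis by (simp add: eis_row_def[of z 0])
  qed
  have im: "Im z \<noteq> 0" using assms by simp
  have "(eis_row z has_sum (- 4 * (of_real pi)\<^sup>2 * T + (of_real pi)\<^sup>2 / 3 + - 4 * (of_real pi)\<^sup>2 * T)) UNIV"
    by (rule has_sum_int_split[OF has_sum_imp_summable[OF eis2_has_sum[OF im]] nonneg])
       (use pos in \<open>simp only: row'\<close>)
  hence "eis2 z = (of_real pi)\<^sup>2 / 3 - 8 * (of_real pi)\<^sup>2 * T"
    using has_sum_unique[OF eis2_has_sum[OF im]] by (simp add: algebra_simps)
  with T that show ?thesis unfolding lambert_series_swap(1)[OF x] by blast
qed

lemma has_field_derivative_eta:
  assumes "Im z > 0"
  shows "(eta has_field_derivative eta z * (\<i> / (4 * of_real pi) * eis2 z)) (at z)"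
proof -
  let ?x = "qexp z"
  note x = norm_qexp_less_1[OF assms]
  obtain T where T: "(\<lambda>n. of_nat (Suc n) * ?x ^ Suc n / (1 - ?x ^ Suc n)) sums T"
    and e: "eis2 z = (of_real pi)\<^sup>2 / 3 - 8 * (of_real pi)\<^sup>2 * T"
    using eis2_eq_lambert[OF assms] by blast
  have "(\<lambda>n. - ?x * (- (of_nat (Suc n) * ?x ^ n) / (1 - ?x ^ Suc n))) sums (- ?x * (deriv euler_prod ?x / euler_prod ?x))"
    by (intro sums_mult euler_prod_logderiv_sums x)
  moreover have "- ?x * (- (of_nat (Suc n) * ?x ^ n) / (1 - ?x ^ Suc n)) = of_nat (Suc n) * ?x ^ Suc n / (1 - ?x ^ Suc n)" for n
    by simp
  ultimately have "T = - ?x * (deriv euler_prod ?x / euler_prod ?x)"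
    using T sums_unique2 by (simp only:)
  hence d: "deriv euler_prod ?x * ?x = - T * euler_prod ?x"
    using euler_prod_nonzero[OF x] by (simp add: field_simps)
  have "(euler_prod has_field_derivative deriv euler_prod ?x) (at ?x)"
    using x by (intro holomorphic_derivI[OF holomorphic_euler_prod]) auto
  hence "((\<lambda>z. euler_prod (qexp z)) has_field_derivative deriv euler_prod ?x * (2 * of_real pi * \<i> * ?x)) (at z)"
    by (rule DERIV_chain2) (auto intro!: derivative_eq_intros)
  moreover have "deriv euler_prod ?x * (2 * of_real pi * \<i> * ?x) = - (2 * of_real pi * \<i> * T * euler_prod ?x)"
  proof -
    have "deriv euler_prod ?x * (2 * of_real pi * \<i> * ?x) = 2 * of_real pi * \<i> * (deriv euler_prod ?x * ?x)"
      by (simp only: mult_ac)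
    also have "\<dots> = - (2 * of_real pi * \<i> * T * euler_prod ?x)" unfolding d by simp
    finally show ?thesis .
  qed
  ultimately have "((\<lambda>z. euler_prod (qexp z)) has_field_derivative - (2 * of_real pi * \<i> * T * euler_prod ?x)) (at z)"
    by (simp only:)
  hence "((\<lambda>z. exp (2 * of_real pi * \<i> * z / 24) * euler_prod (qexp z)) has_field_derivative
          exp (2 * of_real pi * \<i> * z / 24) * - (2 * of_real pi * \<i> * T * euler_prod ?x) +
          exp (2 * of_real pi * \<i> * z / 24) * (2 * of_real pi * \<i> / 24) * euler_prod ?x) (at z)"
    by (rule DERIV_mult'[rotated]) (auto intro!: derivative_eq_intros simp: mult_ac)
  also have "exp (2 * of_real pi * \<i> * z / 24) * - (2 * of_real pi * \<i> * T * euler_prod ?x) +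
          exp (2 * of_real pi * \<i> * z / 24) * (2 * of_real pi * \<i> / 24) * euler_prod ?x =
          eta z * (\<i> / (4 * of_real pi) * eis2 z)"
  proof -
    \<comment> \<open>The factor \<open>\<i> / (4 pi)\<close> turns \<open>pi^2 / 3\<close> into
      \<open>2 pi \<i> / 24\<close>, the contribution of \<open>q^(1/24)\<close>, and the Lambert
      series into that of the product.\<close>
    have r: "\<i> / (4 * of_real pi) * eis2 z = of_real pi * \<i> / 12 - 2 * of_real pi * \<i> * T"
      unfolding e by (simp add: field_simps power2_eq_square)
    show ?thesis unfolding r eta_altdef by (simp add: algebra_simps)
  qed
  finally show ?thesis unfolding eta_altdef[abs_def] .
qed

text \<open>The quotient \<open>B\<close> has derivative 0: the anomaly of \<open>eis2\<close> adds
  \<open>1/(2 z)\<close> to the logarithmic derivative of \<open>eta (- 1 / z)\<close>, and twice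
  this cancels the logarithmic derivative of the factor \<open>z\<close>.\<close>

theorem eta_inversion:
  assumes "Im z > 0"
  shows "(eta (- 1 / z))\<^sup>2 = - \<i> * z * (eta z)\<^sup>2"
proof -
  define f where "f = (\<lambda>z. eta (- 1 / z))"
  define B where "B = (\<lambda>z. (f z)\<^sup>2 / (z * (eta z)\<^sup>2))"
  have im_inv: "Im (- 1 / z) > 0" if "Im z > 0" for z
    using that by (auto simp: Im_divide intro!: divide_pos_pos add_nonneg_pos)
  have "\<exists>c. \<forall>z\<in>{z. Im z > 0}. B z = c"
  proof (rule has_field_derivative_zero_constant)
    show "convex {z. Im z > 0}" by (rule convex_halfspace_Im_gt)
    fix z assume "z \<in> {z. Im z > 0}"
    hence z: "Im z > 0" by simp
    hence z0: "z \<noteq> 0" by auto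
    have "((\<lambda>z. - 1 / z) has_field_derivative 1 / z\<^sup>2) (at z)"
      using z0 by (auto intro!: derivative_eq_intros simp: power2_eq_square)
    from DERIV_chain2[OF has_field_derivative_eta[OF im_inv[OF z]] this]
    have d1: "((\<lambda>z. eta (- 1 / z)) has_field_derivative
        eta (- 1 / z) * (\<i> / (4 * of_real pi) * eis2 (- 1 / z)) * (1 / z\<^sup>2)) (at z)" .
    have eq: "eta (- 1 / z) * (\<i> / (4 * of_real pi) * eis2 (- 1 / z)) * (1 / z\<^sup>2) =
        eta (- 1 / z) * (\<i> / (4 * of_real pi) * eis2 z + 1 / (2 * z))"
    proof -
      have "\<i> / (4 * of_real pi) * eis2 (- 1 / z) * (1 / z\<^sup>2) = \<i> / (4 * of_real pi) * (eis2 (- 1 / z) / z\<^sup>2)" by simp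
      also have "\<dots> = \<i> / (4 * of_real pi) * eis2 z + 1 / (2 * z)"
        unfolding eis2_inversion[OF z] using z0 by (simp add: field_simps)
      finally show ?thesis by (simp only: mult.assoc)
    qed
    define u v w where "u = f z" and "v = eta z" and "w = \<i> / (4 * of_real pi) * eis2 z"
    have nz: "u \<noteq> 0" "v \<noteq> 0" using eta_nonzero im_inv z by (auto simp: u_def v_def f_def)
    have d1': "(f has_field_derivative u * (w + 1 / (2 * z))) (at z)"
      using d1 unfolding eq u_def w_def f_def .
    have d2: "(eta has_field_derivative v * w) (at z)"
      using has_field_derivative_eta[OF z] unfolding v_def w_def .
    have "(B has_field_derivative
       ((2 * u * (u * (w + 1 / (2 * z)))) * (z * v\<^sup>2) - u\<^sup>2 * (v\<^sup>2 + z * (2 * v * (v * w)))) / (z * v\<^sup>2)\<^sup>2) (at z)"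
      unfolding B_def using nz z0
      by (auto intro!: derivative_eq_intros d1' d2 simp: u_def[symmetric] v_def[symmetric] power2_eq_square algebra_simps)
    moreover have "(2 * u * (u * (w + 1 / (2 * z)))) * (z * v\<^sup>2) - u\<^sup>2 * (v\<^sup>2 + z * (2 * v * (v * w))) = 0"
      using z0 by (simp add: field_simps power2_eq_square)
    ultimately have "(B has_field_derivative 0) (at z)" by simp
    thus "(B has_field_derivative 0) (at z within {z. Im z > 0})"
      by (rule has_field_derivative_at_within)
  qed
  then obtain c where c: "B z = c" if "Im z > 0" for z by blast
  \<comment> \<open>The fixed point \<open>\<i>\<close> of the inversion determines the constant, as
    the eta values cancel there.\<close>
  have "B \<i> = - \<i>" using eta_nonzero[of \<i>] by (simp add: B_def f_def field_simps)
  hence "B z = - \<i>" using c[of \<i>] c[OF assms] by simp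
  moreover have "z \<noteq> 0" using assms by auto
  ultimately show ?thesis using eta_nonzero[OF assms] by (simp add: B_def f_def divide_eq_eq)
qed

subsection \<open>Expansions in powers of the local parameter\<close>

lemma upper_half_iff: "z \<in> upper_half \<longleftrightarrow> Im z > 0"
  by (simp add: upper_half_def)

lemma open_upper_half: "open upper_half"
  unfolding upper_half_def by (rule open_halfspace_Im_gt)

lemma upper_half_nonzero: "z \<in> upper_half \<Longrightarrow> z \<noteq> 0"
  by (auto simp: upper_half_def)

lemma qpow_add: "qpow N (m + n) z = qpow N m z * qpow N n z"
  unfolding qpow_def exp_add[symmetric] by (simp add: add_divide_distrib algebra_simps)

lemma qpow_nonzero [simp]: "qpow N n z \<noteq> 0"
  by (simp add: qpow_def)

lemma qpow_0 [simp]: "qpow N 0 z = 1"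
  by (simp add: qpow_def)

lemma qpow_minus: "qpow N (- n) z = inverse (qpow N n z)"
  unfolding qpow_def exp_minus[symmetric] by simp

lemma qpow_of_nat: "qpow N (int n) z = qpow N 1 z ^ n"
  unfolding qpow_def exp_of_nat_mult[symmetric] by (simp add: algebra_simps)

lemma norm_qpow_1_less_1: "z \<in> upper_half \<Longrightarrow> norm (qpow 3 1 z) < 1"
  by (simp add: qpow_def upper_half_def)

lemma qpow_1_in_ball: "z \<in> upper_half \<Longrightarrow> qpow 3 1 z \<in> ball 0 1"
  using norm_qpow_1_less_1 by simp

text \<open>Every point of the punctured disc is a value of the local parameter. This transfers
  convergence and identities from the upper half-plane to power series.\<close>

lemma qpow_1_surj:
  assumes "x \<noteq> 0" "norm x < 1"
  obtains z where "z \<in> upper_half" "qpow 3 1 z = x"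
proof
  let ?z = "3 * Ln x / (2 * of_real pi * \<i>)"
  show "qpow 3 1 ?z = x" using assms by (simp add: qpow_def)
  have "Im ?z = - 3 * ln (norm x) / (2 * pi)"
    using assms by (simp add: Im_divide power2_eq_square)
  also have "\<dots> > 0" using assms by (simp add: field_simps mult_pos_neg)
  finally show "?z \<in> upper_half" by (simp only: upper_half_iff)
qed

lemma qpow_plus_1: "qpow 3 n (z + 1) = zeta3 powi n * qpow 3 n z"
proof -
  have "zeta3 powi n = exp (of_int n * (2 * of_real pi * \<i> / 3))"
    by (simp add: zeta3_def exp_power_int)
  thus ?thesis by (simp add: qpow_def exp_add[symmetric] algebra_simps add_divide_distrib)
qed

lemma zeta3_nonzero [simp]: "zeta3 \<noteq> 0"
  by (simp add: zeta3_def)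

lemma norm_zeta3 [simp]: "norm zeta3 = 1"
  by (simp add: zeta3_def)

lemma zeta3_powi_eq_1_iff: "zeta3 powi n = 1 \<longleftrightarrow> 3 dvd n"
proof -
  have "zeta3 powi n = exp (of_int n * (2 * of_real pi * \<i> / 3))"
    by (simp add: zeta3_def exp_power_int)
  also have "\<dots> = 1 \<longleftrightarrow> (\<exists>k::int. of_int n * (2 * pi / 3) = of_int (2 * k) * pi)"
    by (simp add: exp_eq_1)
  also have "\<dots> \<longleftrightarrow> (\<exists>k::int. real_of_int n = real_of_int (3 * k))"
    by (intro ex_cong1) (auto simp: field_simps)
  also have "\<dots> \<longleftrightarrow> 3 dvd n" unfolding of_int_eq_iff by auto
  finally show ?thesis .
qed

lemma zeta3_powi_eq_iff: "zeta3 powi m = zeta3 powi n \<longleftrightarrow> m mod 3 = n mod 3"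
proof -
  have "zeta3 powi m = zeta3 powi n \<longleftrightarrow> zeta3 powi (m - n) = 1"
    by (simp add: power_int_diff field_simps)
  thus ?thesis by (simp add: zeta3_powi_eq_1_iff mod_eq_dvd_iff)
qed

section \<open>Laurent expansions and their coefficients\<close>

lemma has_qexp3_lower_bound:
  assumes "has_qexp3 f a"
  obtains r where "\<And>n. n < r \<Longrightarrow> a n = 0"
proof -
  have "finite {n. n < 0 \<and> a n \<noteq> 0}" using assms by (simp add: has_qexp3_def)
  from bdd_below_finite[OF this] obtain b where b: "\<And>n. n \<in> {n. n < 0 \<and> a n \<noteq> 0} \<Longrightarrow> b \<le> n"
    unfolding bdd_below_def by blast
  show ?thesis
  proof (rule that)
    fix n assume n: "n < min b 0"
    show "a n = 0"
    proof (rule ccontr)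
      assume "a n \<noteq> 0"
      hence "b \<le> n" using n by (intro b) simp
      thus False using n by simp
    qed
  qed
qed

lemma has_qexp3_sums:
  assumes "has_qexp3 f a" "\<And>n. n < r \<Longrightarrow> a n = 0" "z \<in> upper_half"
  shows "(\<lambda>k. a (r + int k) * qpow 3 1 z ^ k) sums (f z / qpow 3 r z)"
proof -
  have "((\<lambda>n. a n * qpow 3 n z) has_sum f z) UNIV"
    using assms by (simp add: has_qexp3_def)
  moreover have "((\<lambda>n. a n * qpow 3 n z) has_sum f z) {r..} \<longleftrightarrow> ((\<lambda>n. a n * qpow 3 n z) has_sum f z) UNIV"
    by (rule has_sum_cong_neutral) (use assms(2) in \<open>auto simp: not_le\<close>)
  ultimately have "((\<lambda>n. a n * qpow 3 n z) has_sum f z) {r..}" by simp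
  hence "((\<lambda>k. a (r + int k) * qpow 3 (r + int k) z) has_sum f z) UNIV"
    by (subst has_sum_reindex_bij_witness[of _ "\<lambda>n. nat (n - r)" "\<lambda>k. r + int k" "{r..}"]) auto
  hence "(\<lambda>k. a (r + int k) * qpow 3 (r + int k) z) sums f z"
    by (rule has_sum_imp_sums)
  from sums_divide[OF this, of "qpow 3 r z"] show ?thesis
    by (simp add: qpow_add qpow_of_nat)
qed

text \<open>Convergence at every point of the upper half-plane gives convergence of the shifted
  power series on the whole punctured disc, and the centre is trivial; hence its sum is holomorphic
  there.\<close>

lemma has_qexp3_imp_holomorphic_factor:
  assumes "has_qexp3 f a" "\<And>n. n < r \<Longrightarrow> a n = 0"
  obtains G where "G holomorphic_on ball 0 1" "\<And>z. z \<in> upper_half \<Longrightarrow> f z = qpow 3 r z * G (qpow 3 1 z)"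
    "\<And>x. x \<in> ball 0 1 \<Longrightarrow> (\<lambda>k. a (r + int k) * x ^ k) sums G x"
proof -
  define G where "G = (\<lambda>x. \<Sum>k. a (r + int k) * x ^ k)"
  have sums: "(\<lambda>k. a (r + int k) * x ^ k) sums G x" if "x \<in> ball 0 1" for x
  proof (cases "x = 0")
    case True
    have "summable (\<lambda>k. a (r + int k) * x ^ k)" unfolding True by (rule summable_zero_power')
    thus ?thesis by (simp add: G_def summable_sums)
  next
    case False
    then obtain z where "z \<in> upper_half" "qpow 3 1 z = x" using \<open>x \<in> ball 0 1\<close> qpow_1_surj[of x] by auto
    with has_qexp3_sums[OF assms] show ?thesis unfolding G_def by (auto simp: sums_iff)
  qed
  show ?thesis
  proof (rule that)
    show "G holomorphic_on ball 0 1"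
      by (rule power_series_holomorphic[of _ _ "\<lambda>k. a (r + int k)"]) (use sums in simp)
    show "f z = qpow 3 r z * G (qpow 3 1 z)" if "z \<in> upper_half" for z
    proof -
      have "f z / qpow 3 r z = G (qpow 3 1 z)"
        by (rule sums_unique2[OF has_qexp3_sums[OF assms that] sums[OF qpow_1_in_ball[OF that]]])
      thus ?thesis by (simp add: field_simps)
    qed
  qed (rule sums)
qed

lemma has_qexp3_holomorphic:
  assumes "has_qexp3 f a"
  shows "f holomorphic_on upper_half"
proof -
  obtain r where r: "\<And>n. n < r \<Longrightarrow> a n = 0" using has_qexp3_lower_bound[OF assms] by blast
  obtain G where G: "G holomorphic_on ball 0 1" "\<And>z. z \<in> upper_half \<Longrightarrow> f z = qpow 3 r z * G (qpow 3 1 z)"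
    using has_qexp3_imp_holomorphic_factor[OF assms r] by blast
  have q: "qpow 3 n holomorphic_on upper_half" for n
    unfolding qpow_def[abs_def] by (intro holomorphic_intros) auto
  have "(G \<circ> qpow 3 1) holomorphic_on upper_half"
    by (rule holomorphic_on_compose_gen[OF q G(1)]) (use qpow_1_in_ball in auto)
  hence "(\<lambda>z. qpow 3 r z * G (qpow 3 1 z)) holomorphic_on upper_half"
    by (intro holomorphic_on_mult q) (simp add: o_def)
  thus ?thesis by (rule holomorphic_transform) (simp add: G)
qed

lemma has_qexp3_unique:
  assumes "has_qexp3 f a" "has_qexp3 f b"
  shows "a = b"
proof (rule ccontr)
  assume "a \<noteq> b"
  then obtain n where n: "a n \<noteq> b n" by blast
  obtain ra where ra: "\<And>n. n < ra \<Longrightarrow> a n = 0" using has_qexp3_lower_bound[OF assms(1)] by blast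
  obtain rb where rb: "\<And>n. n < rb \<Longrightarrow> b n = 0" using has_qexp3_lower_bound[OF assms(2)] by blast
  \<comment> \<open>Going one below both bounds makes the constant term of the difference 0, so the
    differing coefficient has positive index, as the theorem on isolated zeros used below
    demands.\<close>
  define r where "r = min ra rb - 1"
  have r: "\<And>n. n < r \<Longrightarrow> a n = 0" "\<And>n. n < r \<Longrightarrow> b n = 0" "a r = 0" "b r = 0"
    using ra rb by (auto simp: r_def)
  have nr: "n > r" using n r by (metis linorder_neqE_linordered_idom)
  define c where "c = (\<lambda>k::nat. a (r + int k) - b (r + int k))"
  have sums: "(\<lambda>k. c k * (x - 0) ^ k) sums 0" if "norm (x - 0) < 1" for x
  proof (cases "x = 0")
    case True
    thus ?thesis using powser_sums_zero[of c] by (simp add: c_def r(3,4))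
  next
    case False
    then obtain z where z: "z \<in> upper_half" "qpow 3 1 z = x" using \<open>norm (x - 0) < 1\<close> qpow_1_surj[of x] by auto
    have "(\<lambda>k. a (r + int k) * x ^ k) sums (f z / qpow 3 r z)" "(\<lambda>k. b (r + int k) * x ^ k) sums (f z / qpow 3 r z)"
      using has_qexp3_sums[OF assms(1) r(1), of r z] has_qexp3_sums[OF assms(2) r(2), of r z] z by simp_all
    from sums_diff[OF this] show ?thesis by (simp add: c_def left_diff_distrib)
  qed
  have m: "c (nat (n - r)) \<noteq> 0" "nat (n - r) > 0" using n nr by (simp_all add: c_def)
  show False
  proof (rule powser_0_nonzero[of 1 0 c "\<lambda>_. 0" "nat (n - r)", OF _ sums _ m])
    fix s :: real assume s: "s > 0" "\<And>z::complex. z \<in> cball 0 s - {0} \<Longrightarrow> (0::complex) \<noteq> 0"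
    have "of_real s \<in> cball (0::complex) s - {0}" using s(1) by simp
    from s(2)[OF this] show False by simp
  qed simp_all
qed

text \<open>Converse of the factorisation: the coefficients are the Taylor coefficients of
  \<open>G\<close>, shifted by \<open>r\<close>.\<close>

lemma has_qexp3I:
  assumes G: "G holomorphic_on ball 0 1" and f: "\<And>z. z \<in> upper_half \<Longrightarrow> f z = qpow 3 r z * G (qpow 3 1 z)"
  shows "\<exists>a. has_qexp3 f a \<and> (\<forall>n<r. a n = 0) \<and> a r = G 0"
proof -
  define c where "c = (\<lambda>k. (deriv ^^ k) G 0 / fact k)"
  define a where "a = (\<lambda>n. if n < r then 0 else c (nat (n - r)))"
  have c: "(\<lambda>k. c k * x ^ k) sums G x" if "norm x < 1" for x
    using holomorphic_power_series[OF G, of x] that by (simp add: c_def)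
  have "((\<lambda>n. a n * qpow 3 n z) has_sum f z) UNIV" if z: "z \<in> upper_half" for z
  proof -
    let ?x = "qpow 3 1 z"
    \<comment> \<open>Convergence at a larger radius \<open>y\<close> yields the absolute
      convergence that an unordered sum requires.\<close>
    obtain y where y: "norm ?x < y" "y < 1" using norm_qpow_1_less_1[OF z] dense by blast
    have y0: "0 \<le> y" using y(1) norm_ge_zero[of ?x] by linarith
    have "summable (\<lambda>k. norm (c k * ?x ^ k))"
      by (rule powser_insidea[of _ "of_real y"]) (use c[of "of_real y"] y y0 in \<open>auto simp: sums_iff\<close>)
    hence "((\<lambda>k. c k * ?x ^ k) has_sum G ?x) UNIV"
      by (rule norm_summable_imp_has_sum) (rule c[OF norm_qpow_1_less_1[OF z]])
    from has_sum_cmult_right[OF this, of "qpow 3 r z"]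
    have "((\<lambda>k. a (r + int k) * qpow 3 (r + int k) z) has_sum f z) UNIV"
      by (simp add: f[OF z] a_def qpow_add qpow_of_nat mult_ac)
    hence "((\<lambda>n. a n * qpow 3 n z) has_sum f z) {r..}"
      by (subst (asm) has_sum_reindex_bij_witness[of _ "\<lambda>n. nat (n - r)" "\<lambda>k. r + int k" "{r..}" "\<lambda>n. a n * qpow 3 n z" _ _ "f z"]) auto
    moreover have "((\<lambda>n. a n * qpow 3 n z) has_sum f z) {r..} \<longleftrightarrow> ((\<lambda>n. a n * qpow 3 n z) has_sum f z) UNIV"
      by (rule has_sum_cong_neutral) (auto simp: a_def)
    ultimately show ?thesis by simp
  qed
  moreover have "finite {n. n < 0 \<and> a n \<noteq> 0}"
    by (rule finite_subset[of _ "{r..0}"]) (auto simp: a_def)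
  ultimately have "has_qexp3 f a" by (simp add: has_qexp3_def)
  moreover have "a r = G 0" by (simp add: a_def c_def)
  ultimately show ?thesis by (intro exI[of _ a]) (auto simp: a_def)
qed

lemma has_qexp3_cong: "(\<And>z. z \<in> upper_half \<Longrightarrow> f z = g z) \<Longrightarrow> has_qexp3 f a \<longleftrightarrow> has_qexp3 g a"
  by (auto simp: has_qexp3_def)

lemma has_qexp3_cmult:
  assumes "has_qexp3 f a"
  shows "has_qexp3 (\<lambda>z. c * f z) (\<lambda>n. c * a n)"
proof -
  have "finite {n. n < 0 \<and> c * a n \<noteq> 0}"
    by (rule finite_subset[of _ "{n. n < 0 \<and> a n \<noteq> 0}"]) (use assms in \<open>auto simp: has_qexp3_def\<close>)
  moreover have "((\<lambda>n. c * a n * qpow 3 n z) has_sum c * f z) UNIV" if "z \<in> upper_half" for z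
    using has_sum_cmult_right[of "\<lambda>n. a n * qpow 3 n z" UNIV "f z" c] assms that
    by (auto simp: has_qexp3_def mult_ac)
  ultimately show ?thesis by (simp add: has_qexp3_def)
qed

lemma has_qexp3_add:
  assumes "has_qexp3 f a" "has_qexp3 g b"
  shows "has_qexp3 (\<lambda>z. f z + g z) (\<lambda>n. a n + b n)"
proof -
  have "finite {n. n < 0 \<and> a n + b n \<noteq> 0}"
    by (rule finite_subset[of _ "{n. n < 0 \<and> a n \<noteq> 0} \<union> {n. n < 0 \<and> b n \<noteq> 0}"]) (use assms in \<open>auto simp: has_qexp3_def\<close>)
  moreover have "((\<lambda>n. (a n + b n) * qpow 3 n z) has_sum f z + g z) UNIV" if "z \<in> upper_half" for z
    using has_sum_add[of "\<lambda>n. a n * qpow 3 n z" UNIV "f z" "\<lambda>n. b n * qpow 3 n z" "g z"] assms that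
    by (auto simp: has_qexp3_def distrib_right)
  ultimately show ?thesis by (simp add: has_qexp3_def)
qed

lemma has_qexp3_diff:
  assumes "has_qexp3 f a" "has_qexp3 g b"
  shows "has_qexp3 (\<lambda>z. f z - g z) (\<lambda>n. a n - b n)"
  using has_qexp3_add[OF assms(1) has_qexp3_cmult[OF assms(2), of "-1"]] by simp

lemma has_qexp3_translate:
  assumes "has_qexp3 f a"
  shows "has_qexp3 (\<lambda>z. f (z + 1)) (\<lambda>n. zeta3 powi n * a n)"
proof -
  have "((\<lambda>n. zeta3 powi n * a n * qpow 3 n z) has_sum f (z + 1)) UNIV" if "z \<in> upper_half" for z
  proof -
    have "z + 1 \<in> upper_half" using that by (simp add: upper_half_def)
    hence "((\<lambda>n. a n * qpow 3 n (z + 1)) has_sum f (z + 1)) UNIV" using assms by (simp add: has_qexp3_def)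
    thus ?thesis by (simp add: qpow_plus_1 mult_ac)
  qed
  thus ?thesis using assms by (simp add: has_qexp3_def)
qed

text \<open>Translation multiplies the n-th coefficient by \<open>zeta3 powi n\<close>; by
  uniqueness of coefficients the translation factor is the same datum as the residue class of the
  exponents modulo 3.\<close>

lemma translation_iff_support:
  assumes "has_qexp3 f a"
  shows "(\<forall>z\<in>upper_half. f (z + 1) = zeta3 powi r * f z) \<longleftrightarrow> (\<forall>n. a n \<noteq> 0 \<longrightarrow> n mod 3 = r mod 3)"
proof
  assume "\<forall>z\<in>upper_half. f (z + 1) = zeta3 powi r * f z"
  hence "has_qexp3 (\<lambda>z. zeta3 powi r * f z) (\<lambda>n. zeta3 powi n * a n)"
    using has_qexp3_translate[OF assms] by (subst has_qexp3_cong[of _ "\<lambda>z. f (z + 1)"]) auto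
  from has_qexp3_unique[OF this has_qexp3_cmult[OF assms]]
  have "zeta3 powi n * a n = zeta3 powi r * a n" for n by meson
  thus "\<forall>n. a n \<noteq> 0 \<longrightarrow> n mod 3 = r mod 3" using zeta3_powi_eq_iff by auto
next
  assume *: "\<forall>n. a n \<noteq> 0 \<longrightarrow> n mod 3 = r mod 3"
  show "\<forall>z\<in>upper_half. f (z + 1) = zeta3 powi r * f z"
  proof
    fix z assume z: "z \<in> upper_half"
    have "(\<lambda>n. zeta3 powi n * a n) = (\<lambda>n. zeta3 powi r * a n)"
      using * zeta3_powi_eq_iff by (intro ext) (metis mult_zero_right)
    hence "has_qexp3 (\<lambda>z. f (z + 1)) (\<lambda>n. zeta3 powi r * a n)" using has_qexp3_translate[OF assms] by simp
    thus "f (z + 1) = zeta3 powi r * f z"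
      using z has_qexp3_cmult[OF assms, of "zeta3 powi r"] has_sum_unique unfolding has_qexp3_def by blast
  qed
qed

subsection \<open>Cusp forms for the Fricke group\<close>

lemma fricke_in_upper_half: "z \<in> upper_half \<Longrightarrow> - 1 / (3 * z) \<in> upper_half"
  by (auto simp: upper_half_def Im_divide intro!: divide_pos_pos add_nonneg_pos)

lemma eta_upper_half_nonzero: "z \<in> upper_half \<Longrightarrow> eta z \<noteq> 0" "z \<in> upper_half \<Longrightarrow> eta (3 * z) \<noteq> 0"
  by (simp_all add: eta_nonzero upper_half_def)

lemma eta_fricke:
  assumes "z \<in> upper_half"
  shows "(eta (- 1 / (3 * z)))\<^sup>2 = - \<i> * (3 * z) * (eta (3 * z))\<^sup>2"
    "(eta (3 * (- 1 / (3 * z))))\<^sup>2 = - \<i> * z * (eta z)\<^sup>2"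
  using eta_inversion[of "3 * z"] eta_inversion[of z] assms by (simp_all add: upper_half_def)

lemma h3_fricke:
  assumes "z \<in> upper_half"
  shows "h3 (- 1 / (3 * z)) = - 3 * z\<^sup>2 * h3 z"
  unfolding h3_def eta_fricke[OF assms] by (simp add: power2_eq_square algebra_simps)

lemma h3_nonzero: "z \<in> upper_half \<Longrightarrow> h3 z \<noteq> 0"
  by (simp add: h3_def eta_upper_half_nonzero)

lemma eta_qpow:
  "eta z = exp (2 * of_real pi * \<i> * z / 24) * euler_prod (qpow 3 1 z ^ 3)"
  "eta (3 * z) = exp (2 * of_real pi * \<i> * z / 8) * euler_prod (qpow 3 1 z ^ 9)"
proof -
  have "qexp z = qpow 3 1 z ^ 3" "qexp (3 * z) = qpow 3 1 z ^ 9"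
    unfolding qpow_def exp_of_nat_mult[symmetric] by (simp_all add: mult_ac)
  thus "eta z = exp (2 * of_real pi * \<i> * z / 24) * euler_prod (qpow 3 1 z ^ 3)"
    "eta (3 * z) = exp (2 * of_real pi * \<i> * z / 8) * euler_prod (qpow 3 1 z ^ 9)"
    unfolding eta_altdef by simp_all
qed

lemma h3_factor:
  "h3 z = qpow 3 1 z * ((euler_prod (qpow 3 1 z ^ 3))\<^sup>2 * (euler_prod (qpow 3 1 z ^ 9))\<^sup>2)"
proof -
  \<comment> \<open>The exponent is \<open>2/24 + 2/8 = 1/3\<close>.\<close>
  have e: "(exp (2 * of_real pi * \<i> * z / 24))\<^sup>2 * (exp (2 * of_real pi * \<i> * z / 8))\<^sup>2 = qpow 3 1 z"
    unfolding qpow_def exp_of_nat_mult[symmetric] exp_add[symmetric] by (rule arg_cong[of _ _ exp]) simp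
  show ?thesis unfolding h3_def eta_qpow(2)[of z] eta_qpow(1)[of z] unfolding e[symmetric] power_mult_distrib
    by (simp only: mult_ac)
qed

lemma norm_power_less_one: "norm (x::complex) < 1 \<Longrightarrow> 0 < n \<Longrightarrow> norm (x ^ n) < 1"
  using norm_power_Suc_less_one[of x "n - 1"] by simp

lemma holomorphic_euler_prod_power: "n > 0 \<Longrightarrow> (\<lambda>x. euler_prod (x ^ n)) holomorphic_on ball 0 1"
proof -
  assume "n > 0"
  have "(euler_prod \<circ> (\<lambda>x. x ^ n)) holomorphic_on ball 0 1"
    by (rule holomorphic_on_compose_gen[OF _ holomorphic_euler_prod])
       (use norm_power_less_one \<open>n > 0\<close> in \<open>auto intro!: holomorphic_intros\<close>)
  thus ?thesis by (simp add: o_def)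
qed

lemma euler_prod_0: "euler_prod 0 = 1"
  by (simp add: euler_prod_def)

lemma h3_has_qexp3: "\<exists>a. has_qexp3 h3 a \<and> (\<forall>n<1. a n = 0) \<and> a 1 = 1"
proof -
  let ?G = "\<lambda>x. (euler_prod (x ^ 3))\<^sup>2 * (euler_prod (x ^ 9))\<^sup>2"
  have "?G holomorphic_on ball 0 1"
    by (intro holomorphic_intros holomorphic_euler_prod_power) auto
  from has_qexp3I[OF this, of h3 1] show ?thesis by (simp add: h3_factor euler_prod_0)
qed

lemma h3_plus_1: "h3 (z + 1) = zeta3 * h3 z"
proof -
  have q: "qpow 3 1 (z + 1) = zeta3 * qpow 3 1 z" using qpow_plus_1[of 1 z] by simp
  have "zeta3 ^ 3 = 1" using zeta3_powi_eq_1_iff[of 3] by simp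
  moreover have "zeta3 ^ 9 = (zeta3 ^ 3) ^ 3" unfolding power_mult[symmetric] by simp
  ultimately show ?thesis unfolding h3_factor q power_mult_distrib by simp
qed

text \<open>If \<open>Im z < 1/4\<close>, shift to \<open>\<bar>Re v\<bar> \<le> 1/2\<close>; then
  \<open>3 |v|^2 \<le> 3 (1/4 + 1/16) = 15/16\<close>, so inversion enlarges the imaginary part by
  at least \<open>16/15\<close>. The threshold lies below the lowest point \<open>sqrt 3 / 6\<close>
  of the fundamental domain, and this slack makes the growth geometric.\<close>

lemma fricke_reduction:
  fixes \<phi> :: "complex \<Rightarrow> real"
  assumes T: "\<And>z. z \<in> upper_half \<Longrightarrow> \<phi> (z + 1) = \<phi> z"
    and W: "\<And>z. z \<in> upper_half \<Longrightarrow> \<phi> (- 1 / (3 * z)) = \<phi> z"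
    and "z \<in> upper_half"
  obtains w where "Im w \<ge> 1/4" "\<phi> w = \<phi> z"
proof -
  have T': "\<phi> (z + of_int k) = \<phi> z" if z: "z \<in> upper_half" for z k
  proof (induction k rule: int_induct[where k = 0])
    case (step1 i)
    have "z + of_int i \<in> upper_half" using z by (simp add: upper_half_def)
    from T[OF this] step1 show ?case by (simp add: add.assoc)
  next
    case (step2 i)
    have "z + of_int (i - 1) \<in> upper_half" using z by (simp add: upper_half_def)
    from T[OF this] step2 show ?case by (simp add: add.assoc)
  qed simp
  \<comment> \<open>The index \<open>n\<close> bounds the number of inversions that are still
    needed.\<close>
  have main: "\<exists>w. Im w \<ge> 1/4 \<and> \<phi> w = \<phi> z" if "z \<in> upper_half" "Im z * (16/15) ^ n \<ge> 1/4" for n z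
    using that
  proof (induction n arbitrary: z)
    case 0
    thus ?case by (intro exI[of _ z]) simp
  next
    case (Suc n)
    show ?case
    proof (cases "Im z \<ge> 1/4")
      case False
      define v where "v = z + of_int (- round (Re z))"
      have v: "v \<in> upper_half" using Suc.prems by (simp add: v_def upper_half_def)
      have "\<bar>Re v\<bar> \<le> 1/2" using of_int_round_abs_le[of "Re z"] by (simp add: v_def abs_minus_commute)
      hence "(Re v)\<^sup>2 \<le> (1/2)\<^sup>2" by (rule power2_le_iff_abs_le[THEN iffD2, rotated]) simp
      moreover have "(Im v)\<^sup>2 \<le> (1/4)\<^sup>2" using False v
        by (intro power_mono) (auto simp: v_def upper_half_def)
      ultimately have n: "3 * (norm v)\<^sup>2 \<le> 15/16" by (simp add: cmod_power2 power_divide)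
      have v0: "v \<noteq> 0" using v by (auto simp: upper_half_def)
      define w where "w = - 1 / (3 * v)"
      have w: "w \<in> upper_half" unfolding w_def by (rule fricke_in_upper_half[OF v])
      have "Im w = Im v / (3 * (norm v)\<^sup>2)"
      proof -
        have "w = of_real (- 1/3) * inverse v" by (simp add: w_def field_simps)
        thus ?thesis by (simp add: cmod_power2)
      qed
      also have "\<dots> \<ge> Im v / (15/16)"
        using n v v0 by (intro divide_left_mono) (auto simp: upper_half_def)
      finally have "Im w \<ge> Im z * (16/15)" by (simp add: v_def)
      hence "Im w * (16/15) ^ n \<ge> Im z * (16/15) * (16/15) ^ n" by (intro mult_right_mono) auto
      moreover have "Im z * (16/15) * (16/15) ^ n \<ge> 1/4" using Suc.prems(2) by (simp only: power_Suc mult.assoc)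
      ultimately have "Im w * (16/15) ^ n \<ge> 1/4" by linarith
      hence "\<exists>u. Im u \<ge> 1/4 \<and> \<phi> u = \<phi> w" by (rule Suc.IH[OF w])
      moreover have "\<phi> w = \<phi> v" unfolding w_def by (rule W[OF v])
      moreover have "\<phi> v = \<phi> z" unfolding v_def by (rule T'[OF Suc.prems(1)])
      ultimately show ?thesis by simp
    qed (auto intro!: exI[of _ z])
  qed
  obtain n where "(16/15) ^ n > 1 / (4 * Im z)" using real_arch_pow[of "16/15" "1 / (4 * Im z)"] by auto
  hence "Im z * (16/15) ^ n \<ge> 1/4" using assms(3) by (simp add: upper_half_def field_simps)
  with main[OF assms(3)] that show ?thesis by blast
qed

text \<open>Dividing by the zero-free form \<open>h3\<close> gives a function whose modulus is invariant under the
  Fricke group, hence takes its maximum at an interior point of the \<open>q\<close>-disc.\<close>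
lemma cusp_form_eq_multiple_of_h3:
  assumes f: "has_qexp3 f a" and a: "\<And>n. n \<le> 0 \<Longrightarrow> a n = 0"
    and T: "\<And>z. z \<in> upper_half \<Longrightarrow> norm (f (z + 1)) = norm (f z)"
    and W: "\<And>z. z \<in> upper_half \<Longrightarrow> norm (f (- 1 / (3 * z))) = norm (3 * z\<^sup>2 * f z)"
  obtains c where "\<And>z. z \<in> upper_half \<Longrightarrow> f z = c * h3 z"
proof -
  define H where "H = (\<lambda>x. (euler_prod (x ^ 3))\<^sup>2 * (euler_prod (x ^ 9))\<^sup>2)"
  have H: "H holomorphic_on ball 0 1" "\<And>x. x \<in> ball 0 1 \<Longrightarrow> H x \<noteq> 0"
    unfolding H_def by (intro holomorphic_intros holomorphic_euler_prod_power)
      (use euler_prod_nonzero norm_power_less_one in auto)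
  \<comment> \<open>All exponents are at least 1, the leading exponent of \<open>h3\<close>, so the
    common factor \<open>q^(1/3)\<close> cancels in the quotient, which is then holomorphic at the
    cusp.\<close>
  obtain G where G: "G holomorphic_on ball 0 1" "\<And>z. z \<in> upper_half \<Longrightarrow> f z = qpow 3 1 z * G (qpow 3 1 z)"
  proof -
    have "\<And>n. n < 1 \<Longrightarrow> a n = 0" by (rule a) simp
    from has_qexp3_imp_holomorphic_factor[OF f this] show ?thesis using that by blast
  qed
  define g where "g = (\<lambda>x. G x / H x)"
  have g: "g holomorphic_on ball 0 1" unfolding g_def by (intro holomorphic_intros G H) auto
  have fg: "f z / h3 z = g (qpow 3 1 z)" if "z \<in> upper_half" for z
    unfolding g_def G(2)[OF that] h3_factor H_def by simp
  define \<phi> where "\<phi> = (\<lambda>z. norm (f z / h3 z))"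
  have \<phi>T: "\<phi> (z + 1) = \<phi> z" if "z \<in> upper_half" for z
    using T[OF that] by (simp add: \<phi>_def norm_divide h3_plus_1 norm_mult)
  have \<phi>W: "\<phi> (- 1 / (3 * z)) = \<phi> z" if "z \<in> upper_half" for z
    using W[OF that] upper_half_nonzero[OF that] unfolding \<phi>_def norm_divide h3_fricke[OF that]
    by (simp add: norm_mult)
  \<comment> \<open>The modulus of \<open>q^(1/3)\<close> on the line \<open>Im w = 1/4\<close>: the
    reduced points correspond to the disc of radius \<open>R\<close>.\<close>
  define R where "R = exp (- (pi / 6))"
  have R: "0 < R" "R < 1" by (simp_all add: R_def)
  have "continuous_on (cball 0 R) (\<lambda>x. norm (g x))"
    using R by (intro continuous_intros holomorphic_on_imp_continuous_on holomorphic_on_subset[OF g]) auto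
  then obtain x0 where x0: "x0 \<in> cball 0 R" "\<And>x. x \<in> cball 0 R \<Longrightarrow> norm (g x) \<le> norm (g x0)"
    using continuous_attains_sup[of "cball 0 R" "\<lambda>x. norm (g x)"] R by auto
  have max: "norm (g x) \<le> norm (g x0)" if x: "x \<in> ball 0 1" for x
  proof (cases "x = 0")
    case True
    thus ?thesis using x0(2)[of 0] R by simp
  next
    case False
    then obtain z where z: "z \<in> upper_half" "qpow 3 1 z = x" using x qpow_1_surj[of x] by auto
    obtain w where w: "Im w \<ge> 1/4" "\<phi> w = \<phi> z"
      using fricke_reduction[OF \<phi>T \<phi>W z(1)] by blast
    have wH: "w \<in> upper_half" using w(1) by (simp add: upper_half_def)
    have "norm (qpow 3 1 w) \<le> R"
      using w(1) by (simp add: qpow_def R_def field_simps)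
    hence "norm (g (qpow 3 1 w)) \<le> norm (g x0)" by (intro x0(2)) simp
    thus ?thesis using w(2) fg[OF wH] fg[OF z(1)] z(2) by (simp add: \<phi>_def)
  qed
  have "g constant_on ball 0 1"
    by (rule maximum_modulus_principle[OF g _ _ open_ball order_refl _ max]) (use x0(1) R in auto)
  then obtain c where c: "\<And>x. x \<in> ball 0 1 \<Longrightarrow> g x = c" by (auto simp: constant_on_def)
  show ?thesis
  proof (rule that)
    fix z assume z: "z \<in> upper_half"
    show "f z = c * h3 z"
      using fg[OF z] c[OF qpow_1_in_ball[OF z]] h3_nonzero[OF z] by (simp add: field_simps)
  qed
qed

subsection \<open>Construction of the forms\<close>

text \<open>Invariance under the two generators, with the weight-2 slash operator written out:
  \<open>r\<close> is the exponent of the character at \<open>z + 1\<close>, and \<open>s\<close>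
  the eigenvalue under \<open>W3\<close>.\<close>

definition fricke_equivariant :: "int \<Rightarrow> complex \<Rightarrow> (complex \<Rightarrow> complex) \<Rightarrow> bool" where
  "fricke_equivariant r s f \<longleftrightarrow>
     (\<forall>z\<in>upper_half. f (z + 1) = zeta3 powi r * f z) \<and>
     (\<forall>z\<in>upper_half. f (- 1 / (3 * z)) = s * (3 * z\<^sup>2) * f z)"

lemma fricke_equivariant_cmult: "fricke_equivariant r s f \<Longrightarrow> fricke_equivariant r s (\<lambda>z. c * f z)"
  by (simp add: fricke_equivariant_def mult_ac)

lemma fricke_equivariant_add:
  "fricke_equivariant r s f \<Longrightarrow> fricke_equivariant r s g \<Longrightarrow> fricke_equivariant r s (\<lambda>z. f z + g z)"
  by (simp add: fricke_equivariant_def distrib_left)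

lemma fricke_equivariant_diff:
  "fricke_equivariant r s f \<Longrightarrow> fricke_equivariant r s g \<Longrightarrow> fricke_equivariant r s (\<lambda>z. f z - g z)"
  by (simp add: fricke_equivariant_def right_diff_distrib)

lemma fricke_equivariant_sum:
  "(\<And>i. i \<in> I \<Longrightarrow> fricke_equivariant r s (f i)) \<Longrightarrow> fricke_equivariant r s (\<lambda>z. \<Sum>i\<in>I. f i z)"
  by (simp add: fricke_equivariant_def sum_distrib_left)

lemma has_qexp3_zero: "has_qexp3 (\<lambda>_. 0) (\<lambda>_. 0)"
  by (simp add: has_qexp3_def)

lemma has_qexp3_sum:
  "(\<And>i. i \<in> I \<Longrightarrow> has_qexp3 (f i) (a i)) \<Longrightarrow> has_qexp3 (\<lambda>z. \<Sum>i\<in>I. f i z) (\<lambda>n. \<Sum>i\<in>I. a i n)"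
  by (induction I rule: infinite_finite_induct) (auto intro: has_qexp3_zero has_qexp3_add)

section \<open>Leading terms under products, quotients and derivatives\<close>

text \<open>Keeps the factor \<open>G\<close> explicit, so that the leading coefficient
  \<open>G 0\<close> can be followed through the constructions without computing any other
  coefficient.\<close>

definition q_factor :: "int \<Rightarrow> (complex \<Rightarrow> complex) \<Rightarrow> (complex \<Rightarrow> complex) \<Rightarrow> bool" where
  "q_factor r f G \<longleftrightarrow> G holomorphic_on ball 0 1 \<and> (\<forall>z\<in>upper_half. f z = qpow 3 r z * G (qpow 3 1 z))"

lemma q_factor_mult:
  "q_factor r f G \<Longrightarrow> q_factor k g K \<Longrightarrow> q_factor (r + k) (\<lambda>z. f z * g z) (\<lambda>x. G x * K x)"
  by (auto simp: q_factor_def qpow_add intro!: holomorphic_intros)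

lemma q_factor_divide:
  assumes "q_factor r f G" "q_factor k g K" "\<And>x. x \<in> ball 0 1 \<Longrightarrow> K x \<noteq> 0"
  shows "q_factor (r - k) (\<lambda>z. f z / g z) (\<lambda>x. G x / K x)"
  using assms qpow_add[of 3 r "- k"]
  by (auto simp: q_factor_def qpow_minus divide_inverse intro!: holomorphic_intros)

lemma q_factor_add:
  assumes "q_factor r f G" "q_factor (r + int k) g K"
  shows "q_factor r (\<lambda>z. f z + c * g z) (\<lambda>x. G x + c * (x ^ k * K x))"
  using assms by (auto simp: q_factor_def qpow_add qpow_of_nat algebra_simps intro!: holomorphic_intros)

lemma q_factor_power: "q_factor r f G \<Longrightarrow> q_factor (int m * r) (\<lambda>z. f z ^ m) (\<lambda>x. G x ^ m)"
proof (induction m)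
  case 0 thus ?case by (simp add: q_factor_def)
next
  case (Suc m)
  from q_factor_mult[OF Suc.prems Suc.IH[OF Suc.prems]] show ?case by (simp add: algebra_simps)
qed

lemma q_factor_has_derivative:
  assumes "q_factor r f G" "z \<in> upper_half"
  shows "(f has_field_derivative 2 * of_real pi * \<i> / 3 * (qpow 3 r z * (of_int r * G (qpow 3 1 z) + qpow 3 1 z * deriv G (qpow 3 1 z)))) (at z)"
proof -
  let ?x = "qpow 3 1 z"
  have q: "(qpow 3 n has_field_derivative 2 * of_real pi * \<i> / 3 * of_int n * qpow 3 n z) (at z)" for n
    unfolding qpow_def[abs_def] by (auto intro!: derivative_eq_intros)
  have "(G has_field_derivative deriv G ?x) (at ?x)"
    using assms qpow_1_in_ball by (intro holomorphic_derivI[of G "ball 0 1"]) (auto simp: q_factor_def)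
  from DERIV_mult'[OF q[of r] DERIV_chain2[OF this q[of 1]]]
  have "((\<lambda>z. qpow 3 r z * G (qpow 3 1 z)) has_field_derivative
     2 * of_real pi * \<i> / 3 * (qpow 3 r z * (of_int r * G ?x + ?x * deriv G ?x))) (at z)"
    by (rule DERIV_cong) (simp add: algebra_simps)
  thus ?thesis
    by (rule has_field_derivative_transform_within_open[OF _ open_upper_half assms(2)])
       (use assms(1) in \<open>auto simp: q_factor_def\<close>)
qed

lemma q_factor_deriv:
  assumes "q_factor r f G"
  shows "q_factor r (deriv f) (\<lambda>x. 2 * of_real pi * \<i> / 3 * (of_int r * G x + x * deriv G x))"
proof -
  have "deriv f z = qpow 3 r z * (2 * of_real pi * \<i> / 3 * (of_int r * G (qpow 3 1 z) + qpow 3 1 z * deriv G (qpow 3 1 z)))"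
    if "z \<in> upper_half" for z
    using DERIV_imp_deriv[OF q_factor_has_derivative[OF assms that]] by simp
  thus ?thesis using assms
    by (auto simp: q_factor_def intro!: holomorphic_intros holomorphic_deriv)
qed

lemma q_factor_differentiable: "q_factor r f G \<Longrightarrow> z \<in> upper_half \<Longrightarrow> (f has_field_derivative deriv f z) (at z)"
  using q_factor_has_derivative[of r f G z] DERIV_imp_deriv by metis

lemma deriv_translate:
  assumes "q_factor k f G" "\<And>z. z \<in> upper_half \<Longrightarrow> f (z + 1) = c * f z" "z \<in> upper_half"
  shows "deriv f (z + 1) = c * deriv f z"
proof -
  have "z + 1 \<in> upper_half" using assms(3) by (simp add: upper_half_def)
  note d = q_factor_differentiable[OF assms(1) this]
  have "((\<lambda>z. z + 1) has_field_derivative 1) (at z)" by (auto intro!: derivative_eq_intros)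
  from DERIV_chain2[where f = f and g = "\<lambda>z. z + 1", OF d this]
  have "((\<lambda>z. f (z + 1)) has_field_derivative deriv f (z + 1)) (at z)" by simp
  moreover have "((\<lambda>z. f (z + 1)) has_field_derivative c * deriv f z) (at z)"
    by (rule has_field_derivative_transform_within_open[OF DERIV_cmult[OF q_factor_differentiable[OF assms(1,3)]] open_upper_half assms(3)])
       (use assms(2) in auto)
  ultimately show ?thesis by (rule DERIV_unique)
qed

text \<open>Chain rule, with \<open>1/(3 z^2)\<close> the derivative of \<open>- 1 / (3 z)\<close>.
  The image \<open>g\<close> is arbitrary in order to cover both the Hauptmodul, sent to
  \<open>729 / t\<close>, and invariant functions, whose derivatives get weight 2.\<close>

lemma deriv_fricke:
  assumes "q_factor k f G" "\<And>z. z \<in> upper_half \<Longrightarrow> f (- 1 / (3 * z)) = g z"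
    "z \<in> upper_half" "(g has_field_derivative g') (at z)"
  shows "deriv f (- 1 / (3 * z)) = 3 * z\<^sup>2 * g'"
proof -
  have z0: "z \<noteq> 0" by (rule upper_half_nonzero[OF assms(3)])
  have W: "((\<lambda>z. - 1 / (3 * z)) has_field_derivative 1 / (3 * z\<^sup>2)) (at z)"
    using z0 by (auto intro!: derivative_eq_intros simp: power2_eq_square field_simps)
  have "((\<lambda>z. f (- 1 / (3 * z))) has_field_derivative deriv f (- 1 / (3 * z)) * (1 / (3 * z\<^sup>2))) (at z)"
    by (rule DERIV_chain2[OF q_factor_differentiable[OF assms(1) fricke_in_upper_half[OF assms(3)]] W])
  moreover have "((\<lambda>z. f (- 1 / (3 * z))) has_field_derivative g') (at z)"
    by (rule has_field_derivative_transform_within_open[OF assms(4) open_upper_half assms(3)])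
       (use assms(2) in auto)
  ultimately have "deriv f (- 1 / (3 * z)) * (1 / (3 * z\<^sup>2)) = g'" by (rule DERIV_unique)
  thus ?thesis using z0 by (simp add: field_simps)
qed

section \<open>The Hauptmodul and its logarithmic derivative\<close>

text \<open>The Hauptmodul \<open>t\<close> of \<open>\<Gamma>_0(3)\<close>. The power 12 makes the
  leading exponent \<open>12 (1/24 - 1/8) = -1\<close> in \<open>q\<close>, written as -3 in powers
  of \<open>q^(1/3)\<close>.\<close>

definition hauptmodul :: "complex \<Rightarrow> complex" where
  "hauptmodul z = (eta z / eta (3 * z)) ^ 12"

definition hauptmodul_factor :: "complex \<Rightarrow> complex" where
  "hauptmodul_factor x = (euler_prod (x ^ 3) / euler_prod (x ^ 9)) ^ 12"

lemma hauptmodul_nonzero: "z \<in> upper_half \<Longrightarrow> hauptmodul z \<noteq> 0"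
  by (simp add: hauptmodul_def eta_upper_half_nonzero)

lemma hauptmodul_factor_nonzero: "x \<in> ball 0 1 \<Longrightarrow> hauptmodul_factor x \<noteq> 0"
  using norm_power_less_one[of x 3] norm_power_less_one[of x 9]
  by (auto simp: hauptmodul_factor_def euler_prod_nonzero)

lemma q_factor_hauptmodul: "q_factor (- 3) hauptmodul hauptmodul_factor"
proof -
  have nz: "euler_prod (x ^ 9) \<noteq> 0" if "x \<in> ball 0 1" for x
    using norm_power_less_one[of x 9] that by (auto intro!: euler_prod_nonzero)
  have "hauptmodul_factor holomorphic_on ball 0 1"
    unfolding hauptmodul_factor_def[abs_def]
    by (intro holomorphic_intros holomorphic_euler_prod_power) (use nz in auto)
  moreover have "hauptmodul z = qpow 3 (- 3) z * hauptmodul_factor (qpow 3 1 z)" for z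
  proof -
    have "exp (2 * of_real pi * \<i> * z / 24) / exp (2 * of_real pi * \<i> * z / 8) = exp (- (2 * of_real pi * \<i> * z) / 12)"
      unfolding exp_diff[symmetric] by (rule arg_cong[of _ _ exp]) simp
    hence "(exp (2 * of_real pi * \<i> * z / 24) / exp (2 * of_real pi * \<i> * z / 8)) ^ 12 = qpow 3 (- 3) z"
      unfolding qpow_def by (simp only: exp_of_nat_mult[symmetric]) simp
    thus ?thesis unfolding hauptmodul_def hauptmodul_factor_def eta_qpow(2)[of z] eta_qpow(1)[of z]
      by (simp only: times_divide_times_eq[symmetric] power_mult_distrib)
  qed
  ultimately show ?thesis by (simp add: q_factor_def)
qed

lemma hauptmodul_factor_0: "hauptmodul_factor 0 = 1"
  by (simp add: hauptmodul_factor_def euler_prod_0)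

text \<open>The inversion turns the quotient of the squared etas into 3 times its reciprocal, and
  \<open>3^6 = 729\<close>.\<close>

lemma hauptmodul_fricke:
  assumes "z \<in> upper_half"
  shows "hauptmodul (- 1 / (3 * z)) = 729 / hauptmodul z"
proof -
  have t: "hauptmodul w = ((eta w)\<^sup>2 / (eta (3 * w))\<^sup>2) ^ 6" for w
    unfolding hauptmodul_def power_divide[symmetric] power_mult[symmetric] by simp
  have z0: "z \<noteq> 0" by (rule upper_half_nonzero[OF assms])
  have "hauptmodul (- 1 / (3 * z)) = (3 * ((eta (3 * z))\<^sup>2 / (eta z)\<^sup>2)) ^ 6"
    unfolding t[of "- 1 / (3 * z)"] eta_fricke[OF assms] using z0 by simp
  also have "\<dots> = 729 / hauptmodul z"
    unfolding t[of z] power_mult_distrib power_divide by simp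
  finally show ?thesis .
qed

lemma hauptmodul_plus_1:
  assumes "z \<in> upper_half"
  shows "hauptmodul (z + 1) = hauptmodul z"
proof -
  have "z + 1 \<in> upper_half" using assms by (simp add: upper_half_def)
  moreover have "qpow 3 1 (z + 1) = zeta3 * qpow 3 1 z" using qpow_plus_1[of 1 z] by simp
  moreover have z3: "zeta3 ^ 3 = 1" using zeta3_powi_eq_1_iff[of 3] by simp
  have "zeta3 ^ 9 = (zeta3 ^ 3) ^ 3" unfolding power_mult[symmetric] by simp
  hence "zeta3 ^ 9 = 1" unfolding z3 by simp
  moreover have "zeta3 powi (- 3) = 1" by (simp only: zeta3_powi_eq_1_iff) simp
  ultimately show ?thesis using q_factor_hauptmodul assms z3
    by (simp add: q_factor_def hauptmodul_factor_def qpow_plus_1 power_mult_distrib)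
qed

text \<open>The form \<open>L\<close>: of weight 2, translation invariant, with eigenvalue -1 under
  \<open>W3\<close> since \<open>t\<close> goes to a multiple of \<open>1/t\<close>. It is
  holomorphic because \<open>t\<close> has no zeros, and its constant term is nonzero because
  \<open>t\<close> has a pole at the cusp.\<close>

abbreviation hauptmodul_logderiv :: "complex \<Rightarrow> complex" where
  "hauptmodul_logderiv z \<equiv> deriv hauptmodul z / hauptmodul z"

lemma hauptmodul_logderiv_plus_1:
  assumes "z \<in> upper_half"
  shows "hauptmodul_logderiv (z + 1) = hauptmodul_logderiv z"
  using deriv_translate[OF q_factor_hauptmodul, of 1 z] hauptmodul_plus_1 assms by simp

lemma hauptmodul_logderiv_fricke:
  assumes "z \<in> upper_half"
  shows "hauptmodul_logderiv (- 1 / (3 * z)) = - (3 * z\<^sup>2) * hauptmodul_logderiv z"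
proof -
  have "((\<lambda>z. 729 / hauptmodul z) has_field_derivative - (729 * deriv hauptmodul z / (hauptmodul z)\<^sup>2)) (at z)"
    using hauptmodul_nonzero[OF assms]
    by (auto intro!: derivative_eq_intros q_factor_differentiable[OF q_factor_hauptmodul assms] simp: power2_eq_square)
  from deriv_fricke[OF q_factor_hauptmodul hauptmodul_fricke assms this]
  show ?thesis unfolding hauptmodul_fricke[OF assms] using hauptmodul_nonzero[OF assms]
    by (simp add: field_simps power2_eq_square)
qed

lemma q_factor_hauptmodul_logderiv:
  "\<exists>G. q_factor 0 hauptmodul_logderiv G \<and> G 0 \<noteq> 0"
proof -
  let ?G = "\<lambda>x. 2 * of_real pi * \<i> / 3 * (of_int (- 3) * hauptmodul_factor x + x * deriv hauptmodul_factor x) / hauptmodul_factor x"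
  from q_factor_divide[OF q_factor_deriv[OF q_factor_hauptmodul] q_factor_hauptmodul hauptmodul_factor_nonzero]
  have "q_factor 0 hauptmodul_logderiv ?G" by simp
  moreover have "?G 0 \<noteq> 0" by (simp add: hauptmodul_factor_0)
  ultimately show ?thesis by blast
qed

lemma q_factor_h3: "q_factor 1 h3 (\<lambda>x. (euler_prod (x ^ 3))\<^sup>2 * (euler_prod (x ^ 9))\<^sup>2)"
  by (auto simp: q_factor_def h3_factor intro!: holomorphic_intros holomorphic_euler_prod_power)

lemma h3_factor_nonzero: "x \<in> ball 0 1 \<Longrightarrow> (euler_prod (x ^ 3))\<^sup>2 * (euler_prod (x ^ 9))\<^sup>2 \<noteq> 0"
  using norm_power_less_one[of x 3] norm_power_less_one[of x 9] by (auto simp: euler_prod_nonzero)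

lemma fricke_equivariant_h3: "fricke_equivariant 1 (-1) h3"
  unfolding fricke_equivariant_def by (intro conjI ballI, simp_all only: h3_plus_1 h3_fricke) simp_all

section \<open>Base forms for each character and sign\<close>

text \<open>The quotient \<open>L^2 / h3\<close> has weight \<open>2 + 2 - 2\<close>, the inverse
  translation factor of \<open>h3\<close>, and the sign \<open>(-1)(-1)/(-1) = -1\<close>.\<close>

lemma base_form_conj_minus:
  "\<exists>b B. fricke_equivariant (-1) (-1) b \<and> q_factor (-1) b B \<and> B 0 \<noteq> 0"
proof -
  obtain G where G: "q_factor 0 hauptmodul_logderiv G" "G 0 \<noteq> 0" using q_factor_hauptmodul_logderiv by blast
  let ?b = "\<lambda>z. hauptmodul_logderiv z * hauptmodul_logderiv z / h3 z"
  have "fricke_equivariant (-1) (-1) ?b"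
    unfolding fricke_equivariant_def
  proof (intro conjI ballI)
    fix z assume z: "z \<in> upper_half"
    show "?b (z + 1) = zeta3 powi (- 1) * ?b z"
      unfolding hauptmodul_logderiv_plus_1[OF z] h3_plus_1 by (simp add: power_int_minus field_simps)
    show "?b (- 1 / (3 * z)) = - 1 * (3 * z\<^sup>2) * ?b z"
      unfolding hauptmodul_logderiv_fricke[OF z] h3_fricke[OF z] using upper_half_nonzero[OF z] h3_nonzero[OF z]
      by (simp add: field_simps power2_eq_square)
  qed
  moreover from q_factor_divide[OF q_factor_mult[OF G(1) G(1)] q_factor_h3 h3_factor_nonzero]
  have "q_factor (-1) ?b (\<lambda>x. G x * G x / ((euler_prod (x ^ 3))\<^sup>2 * (euler_prod (x ^ 9))\<^sup>2))" by simp
  moreover have "(\<lambda>x. G x * G x / ((euler_prod (x ^ 3))\<^sup>2 * (euler_prod (x ^ 9))\<^sup>2)) 0 \<noteq> 0"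
    using G(2) by (simp add: euler_prod_0)
  ultimately show ?thesis by blast
qed

text \<open>The signs cancel in \<open>L / h3\<close>, an invariant function of weight 0 up to its
  translation factor, so its derivative has weight 2 and sign +1. Differentiation preserves the
  leading term because its exponent -1 is nonzero.\<close>

lemma base_form_conj_plus:
  "\<exists>b B. fricke_equivariant (-1) 1 b \<and> q_factor (-1) b B \<and> B 0 \<noteq> 0"
proof -
  obtain G where G: "q_factor 0 hauptmodul_logderiv G" "G 0 \<noteq> 0" using q_factor_hauptmodul_logderiv by blast
  let ?u = "\<lambda>z. hauptmodul_logderiv z / h3 z"
  from q_factor_divide[OF G(1) q_factor_h3 h3_factor_nonzero]
  have u: "q_factor (-1) ?u (\<lambda>x. G x / ((euler_prod (x ^ 3))\<^sup>2 * (euler_prod (x ^ 9))\<^sup>2))" by simp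
  have "fricke_equivariant (-1) 1 (deriv ?u)"
    unfolding fricke_equivariant_def
  proof (intro conjI ballI)
    fix z assume z: "z \<in> upper_half"
    show "deriv ?u (z + 1) = zeta3 powi (- 1) * deriv ?u z"
    proof (rule deriv_translate[OF u _ z])
      show "?u (z + 1) = zeta3 powi (- 1) * ?u z" if "z \<in> upper_half" for z
        unfolding hauptmodul_logderiv_plus_1[OF that] h3_plus_1 by (simp add: power_int_minus field_simps)
    qed
    have "deriv ?u (- 1 / (3 * z)) = 3 * z\<^sup>2 * deriv ?u z"
    proof (rule deriv_fricke[OF u _ z q_factor_differentiable[OF u z]])
      show "?u (- 1 / (3 * z)) = ?u z" if z: "z \<in> upper_half" for z
        unfolding hauptmodul_logderiv_fricke[OF z] h3_fricke[OF z] using upper_half_nonzero[OF z] h3_nonzero[OF z]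
        by (simp add: field_simps)
    qed
    thus "deriv ?u (- 1 / (3 * z)) = 1 * (3 * z\<^sup>2) * deriv ?u z" by simp
  qed
  moreover let ?U = "\<lambda>x. G x / ((euler_prod (x ^ 3))\<^sup>2 * (euler_prod (x ^ 9))\<^sup>2)"
  have "(\<lambda>x. 2 * of_real pi * \<i> / 3 * (of_int (- 1) * ?U x + x * deriv ?U x)) 0 \<noteq> 0"
    using G(2) by (simp add: euler_prod_0)
  ultimately show ?thesis using q_factor_deriv[OF u] by blast
qed

text \<open>The function \<open>t - 729/t\<close> is negated by \<open>W3\<close>, which reverses
  the sign of \<open>h3\<close>.\<close>

lemma base_form_plus:
  "\<exists>b B. fricke_equivariant 1 1 b \<and> q_factor (-2) b B \<and> B 0 \<noteq> 0"
proof -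
  let ?m = "\<lambda>z. hauptmodul z + (- 729) * (1 / hauptmodul z)"
  let ?M = "\<lambda>x. hauptmodul_factor x + (- 729) * (x ^ 6 * (1 / hauptmodul_factor x))"
  have one: "q_factor 0 (\<lambda>_. 1) (\<lambda>_. 1)" by (simp add: q_factor_def)
  have m: "q_factor (- 3) ?m ?M"
    using q_factor_divide[OF one q_factor_hauptmodul hauptmodul_factor_nonzero]
    by (intro q_factor_add q_factor_hauptmodul) simp
  have "fricke_equivariant 1 1 (\<lambda>z. h3 z * ?m z)"
    unfolding fricke_equivariant_def
  proof (intro conjI ballI)
    fix z assume z: "z \<in> upper_half"
    show "h3 (z + 1) * ?m (z + 1) = zeta3 powi 1 * (h3 z * ?m z)"
      by (simp add: hauptmodul_plus_1[OF z] h3_plus_1)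
    show "h3 (- 1 / (3 * z)) * ?m (- 1 / (3 * z)) = 1 * (3 * z\<^sup>2) * (h3 z * ?m z)"
      unfolding hauptmodul_fricke[OF z] h3_fricke[OF z] using hauptmodul_nonzero[OF z]
      by (simp add: field_simps)
  qed
  moreover from q_factor_mult[OF q_factor_h3 m]
  have "q_factor (- 2) (\<lambda>z. h3 z * ?m z) (\<lambda>x. (euler_prod (x ^ 3))\<^sup>2 * (euler_prod (x ^ 9))\<^sup>2 * ?M x)" by simp
  moreover have "(\<lambda>x. (euler_prod (x ^ 3))\<^sup>2 * (euler_prod (x ^ 9))\<^sup>2 * ?M x) 0 \<noteq> 0"
    by (simp add: euler_prod_0 hauptmodul_factor_0)
  ultimately show ?thesis by blast
qed

section \<open>Forms with a pole of prescribed order\<close>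

definition hauptmodul_star :: "complex \<Rightarrow> complex" where
  "hauptmodul_star z = hauptmodul z + 729 * (1 / hauptmodul z)"

lemma hauptmodul_star_invariant:
  assumes "z \<in> upper_half"
  shows "hauptmodul_star (z + 1) = hauptmodul_star z" "hauptmodul_star (- 1 / (3 * z)) = hauptmodul_star z"
  unfolding hauptmodul_star_def hauptmodul_plus_1[OF assms] hauptmodul_fricke[OF assms]
  using hauptmodul_nonzero[OF assms] by simp_all

lemma q_factor_hauptmodul_star: "\<exists>J. q_factor (- 3) hauptmodul_star J \<and> J 0 = 1"
proof -
  have one: "q_factor 0 (\<lambda>_. 1) (\<lambda>_. 1)" by (simp add: q_factor_def)
  let ?J = "\<lambda>x. hauptmodul_factor x + 729 * (x ^ 6 * (1 / hauptmodul_factor x))"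
  have "q_factor (- 3) hauptmodul_star ?J"
    unfolding hauptmodul_star_def[abs_def]
    using q_factor_divide[OF one q_factor_hauptmodul hauptmodul_factor_nonzero]
    by (intro q_factor_add q_factor_hauptmodul) simp
  moreover have "?J 0 = 1" by (simp add: hauptmodul_factor_0)
  ultimately show ?thesis by blast
qed

text \<open>Triangular elimination: multiplying \<open>b\<close> by the m-th power of
  \<open>hauptmodul_star\<close> gives leading exponent \<open>k - 3 m\<close>. The forms for
  smaller \<open>m\<close> each have a single exponent up to \<open>k\<close>, so subtracting them
  clears all others.\<close>

lemma forms_with_prescribed_pole:
  assumes b: "fricke_equivariant r s b" "q_factor k b B" "B 0 \<noteq> 0"
  shows "\<exists>f a. fricke_equivariant r s f \<and> has_qexp3 f a \<and> a (k - 3 * int m) = 1 \<and>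
           (\<forall>n\<le>k. n \<noteq> k - 3 * int m \<longrightarrow> a n = 0)"
proof (induction m rule: less_induct)
  case (less m)
  obtain J where J: "q_factor (- 3) hauptmodul_star J" "J 0 = 1" using q_factor_hauptmodul_star by blast
  define g where "g = (\<lambda>z. inverse (B 0) * (b z * hauptmodul_star z ^ m))"
  have g: "fricke_equivariant r s g"
    unfolding g_def
  proof (rule fricke_equivariant_cmult, unfold fricke_equivariant_def, intro conjI ballI)
    fix z assume z: "z \<in> upper_half"
    show "b (z + 1) * hauptmodul_star (z + 1) ^ m = zeta3 powi r * (b z * hauptmodul_star z ^ m)"
      using b(1) z unfolding hauptmodul_star_invariant[OF z] by (simp add: fricke_equivariant_def)
    have "b (- 1 / (3 * z)) = s * (3 * z\<^sup>2) * b z" using b(1) z unfolding fricke_equivariant_def by blast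
    thus "b (- 1 / (3 * z)) * hauptmodul_star (- 1 / (3 * z)) ^ m = s * (3 * z\<^sup>2) * (b z * hauptmodul_star z ^ m)"
      unfolding hauptmodul_star_invariant[OF z] by (simp only: mult.assoc)
  qed
  define p where "p = k - 3 * int m"
  have qf: "q_factor p (\<lambda>z. b z * hauptmodul_star z ^ m) (\<lambda>x. B x * J x ^ m)"
    using q_factor_mult[OF b(2) q_factor_power[OF J(1), of m]] by (simp add: p_def algebra_simps)
  obtain c' where c': "has_qexp3 (\<lambda>z. b z * hauptmodul_star z ^ m) c'" "\<forall>n<p. c' n = 0" "c' p = B 0"
    using has_qexp3I[of "\<lambda>x. B x * J x ^ m" "\<lambda>z. b z * hauptmodul_star z ^ m" p] qf J(2)
    by (auto simp: q_factor_def)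
  define c where "c = (\<lambda>n. inverse (B 0) * c' n)"
  have c: "has_qexp3 g c" "\<And>n. n < p \<Longrightarrow> c n = 0" "c p = 1"
    using has_qexp3_cmult[OF c'(1)] c' b(3) by (simp_all add: g_def c_def)
  \<comment> \<open>Hence the only exponents between the leading one and \<open>k\<close> are
    \<open>k - 3 i\<close> with \<open>i \<le> m\<close>, precisely those the elimination
    reaches.\<close>
  have supp: "n mod 3 = r mod 3" if "c n \<noteq> 0" for n
    using translation_iff_support[OF c(1), of r] g that by (simp add: fricke_equivariant_def)
  have pr: "p mod 3 = r mod 3" using supp c(3) by simp
  have "\<forall>i\<in>{..<m}. \<exists>fa. fricke_equivariant r s (fst fa) \<and> has_qexp3 (fst fa) (snd fa) \<and> snd fa (k - 3 * int i) = 1 \<and>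
           (\<forall>n\<le>k. n \<noteq> k - 3 * int i \<longrightarrow> snd fa n = 0)"
    using less by simp
  then obtain fa where fa: "\<And>i. i < m \<Longrightarrow> fricke_equivariant r s (fst (fa i)) \<and> has_qexp3 (fst (fa i)) (snd (fa i)) \<and>
           snd (fa i) (k - 3 * int i) = 1 \<and> (\<forall>n\<le>k. n \<noteq> k - 3 * int i \<longrightarrow> snd (fa i) n = 0)"
    unfolding bchoice_iff by auto
  define F A where "F = (\<lambda>i. fst (fa i))" and "A = (\<lambda>i. snd (fa i))"
  have FA: "fricke_equivariant r s (F i)" "has_qexp3 (F i) (A i)" "A i (k - 3 * int i) = 1"
    "\<And>n. n \<le> k \<Longrightarrow> n \<noteq> k - 3 * int i \<Longrightarrow> A i n = 0" if "i < m" for i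
    using fa[OF that] by (auto simp: F_def A_def)
  define f where "f = (\<lambda>z. g z - (\<Sum>i<m. c (k - 3 * int i) * F i z))"
  define a where "a = (\<lambda>n. c n - (\<Sum>i<m. c (k - 3 * int i) * A i n))"
  have "fricke_equivariant r s f"
    unfolding f_def by (intro fricke_equivariant_diff g fricke_equivariant_sum fricke_equivariant_cmult FA) auto
  moreover have "has_qexp3 f a"
    unfolding f_def a_def by (intro has_qexp3_diff c has_qexp3_sum has_qexp3_cmult FA) auto
  moreover have "a (k - 3 * int m) = 1"
  proof -
    have "(\<Sum>i<m. c (k - 3 * int i) * A i p) = 0"
      by (intro sum.neutral ballI) (use FA(4)[of _ p] in \<open>auto simp: p_def\<close>)
    thus ?thesis using c(3) by (simp add: a_def p_def)
  qed
  moreover have "a n = 0" if n: "n \<le> k" "n \<noteq> k - 3 * int m" for n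
  proof (cases "\<exists>i<m. n = k - 3 * int i")
    case True
    then obtain i where i: "i < m" "n = k - 3 * int i" by blast
    have "(\<Sum>j<m. c (k - 3 * int j) * A j n) = (\<Sum>j<m. if j = i then c n else 0)"
      using FA(3)[OF i(1)] FA(4)[of _ n] n i by (intro sum.cong) auto
    also have "\<dots> = c n" using i(1) by simp
    finally show ?thesis by (simp add: a_def)
  next
    case False
    hence "(\<Sum>j<m. c (k - 3 * int j) * A j n) = 0"
      using FA(4)[of _ n] n by (intro sum.neutral ballI) auto
    moreover have "c n = 0"
    proof (rule ccontr)
      assume "c n \<noteq> 0"
      hence "n mod 3 = p mod 3" "\<not> n < p" using supp pr c(2) by auto
      hence "3 dvd n - p" "n \<ge> p" by (auto simp: mod_eq_dvd_iff)
      then obtain l where l: "n - p = 3 * l" by (auto elim: dvdE)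
      have "l \<ge> 0" "l \<le> int m" "l \<noteq> 0" using l n \<open>n \<ge> p\<close> by (auto simp: p_def)
      hence "n = k - 3 * int (nat (int m - l))" "nat (int m - l) < m" using l by (auto simp: p_def)
      thus False using False by blast
    qed
    ultimately show ?thesis by (simp add: a_def)
  qed
  ultimately show ?case by blast
qed

subsection \<open>From the generators to the full group\<close>

definition mmul :: "imat \<Rightarrow> imat \<Rightarrow> imat" where
  "mmul g h = (case g of (a, b, c, d) \<Rightarrow> case h of (a', b', c', d') \<Rightarrow>
     (a * a' + b * c', a * b' + b * d', c * a' + d * c', c * b' + d * d'))"

lemma moebius_upper_half:
  assumes "a * d - b * c > (0::int)" "z \<in> upper_half"
  shows "of_int c * z + of_int d \<noteq> 0"
    "(of_int a * z + of_int b) / (of_int c * z + of_int d) \<in> upper_half"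
proof -
  have z: "Im z > 0" using assms(2) by (simp add: upper_half_def)
  show nz: "of_int c * z + of_int d \<noteq> 0"
  proof
    assume eq: "of_int c * z + of_int d = 0"
    hence "Im (of_int c * z + of_int d) = 0" "Re (of_int c * z + of_int d) = 0" by simp_all
    hence "c = 0" "d = 0" using z by auto
    thus False using assms(1) by simp
  qed
  have "Im ((of_int a * z + of_int b) / (of_int c * z + of_int d)) =
      of_int (a * d - b * c) * Im z / (norm (of_int c * z + of_int d))\<^sup>2"
    by (simp add: Im_divide cmod_power2 algebra_simps)
  also have "\<dots> > 0"
    by (intro divide_pos_pos mult_pos_pos z zero_less_power) (use assms(1) nz in \<open>simp_all del: of_int_diff of_int_mult\<close>)
  finally show "(of_int a * z + of_int b) / (of_int c * z + of_int d) \<in> upper_half"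
    by (simp only: upper_half_iff)
qed

lemma slash_2:
  assumes "a * d - b * c > (0::int)"
  shows "slash 2 (a, b, c, d) f z = of_int (a * d - b * c) / (of_int c * z + of_int d)\<^sup>2 *
           f ((of_int a * z + of_int b) / (of_int c * z + of_int d))"
proof -
  have "real_of_int (a * d - b * c) powr (real_of_int 2 / 2) = real_of_int (a * d - b * c)"
    using assms by (simp del: of_int_diff of_int_mult)
  moreover have "x powi (- 2) = inverse (x\<^sup>2)" for x :: complex
    by (simp add: power_int_minus)
  ultimately show ?thesis unfolding slash_def by (simp add: divide_inverse)
qed

text \<open>The automorphy factors obey the cocycle rule: with \<open>u\<close> the image of
  \<open>z\<close> under \<open>h\<close>, the denominator for the product is \<open>v * w\<close>.
  Slashing is thus a right action.\<close>

lemma slash_2_mmul: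
  assumes g: "mdet g > 0" and h: "mdet h > 0" and z: "z \<in> upper_half"
  shows "slash 2 (mmul g h) f z = slash 2 h (slash 2 g f) z"
proof -
  obtain a b c d where g': "g = (a, b, c, d)" by (cases g)
  obtain a' b' c' d' where h': "h = (a', b', c', d')" by (cases h)
  have dg: "a * d - b * c > 0" and dh: "a' * d' - b' * c' > 0" using g h by (simp_all add: mdet_def g' h')
  have det: "(a * a' + b * c') * (c * b' + d * d') - (a * b' + b * d') * (c * a' + d * c') =
      (a * d - b * c) * (a' * d' - b' * c')" by (simp add: algebra_simps)
  hence dm: "(a * a' + b * c') * (c * b' + d * d') - (a * b' + b * d') * (c * a' + d * c') > 0"
    using dg dh by simp
  define w where "w = of_int c' * z + of_int d'"
  define u where "u = (of_int a' * z + of_int b') / w"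
  have w0: "w \<noteq> 0" and uH: "u \<in> upper_half"
    using moebius_upper_half[OF dh z] by (simp_all add: w_def u_def)
  define v where "v = of_int c * u + of_int d"
  have v0: "v \<noteq> 0" unfolding v_def by (rule moebius_upper_half(1)[OF dg uH])
  have e1: "of_int (c * a' + d * c') * z + of_int (c * b' + d * d') = v * w"
    using w0 by (simp add: v_def u_def w_def[symmetric] field_simps) (simp add: w_def algebra_simps)
  have e2: "of_int (a * a' + b * c') * z + of_int (a * b' + b * d') = (of_int a * u + of_int b) * w"
    using w0 by (simp add: u_def w_def[symmetric] field_simps) (simp add: w_def algebra_simps)
  have "slash 2 (mmul g h) f z = of_int ((a * d - b * c) * (a' * d' - b' * c')) / (v * w)\<^sup>2 *
      f ((of_int a * u + of_int b) * w / (v * w))"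
    unfolding g' h' mmul_def prod.case slash_2[OF dm] e1 e2 det ..
  also have "\<dots> = of_int (a' * d' - b' * c') / w\<^sup>2 * (of_int (a * d - b * c) / v\<^sup>2 * f ((of_int a * u + of_int b) / v))"
    using w0 by (simp add: power_mult_distrib mult_ac)
  also have "\<dots> = slash 2 h (slash 2 g f) z"
    unfolding g' h' slash_2[OF dh] slash_2[OF dg] w_def[symmetric] u_def[symmetric] v_def[symmetric] ..
  finally show ?thesis .
qed

lemma slash_2_cong:
  assumes "mdet h > 0" "z \<in> upper_half" "\<And>w. w \<in> upper_half \<Longrightarrow> F w = c * f w"
  shows "slash 2 h F z = c * slash 2 h f z"
proof -
  obtain a' b' c' d' where h': "h = (a', b', c', d')" by (cases h)
  have dh: "a' * d' - b' * c' > 0" using assms(1) by (simp add: mdet_def h')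
  show ?thesis unfolding h' slash_2[OF dh] assms(3)[OF moebius_upper_half(2)[OF dh assms(2)]] by simp
qed

text \<open>On \<open>\<Gamma>\<^sub>0(3)\<close> one has \<open>a \<equiv> d\<close> modulo 3, so this is the exponent of \<open>\<nu>\<close> modulo 3, in a shape
  that makes multiplicativity evident.\<close>
definition nu_exp :: "imat \<Rightarrow> int" where
  "nu_exp g = (case g of (a, b, c, d) \<Rightarrow> d * (b - c div 3))"

lemma Gamma0_3_diag_cong:
  assumes "(a, b, 3 * c, d) \<in> Gamma0_3"
  shows "a mod 3 = d mod 3"
proof -
  have "a * d = 1 + 3 * (b * c)" using assms by (simp add: Gamma0_3_def algebra_simps)
  hence "(a * d) mod 3 = 1" by simp
  hence "((a mod 3) * (d mod 3)) mod 3 = 1" by (simp add: mod_mult_eq)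
  moreover have "a mod 3 \<in> {0, 1, 2}" "d mod 3 \<in> {0, 1, 2}" by auto
  ultimately show ?thesis by auto
qed

lemma Gamma0_3_cases:
  assumes "g \<in> Gamma0_3"
  obtains a b c d where "g = (a, b, 3 * c, d)" "a * d - b * (3 * c) = 1"
  using assms by (cases g) (auto simp: Gamma0_3_def elim!: dvdE)

lemma nu0_eq_nu_exp:
  assumes "g \<in> Gamma0_3"
  shows "nu0 g = zeta3 powi nu_exp g"
proof -
  obtain a b c d where g: "g = (a, b, 3 * c, d)" using Gamma0_3_cases[OF assms] by metis
  have "3 dvd a - d" using Gamma0_3_diag_cong assms unfolding g mod_eq_dvd_iff by blast
  then obtain k where "a - d = 3 * k" by (elim dvdE)
  hence a: "a = d + 3 * k" by simp
  have "c * (a + d) + b * d - d * (b - c) = 3 * (c * (d + k))" unfolding a by (simp add: algebra_simps)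
  hence "3 dvd c * (a + d) + b * d - d * (b - c)" by simp
  thus ?thesis by (simp add: nu0_def nu_exp_def g zeta3_powi_eq_iff mod_eq_dvd_iff)
qed

text \<open>Modulo 3 one has \<open>a = d\<close>, \<open>a' = d'\<close> and
  \<open>d^2 = d'^2 = 1\<close>. Expanding leaves \<open>d^2\<close> times the exponent of
  \<open>h\<close> plus \<open>d'^2\<close> times that of \<open>g\<close>, apart from multiples of
  3.\<close>

lemma nu_exp_mmul:
  assumes "g \<in> Gamma0_3" "h \<in> Gamma0_3"
  shows "nu_exp (mmul g h) mod 3 = (nu_exp g + nu_exp h) mod 3" "mmul g h \<in> Gamma0_3"
proof -
  obtain a b c d where g: "g = (a, b, 3 * c, d)" "a * d - b * (3 * c) = 1" using Gamma0_3_cases[OF assms(1)] by metis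
  obtain a' b' c' d' where h: "h = (a', b', 3 * c', d')" "a' * d' - b' * (3 * c') = 1" using Gamma0_3_cases[OF assms(2)] by metis
  have "3 dvd a - d" "3 dvd a' - d'" using Gamma0_3_diag_cong assms unfolding g h mod_eq_dvd_iff by blast+
  then obtain k k' where "a - d = 3 * k" "a' - d' = 3 * k'" by (elim dvdE)
  hence a: "a = d + 3 * k" "a' = d' + 3 * k'" by simp_all
  have e: "3 * c * a' + d * (3 * c') = 3 * (c * a' + d * c')" by (simp add: algebra_simps)
  have d1: "d * d = 1 + 3 * (b * c - d * k)" and d2: "d' * d' = 1 + 3 * (b' * c' - d' * k')"
    using g(2) h(2) unfolding a by (simp_all add: algebra_simps)
  define X where "X = a * b' + b * d' - (c * a' + d * c')"
  have "nu_exp (mmul g h) = (3 * c * b' + d * d') * X"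
    unfolding nu_exp_def g h mmul_def prod.case e X_def by simp
  also have "\<dots> = 3 * (c * b' * X + d * d' * (k * b' - c * k')) + (d * d) * (d' * (b' - c')) + (d' * d') * (d * (b - c))"
    unfolding X_def a by (simp add: algebra_simps)
  also have "\<dots> = (nu_exp g + nu_exp h) + 3 * (c * b' * X + d * d' * (k * b' - c * k') +
      (b * c - d * k) * (d' * (b' - c')) + (b' * c' - d' * k') * (d * (b - c)))"
    unfolding d1 d2 nu_exp_def g h by (simp add: algebra_simps)
  finally show "nu_exp (mmul g h) mod 3 = (nu_exp g + nu_exp h) mod 3" by (simp only: mod_mult_self2)
  have "(a * a' + b * (3 * c')) * (3 * c * b' + d * d') - (a * b' + b * d') * (3 * c * a' + d * (3 * c')) =
      (a * d - b * (3 * c)) * (a' * d' - b' * (3 * c'))" by (simp add: algebra_simps)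
  thus "mmul g h \<in> Gamma0_3" using g(2) h(2) unfolding g h mmul_def Gamma0_3_def prod.case e by simp
qed

lemma Gamma0_3_mdet: "g \<in> Gamma0_3 \<Longrightarrow> mdet g = 1"
  by (auto simp: Gamma0_3_def mdet_def)

text \<open>Membership in the group is part of the predicate, so that it is closed under products
  and can be carried through a descent.\<close>

definition nu_equivariant :: "int \<Rightarrow> (complex \<Rightarrow> complex) \<Rightarrow> imat \<Rightarrow> bool" where
  "nu_equivariant r f g \<longleftrightarrow> g \<in> Gamma0_3 \<and> (\<forall>z\<in>upper_half. slash 2 g f z = zeta3 powi (r * nu_exp g) * f z)"

lemma nu_equivariant_mmul:
  assumes "nu_equivariant r f g" "nu_equivariant r f h"
  shows "nu_equivariant r f (mmul g h)"
proof -
  have gh: "g \<in> Gamma0_3" "h \<in> Gamma0_3" using assms by (simp_all add: nu_equivariant_def)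
  have "slash 2 (mmul g h) f z = zeta3 powi (r * nu_exp (mmul g h)) * f z" if z: "z \<in> upper_half" for z
  proof -
    have "slash 2 (mmul g h) f z = slash 2 h (slash 2 g f) z"
      by (rule slash_2_mmul) (use gh z Gamma0_3_mdet in auto)
    also have "\<dots> = zeta3 powi (r * nu_exp g) * slash 2 h f z"
      by (rule slash_2_cong) (use gh z Gamma0_3_mdet assms(1) in \<open>auto simp: nu_equivariant_def\<close>)
    also have "\<dots> = zeta3 powi (r * nu_exp g + r * nu_exp h) * f z"
      using assms(2) z by (simp add: nu_equivariant_def power_int_add)
    also have "zeta3 powi (r * nu_exp g + r * nu_exp h) = zeta3 powi (r * nu_exp (mmul g h))"
      unfolding zeta3_powi_eq_iff using nu_exp_mmul(1)[OF gh] by (metis distrib_left mod_mult_right_eq)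
    finally show ?thesis .
  qed
  thus ?thesis using nu_exp_mmul(2)[OF gh] by (simp add: nu_equivariant_def)
qed

lemma exists_small_residue:
  fixes a c :: int
  assumes "c \<noteq> 0"
  obtains n where "2 * \<bar>a + n * c\<bar> \<le> \<bar>c\<bar>"
proof -
  define m where "m = \<bar>c\<bar>"
  have m: "m > 0" using assms by (simp add: m_def)
  obtain e where e: "m = e * c" using assms unfolding m_def by (metis abs_mult_sgn mult.commute abs_sgn mult_minus_left abs_eq_iff' mult_1 mult_minus1)
  define q where "q = a mod m"
  have q: "0 \<le> q" "q < m" using m by (simp_all add: q_def)
  have q': "q = a + (- (a div m)) * m" by (simp add: q_def minus_div_mult_eq_mod)
  show ?thesis
  proof (cases "2 * q \<le> m")
    case True
    show ?thesis
    proof (rule that)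
      have "a + (- (a div m) * e) * c = q" unfolding q' using e by (simp add: mult.assoc)
      thus "2 * \<bar>a + (- (a div m) * e) * c\<bar> \<le> \<bar>c\<bar>" using True q by (simp add: m_def[symmetric])
    qed
  next
    case False
    show ?thesis
    proof (rule that)
      have "a + ((- (a div m) - 1) * e) * c = q - m" unfolding q' using e by (simp add: mult.assoc left_diff_distrib)
      thus "2 * \<bar>a + ((- (a div m) - 1) * e) * c\<bar> \<le> \<bar>c\<bar>" using False q by (simp add: m_def[symmetric])
    qed
  qed
qed

text \<open>Euclidean descent on the lower left entry, with the generators \<open>z \<mapsto> z + 1\<close> and
  \<open>z \<mapsto> z / (3z + 1)\<close>, the latter being conjugate to the inverse of the former under \<open>W\<^sub>3\<close>.\<close>
lemma nu_equivariant_Gamma0_3: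
  assumes T: "\<And>n. nu_equivariant r f (1, n, 0, 1)" and V: "\<And>n. nu_equivariant r f (1, 0, 3 * n, 1)"
    and g: "g \<in> Gamma0_3"
  shows "nu_equivariant r f g"
  using g
proof (induction "nat \<bar>fst (snd (snd g))\<bar>" arbitrary: g rule: less_induct)
  case less
  obtain a b c d where g: "g = (a, b, 3 * c, d)" "a * d - b * (3 * c) = 1" using Gamma0_3_cases[OF less.prems] by metis
  show ?case
  proof (cases "c = 0")
    case True
    hence ad: "a * d = 1" using g by simp
    hence "(a = 1 \<and> d = 1) \<or> (a = -1 \<and> d = -1)" by (metis zmult_eq_1_iff)
    thus ?thesis
    proof
      assume "a = 1 \<and> d = 1"
      thus ?thesis using T[of b] g True by simp
    next
      \<comment> \<open>In even weight \<open>-I\<close> acts trivially, so this case reduces to a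
        translation.\<close>
      assume *: "a = -1 \<and> d = -1"
      have "slash 2 (-1, b, 0, -1) f z = slash 2 (1, -b, 0, 1) f z" for z
        by (subst (1 2) slash_2) simp_all
      moreover have "nu_exp (-1, b, 0, -1) = nu_exp (1, -b, 0, 1)" by (simp add: nu_exp_def)
      ultimately show ?thesis using T[of "-b"] g True * by (simp add: nu_equivariant_def Gamma0_3_def)
    qed
  next
    case False
    obtain n where n: "2 * \<bar>a + n * (3 * c)\<bar> \<le> \<bar>3 * c\<bar>" using exists_small_residue[of "3 * c" a] False by auto
    define a' b' where "a' = a + n * (3 * c)" and "b' = b + n * d"
    have det': "a' * d - b' * (3 * c) = 1" using g(2) by (simp add: a'_def b'_def algebra_simps)
    \<comment> \<open>Otherwise the determinant 1 would be divisible by 3; so \<open>c\<close> may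
      be reduced modulo \<open>a'\<close>.\<close>
    have "a' \<noteq> 0"
    proof
      assume "a' = 0"
      hence "3 * (- b' * c) = 1" using det' by simp
      thus False by presburger
    qed
    then obtain k where k: "2 * \<bar>c + k * a'\<bar> \<le> \<bar>a'\<bar>" using exists_small_residue[of a' c] by auto
    define c'' d'' where "c'' = c + k * a'" and "d'' = d + 3 * k * b'"
    define h where "h = (a', b', 3 * c'', d'')"
    have hG: "h \<in> Gamma0_3" using det' by (simp add: h_def Gamma0_3_def c''_def d''_def algebra_simps)
    \<comment> \<open>Each reduction halves: \<open>\<bar>c''\<bar> \<le> \<bar>a'\<bar> / 2 \<le> 3
      \<bar>c\<bar> / 4\<close>.\<close>
    have "nat \<bar>fst (snd (snd h))\<bar> < nat \<bar>fst (snd (snd g))\<bar>"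
      using n k False by (simp add: h_def g a'_def[symmetric] c''_def[symmetric])
    from less.hyps[OF this hG] have "nu_equivariant r f h" .
    from nu_equivariant_mmul[OF T[of "-n"] nu_equivariant_mmul[OF V[of "-k"] this]]
    show ?thesis by (simp add: mmul_def h_def g(1) c''_def d''_def a'_def b'_def algebra_simps)
  qed
qed

lemma fricke_equivariant_translate:
  assumes "fricke_equivariant r s f" "z \<in> upper_half"
  shows "f (z + of_int n) = zeta3 powi (r * n) * f z"
proof (induction n rule: int_induct[where k = 0])
  case (step1 i)
  have "z + of_int i \<in> upper_half" using assms(2) by (simp add: upper_half_def)
  hence "f (z + of_int i + 1) = zeta3 powi r * f (z + of_int i)" using assms(1) by (simp add: fricke_equivariant_def)
  with step1 show ?case by (simp add: add.assoc distrib_left power_int_add)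
next
  case (step2 i)
  have "z + of_int (i - 1) \<in> upper_half" using assms(2) by (simp add: upper_half_def)
  hence "f (z + of_int (i - 1) + 1) = zeta3 powi r * f (z + of_int (i - 1))"
    using assms(1) unfolding fricke_equivariant_def by blast
  hence "f (z + of_int i) = zeta3 powi r * f (z + of_int (i - 1))" by (simp add: add.assoc)
  with step2 show ?case by (simp add: right_diff_distrib power_int_diff field_simps)
qed simp

lemma fricke_equivariant_imp_nu_equivariant:
  assumes f: "fricke_equivariant r s f" and s: "s * s = 1" and g: "g \<in> Gamma0_3"
  shows "nu_equivariant r f g"
proof (rule nu_equivariant_Gamma0_3[OF _ _ g])
  show "nu_equivariant r f (1, n, 0, 1)" for n
    using fricke_equivariant_translate[OF f]
    by (simp add: nu_equivariant_def Gamma0_3_def nu_exp_def slash_2)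
  show "nu_equivariant r f (1, 0, 3 * n, 1)" for n
  proof -
    have "slash 2 (1, 0, 3 * n, 1) f z = zeta3 powi (r * (- n)) * f z" if z: "z \<in> upper_half" for z
    proof -
      have z0: "z \<noteq> 0" by (rule upper_half_nonzero[OF z])
      have nz: "of_int (3 * n) * z + 1 \<noteq> 0" using moebius_upper_half(1)[of 1 1 0 "3 * n", OF _ z] by simp
      \<comment> \<open>The map \<open>z \<mapsto> z / (3 n z + 1)\<close> is inversion, translation
        by \<open>-n\<close>, inversion. The sign \<open>s\<close> enters twice and cancels.\<close>
      define w where "w = - 1 / (3 * z)"
      have w: "w \<in> upper_half" unfolding w_def by (rule fricke_in_upper_half[OF z])
      define v where "v = w + of_int (- n)"
      have v: "v \<in> upper_half" using w by (simp add: v_def upper_half_def)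
      have vz: "v = - (of_int (3 * n) * z + 1) / (3 * z)" using z0 by (simp add: v_def w_def field_simps)
      have "- 1 / (3 * (- D / (3 * z))) = z / D" if "D \<noteq> 0" for D
        using z0 that by simp
      hence "- 1 / (3 * v) = z / (of_int (3 * n) * z + 1)"
        unfolding vz using nz by blast
      hence "f (z / (of_int (3 * n) * z + 1)) = f (- 1 / (3 * v))" by simp
      also have "\<dots> = s * (3 * v\<^sup>2) * f v" using f v unfolding fricke_equivariant_def by blast
      also have "f v = zeta3 powi (r * (- n)) * f w" unfolding v_def by (rule fricke_equivariant_translate[OF f w])
      also have "f w = s * (3 * z\<^sup>2) * f z" unfolding w_def using f z unfolding fricke_equivariant_def by blast
      also have "s * (3 * v\<^sup>2) * (zeta3 powi (r * - n) * (s * (3 * z\<^sup>2) * f z)) = (s * s) * (3 * z * v)\<^sup>2 * (zeta3 powi (r * - n) * f z)"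
        by (simp add: power2_eq_square)
      also have "3 * z * v = - (of_int (3 * n) * z + 1)" unfolding vz using z0 by simp
      finally have "f (z / (of_int (3 * n) * z + 1)) = (of_int (3 * n) * z + 1)\<^sup>2 * (zeta3 powi (r * - n) * f z)"
        by (simp only: s power2_minus mult_1_left)
      thus ?thesis using nz by (simp add: slash_2)
    qed
    thus ?thesis by (simp add: nu_equivariant_def Gamma0_3_def nu_exp_def)
  qed
qed

section \<open>Expansions at all cusps\<close>

text \<open>\<open>\<Gamma>_0(3)\<close> has two classes of cusps, exchanged by \<open>W3\<close>,
  so one expansion serves for both. The cusp 0 has width 3, which replaces \<open>q^(1/3)\<close> by
  \<open>q^(1/9)\<close>.\<close>

lemma fricke_equivariant_meromorphic_at_cusps:
  assumes f: "fricke_equivariant r s f" and s: "s * s = 1" and a: "has_qexp3 f a"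
  shows "mero_at_cusps 2 f"
  unfolding mero_at_cusps_def
proof
  fix g assume "g \<in> SL2Z"
  then obtain A B C D where g: "g = (A, B, C, D)" "A * D - B * C = 1" by (cases g) (auto simp: SL2Z_def mdet_def)
  have fin: "finite {n. n < 0 \<and> c n * a n \<noteq> 0}" for c
    by (rule finite_subset[of _ "{n. n < 0 \<and> a n \<noteq> 0}"]) (use a in \<open>auto simp: has_qexp3_def\<close>)
  have sum: "((\<lambda>n. a n * qpow 3 n z) has_sum f z) UNIV" if "z \<in> upper_half" for z
    using a that by (simp add: has_qexp3_def)
  show "\<exists>N>0. \<exists>b. finite {n. n < 0 \<and> b n \<noteq> 0} \<and> (\<forall>z\<in>upper_half. ((\<lambda>n. b n * qpow N n z) has_sum slash 2 g f z) UNIV)"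
  proof (cases "3 dvd C")
    case True
    hence "nu_equivariant r f g"
      using g by (intro fricke_equivariant_imp_nu_equivariant[OF f s]) (simp add: Gamma0_3_def)
    hence "((\<lambda>n. zeta3 powi (r * nu_exp g) * a n * qpow 3 n z) has_sum slash 2 g f z) UNIV" if "z \<in> upper_half" for z
      using has_sum_cmult_right[OF sum[OF that], of "zeta3 powi (r * nu_exp g)"] that
      by (simp add: nu_equivariant_def mult.assoc)
    thus ?thesis using fin[of "\<lambda>_. zeta3 powi (r * nu_exp g)"]
      by (intro exI[of _ 3] conjI exI[of _ "\<lambda>n. zeta3 powi (r * nu_exp g) * a n"]) auto
  next
    case False
    \<comment> \<open>Chosen so that \<open>j C = D\<close> modulo 3, since \<open>C^2 = 1\<close>
      modulo 3; this places \<open>h\<close> in \<open>\<Gamma>_0(3)\<close>.\<close>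
    define j where "j = C * D"
    define h where "h = (j * A - B, A, j * C - D, C)"
    have "3 dvd C * C - 1"
    proof -
      have "3 dvd C - 1 \<or> 3 dvd C + 1" using False by presburger
      moreover have "C * C - 1 = (C - 1) * (C + 1)" by (simp add: algebra_simps)
      ultimately show ?thesis by auto
    qed
    hence "3 dvd D * (C * C - 1)" by (rule dvd_mult)
    moreover have "D * (C * C - 1) = j * C - D" by (simp add: j_def algebra_simps)
    ultimately have "3 dvd j * C - D" by (simp only:)
    moreover have "(j * A - B) * C - A * (j * C - D) = 1" using g(2) by (simp add: algebra_simps)
    ultimately have hG: "h \<in> Gamma0_3" by (simp add: h_def Gamma0_3_def)
    have gh: "g = mmul h (0, -1, 1, j)" by (simp add: g h_def mmul_def algebra_simps)
    define chi where "chi = zeta3 powi (r * nu_exp h)"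
    have sl: "slash 2 g f z = chi * s / 3 * f ((z + of_int j) / 3)" if z: "z \<in> upper_half" for z
    proof -
      define w where "w = (z + of_int j) / 3"
      have w: "w \<in> upper_half" using z by (simp add: w_def upper_half_def)
      have w0: "w \<noteq> 0" by (rule upper_half_nonzero[OF w])
      have w3: "z + of_int j = 3 * w" by (simp add: w_def)
      have "slash 2 g f z = slash 2 (0, -1, 1, j) (slash 2 h f) z"
        unfolding gh by (rule slash_2_mmul) (use hG z Gamma0_3_mdet in \<open>auto simp: mdet_def\<close>)
      also have "\<dots> = chi * slash 2 (0, -1, 1, j) f z"
        by (rule slash_2_cong)
           (use z fricke_equivariant_imp_nu_equivariant[OF f s hG] in \<open>auto simp: mdet_def nu_equivariant_def chi_def\<close>)
      also have "slash 2 (0, -1, 1, j) f z = 1 / (3 * w)\<^sup>2 * f (- 1 / (3 * w))"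
        by (simp add: slash_2 w3)
      also have "f (- 1 / (3 * w)) = s * (3 * w\<^sup>2) * f w" using f w unfolding fricke_equivariant_def by blast
      finally show ?thesis unfolding w_def[symmetric] using w0 by (simp add: field_simps power2_eq_square)
    qed
    have "((\<lambda>n. chi * s / 3 * qpow 9 n (of_int j) * a n * qpow 9 n z) has_sum slash 2 g f z) UNIV" if z: "z \<in> upper_half" for z
    proof -
      have "(z + of_int j) / 3 \<in> upper_half" using z by (simp add: upper_half_def)
      from has_sum_cmult_right[OF sum[OF this], of "chi * s / 3"]
      have "((\<lambda>n. chi * s / 3 * (a n * qpow 3 n ((z + of_int j) / 3))) has_sum slash 2 g f z) UNIV"
        by (simp add: sl[OF z])
      moreover have "qpow 3 n ((z + of_int j) / 3) = qpow 9 n (of_int j) * qpow 9 n z" for n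
        unfolding qpow_def exp_add[symmetric] by (rule arg_cong[of _ _ exp]) (simp add: field_simps)
      ultimately show ?thesis by (simp add: mult_ac)
    qed
    thus ?thesis using fin[of "\<lambda>n. chi * s / 3 * qpow 9 n (of_int j)"]
      by (intro exI[of _ 9] conjI exI[of _ "\<lambda>n. chi * s / 3 * qpow 9 n (of_int j) * a n"]) auto
  qed
qed

lemma slash_W3: "slash 2 W3 f z = 1 / (3 * z\<^sup>2) * f (- 1 / (3 * z))"
  by (simp add: W3_def slash_2 power_mult_distrib)

lemma cnj_zeta3_powi: "cnj (zeta3 powi n) = zeta3 powi (- n)"
proof -
  have "zeta3 * cnj zeta3 = 1" by (simp add: complex_norm_square[symmetric])
  hence "cnj zeta3 = inverse zeta3" by (simp add: inverse_unique)
  thus ?thesis by (simp add: complex_cnj_power_int power_int_inverse power_int_minus)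
qed

text \<open>Reduces the conditions on the whole group and on all cusps to the two generators; the
  expansion supplies holomorphy. At \<open>z + 1\<close> the exponent \<open>nu_exp\<close> is 1, so
  the character takes the value \<open>zeta3 powi r\<close>.\<close>

lemma wmf_star3_iff:
  assumes "s * s = 1" "has_qexp3 f a" "\<And>g. g \<in> Gamma0_3 \<Longrightarrow> chi g = zeta3 powi (r * nu_exp g)"
  shows "wmf_star3 2 chi s f \<longleftrightarrow> fricke_equivariant r s f"
proof
  assume f: "fricke_equivariant r s f"
  show "wmf_star3 2 chi s f"
    unfolding wmf_star3_def
  proof (intro conjI ballI)
    show "f holomorphic_on upper_half" by (rule has_qexp3_holomorphic[OF assms(2)])
    show "mero_at_cusps 2 f" by (rule fricke_equivariant_meromorphic_at_cusps[OF f assms(1,2)])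
    show "slash 2 g f z = chi g * f z" if "g \<in> Gamma0_3" "z \<in> upper_half" for g z
      using fricke_equivariant_imp_nu_equivariant[OF f assms(1) that(1)] that assms(3)
      by (simp add: nu_equivariant_def)
    fix z assume z: "z \<in> upper_half"
    have "f (- 1 / (3 * z)) = s * (3 * z\<^sup>2) * f z" using f z unfolding fricke_equivariant_def by blast
    thus "slash 2 W3 f z = s * f z" unfolding slash_W3 using upper_half_nonzero[OF z] by simp
  qed
next
  assume f: "wmf_star3 2 chi s f"
  show "fricke_equivariant r s f"
    unfolding fricke_equivariant_def
  proof (intro conjI ballI)
    fix z assume z: "z \<in> upper_half"
    have T: "(1, 1, 0, 1) \<in> Gamma0_3" by (simp add: Gamma0_3_def)
    have "slash 2 (1, 1, 0, 1) f z = chi (1, 1, 0, 1) * f z" using f z T by (simp add: wmf_star3_def)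
    thus "f (z + 1) = zeta3 powi r * f z" by (simp add: assms(3)[OF T] slash_2 nu_exp_def)
    have "slash 2 W3 f z = s * f z" using f z by (simp add: wmf_star3_def)
    thus "f (- 1 / (3 * z)) = s * (3 * z\<^sup>2) * f z"
      unfolding slash_W3 using upper_half_nonzero[OF z] by (simp add: field_simps)
  qed
qed

subsection \<open>Hecke operators\<close>

lemma fricke_equivariant_cong:
  "r mod 3 = r' mod 3 \<Longrightarrow> fricke_equivariant r s f \<longleftrightarrow> fricke_equivariant r' s f"
  using zeta3_powi_eq_iff[of r r'] by (simp add: fricke_equivariant_def)

section \<open>Uniqueness of forms with given principal part\<close>

text \<open>The form is \<open>c * h3\<close>. Then \<open>c = 0\<close> because the sign differs
  from that of \<open>h3\<close>, or the residue class of exponents excludes 1, or the coefficient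
  \<open>a 1 = c\<close> is 0.\<close>

lemma fricke_equivariant_vanishes:
  assumes f: "fricke_equivariant r s f" and s: "s = 1 \<or> s = -1"
    and a: "has_qexp3 f a" "\<And>n. n \<le> 0 \<Longrightarrow> a n = 0"
    and r: "r mod 3 \<noteq> 1 \<or> s = 1 \<or> a 1 = 0"
    and z: "z \<in> upper_half"
  shows "f z = 0"
proof -
  have fT: "f (z + 1) = zeta3 powi r * f z" and fW: "f (- 1 / (3 * z)) = s * (3 * z\<^sup>2) * f z"
    if "z \<in> upper_half" for z using f that unfolding fricke_equivariant_def by blast+
  obtain c where c: "\<And>z. z \<in> upper_half \<Longrightarrow> f z = c * h3 z"
  proof (rule cusp_form_eq_multiple_of_h3[OF a])
    fix z assume z: "z \<in> upper_half"
    show "norm (f (z + 1)) = norm (f z)" unfolding fT[OF z] by (simp add: norm_mult norm_power_int)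
    show "norm (f (- 1 / (3 * z))) = norm (3 * z\<^sup>2 * f z)"
      unfolding fW[OF z] using s by (auto simp: norm_mult)
  qed auto
  obtain b where b: "has_qexp3 h3 b" "b 1 = 1" using h3_has_qexp3 by blast
  have "has_qexp3 f (\<lambda>n. c * b n)"
    using has_qexp3_cmult[OF b(1), of c] c by (subst has_qexp3_cong[of f "\<lambda>z. c * h3 z"]) auto
  hence a1: "a 1 = c" using has_qexp3_unique[OF a(1)] b(2) by auto
  have supp: "\<forall>n. a n \<noteq> 0 \<longrightarrow> n mod 3 = r mod 3"
    using translation_iff_support[OF a(1)] fT by blast
  have "c = 0"
  proof (cases "s = 1")
    case True
    have "c * (- 3 * z\<^sup>2 * h3 z) = s * (3 * z\<^sup>2) * (c * h3 z)"
      using fW[OF z] unfolding c[OF z] c[OF fricke_in_upper_half[OF z]] h3_fricke[OF z] .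
    thus ?thesis using True h3_nonzero[OF z] upper_half_nonzero[OF z] by (simp add: field_simps)
  next
    case False
    thus ?thesis using r a1 supp[rule_format, of 1] by auto
  qed
  thus ?thesis using c[OF z] by simp
qed

lemma fricke_equivariant_unique:
  assumes "fricke_equivariant r s f" "fricke_equivariant r s g" "s = 1 \<or> s = -1"
    and "has_qexp3 f a" "has_qexp3 g b" "\<And>n. n \<le> 0 \<Longrightarrow> a n = b n"
    and "r mod 3 \<noteq> 1 \<or> s = 1 \<or> a 1 = b 1" "z \<in> upper_half"
  shows "f z = g z"
  using fricke_equivariant_vanishes[OF fricke_equivariant_diff[OF assms(1,2)] assms(3) has_qexp3_diff[OF assms(4,5)], of z] assms(6-8)
  by simp

section \<open>Existence of the forms \<open>f_d\<close>\<close>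

text \<open>For \<open>d\<close> not divisible by 3 this is the representative of \<open>-d\<close>
  modulo 3, the class of the leading exponent: -1 belongs to the conjugate character, 1 to the
  character itself.\<close>

definition char_index :: "nat \<Rightarrow> int" where
  "char_index d = (if d mod 3 = 1 then -1 else 1)"

lemma chi_d_eq:
  assumes "g \<in> Gamma0_3"
  shows "chi_d d g = zeta3 powi (char_index d * nu_exp g)"
  unfolding chi_d_def char_index_def nu0_eq_nu_exp[OF assms] using cnj_zeta3_powi[of "nu_exp g"] by simp

lemma exists_form:
  assumes d: "d mod 3 = 1 \<or> d mod 3 = (2::nat)" and s: "s = 1 \<or> s = -1"
  shows "\<exists>f a. fricke_equivariant (char_index d) (of_int s) f \<and> has_qexp3 f a \<and> a (- int d) = 1 \<and>
          (\<forall>n. n \<noteq> - int d \<and> \<not> exps_d d s n \<longrightarrow> a n = 0)"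
proof -
  \<comment> \<open>The leading exponent of the base form. In the last case the base form is
    \<open>h3\<close> with \<open>k = 1\<close>, and the elimination up to \<open>k\<close> also
    clears the exponent 1.\<close>
  define k where "k = (if d mod 3 = 1 then -1 else if s = 1 then -2 else 1 :: int)"
  have "\<exists>b B. fricke_equivariant (char_index d) (of_int s) b \<and> q_factor k b B \<and> B 0 \<noteq> 0"
  proof -
    have h: "\<exists>b B. fricke_equivariant 1 (-1) b \<and> q_factor 1 b B \<and> B 0 \<noteq> 0"
      using fricke_equivariant_h3 q_factor_h3 h3_factor_nonzero[of 0] by fastforce
    show ?thesis
      using s base_form_conj_minus base_form_conj_plus base_form_plus h by (auto simp: k_def char_index_def)
  qed
  then obtain b B where b: "fricke_equivariant (char_index d) (of_int s) b" "q_factor k b B" "B 0 \<noteq> 0" by blast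
  have "\<exists>m::nat. - int d = k - 3 * int m" using d unfolding k_def by presburger
  then obtain m where m: "- int d = k - 3 * int m" by blast
  obtain f a where f: "fricke_equivariant (char_index d) (of_int s) f" "has_qexp3 f a" "a (- int d) = 1"
    "\<And>n. n \<le> k \<Longrightarrow> n \<noteq> - int d \<Longrightarrow> a n = 0"
    using forms_with_prescribed_pole[OF b, of m] unfolding m by blast
  have supp: "a n \<noteq> 0 \<Longrightarrow> n mod 3 = char_index d mod 3" for n
    using translation_iff_support[OF f(2), of "char_index d"] f(1) by (simp add: fricke_equivariant_def)
  have "a n = 0" if n: "n \<noteq> - int d" "\<not> exps_d d s n" for n
  proof (rule ccontr)
    assume an: "a n \<noteq> 0"
    hence "n > k" using f(4)[of n] n(1) by (cases "n \<le> k") auto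
    moreover have "n mod 3 = (if d mod 3 = 1 then 2 else 1)"
      using supp[OF an] by (simp add: char_index_def split: if_splits)
    ultimately have "exps_d d s n"
      unfolding exps_d_def k_def using d by (simp split: if_splits; presburger)
    thus False using n by simp
  qed
  with f show ?thesis by blast
qed

lemma f_d_props:
  assumes d: "d mod 3 = 1 \<or> d mod 3 = (2::nat)" and s: "s = 1 \<or> s = -1"
  shows "\<exists>a. fricke_equivariant (char_index d) (of_int s) (f_d d s) \<and> has_qexp3 (f_d d s) a \<and> a (- int d) = 1 \<and>
          (\<forall>n. n \<noteq> - int d \<and> \<not> exps_d d s n \<longrightarrow> a n = 0)"
proof -
  have s2: "of_int s * of_int s = (1::complex)" using s by auto
  obtain f a where f: "fricke_equivariant (char_index d) (of_int s) f" "has_qexp3 f a" "a (- int d) = 1"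
     "\<forall>n. n \<noteq> - int d \<and> \<not> exps_d d s n \<longrightarrow> a n = 0" using exists_form[OF assms] by blast
  have "is_f_d d s f"
    unfolding is_f_d_def using f wmf_star3_iff[OF s2 f(2) chi_d_eq] by blast
  hence "is_f_d d s (f_d d s)" unfolding f_d_def by (rule someI[of "is_f_d d s" f])
  then obtain a where a: "wmf_star3 2 (chi_d d) (of_int s) (f_d d s)" "has_qexp3 (f_d d s) a" "a (- int d) = 1"
     "\<forall>n. n \<noteq> - int d \<and> \<not> exps_d d s n \<longrightarrow> a n = 0" unfolding is_f_d_def by blast
  thus ?thesis using wmf_star3_iff[OF s2 a(2) chi_d_eq] by blast
qed

lemma qcoeff3_eq: "has_qexp3 f a \<Longrightarrow> qcoeff3 f = a"
  unfolding qcoeff3_def by (metis has_qexp3_unique someI)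

section \<open>Hecke operators on expansions\<close>

lemma sum_roots_of_unity:
  fixes p :: nat and n :: int
  assumes "p > 0"
  shows "(\<Sum>l<p. exp (2 * of_real pi * \<i> * of_int n * of_nat l / of_nat p)) = (if int p dvd n then of_nat p else 0 :: complex)"
proof -
  define \<omega> where "\<omega> = exp (2 * of_real pi * \<i> * of_int n / of_nat p)"
  have pw: "exp (2 * of_real pi * \<i> * of_int n * of_nat l / of_nat p) = \<omega> ^ l" for l
    unfolding \<omega>_def exp_of_nat_mult[symmetric] by (simp add: mult_ac)
  have "\<omega> = 1 \<longleftrightarrow> (\<exists>k::int. 2 * pi * of_int n / of_nat p = of_int (2 * k) * pi)"
    unfolding \<omega>_def by (simp add: exp_eq_1)
  also have "\<dots> \<longleftrightarrow> (\<exists>k::int. real_of_int n = real_of_int (int p * k))"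
    using assms by (intro ex_cong1) (auto simp: field_simps)
  also have "\<dots> \<longleftrightarrow> int p dvd n" unfolding of_int_eq_iff by auto
  finally have iff: "\<omega> = 1 \<longleftrightarrow> int p dvd n" .
  show ?thesis
  proof (cases "\<omega> = 1")
    case True
    thus ?thesis unfolding pw using iff by simp
  next
    case False
    have "\<omega> ^ p = exp (2 * of_real pi * \<i> * of_int n)"
      unfolding \<omega>_def exp_of_nat_mult[symmetric] using assms by simp
    also have "\<dots> = 1" by (simp add: exp_eq_1)
    finally have "(\<Sum>l<p. \<omega> ^ l) = 0" using False by (simp add: geometric_sum)
    thus ?thesis unfolding pw using iff False by simp
  qed
qed

lemma has_sum_finite_sum:
  fixes f :: "'i \<Rightarrow> 'a \<Rightarrow> complex"
  assumes "finite I" "\<And>i. i \<in> I \<Longrightarrow> (f i has_sum S i) A"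
  shows "((\<lambda>x. \<Sum>i\<in>I. f i x) has_sum (\<Sum>i\<in>I. S i)) A"
  using assms by (induction I rule: finite_induct) (auto intro: has_sum_add)

lemma hecke_p_eq:
  assumes "p > 0"
  shows "hecke_p 2 3 p f z = (\<Sum>l<p. slash 2 (1, 3 * int l, 0, int p) f z) + slash 2 (int p, 0, 0, 1) f z"
  using assms by (simp add: hecke_p_def)

text \<open>The sum over \<open>l\<close> filters the exponents divisible by \<open>p\<close>, and
  the last matrix substitutes \<open>p z\<close>. In weight 2 the matrices of determinant
  \<open>p\<close> contribute the factors \<open>1/p\<close> and \<open>p\<close>
  respectively.\<close>

lemma has_qexp3_hecke_p:
  assumes f: "has_qexp3 f a" and p: "p > 0"
  shows "has_qexp3 (hecke_p 2 3 p f)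
           (\<lambda>m. a (int p * m) + of_nat p * (if int p dvd m then a (m div int p) else 0))"
    (is "has_qexp3 _ ?A")
proof -
  have p0: "of_nat p \<noteq> (0::complex)" using p by simp
  have sum: "((\<lambda>n. a n * qpow 3 n z) has_sum f z) UNIV" if "z \<in> upper_half" for z
    using f that by (simp add: has_qexp3_def)
  have "((\<lambda>m. ?A m * qpow 3 m z) has_sum hecke_p 2 3 p f z) UNIV" if z: "z \<in> upper_half" for z
  proof -
    have sl: "slash 2 (1, 3 * int l, 0, int p) f z = f ((z + 3 * of_nat l) / of_nat p) / of_nat p" for l
      using p by (simp add: slash_2 power2_eq_square)
    have zl: "(z + 3 * of_nat l) / of_nat p \<in> upper_half" for l
      using moebius_upper_half(2)[of 1 "int p" "3 * int l" 0 z] p z by simp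
    have "((\<lambda>n. \<Sum>l<p. a n * qpow 3 n ((z + 3 * of_nat l) / of_nat p) / of_nat p) has_sum
        (\<Sum>l<p. slash 2 (1, 3 * int l, 0, int p) f z)) UNIV"
      unfolding sl by (intro has_sum_finite_sum has_sum_divide_const sum zl) auto
    \<comment> \<open>The shift by \<open>3 l\<close> offsets the denominator 3 of the exponents, so
      the factors are p-th roots of unity.\<close>
    moreover have "(\<Sum>l<p. a n * qpow 3 n ((z + 3 * of_nat l) / of_nat p) / of_nat p) =
        (if int p dvd n then a n * qpow 3 (n div int p) z else 0)" for n
    proof -
      have q: "qpow 3 n ((z + 3 * of_nat l) / of_nat p) =
          exp (2 * of_real pi * \<i> * of_int n * z / (3 * of_nat p)) * exp (2 * of_real pi * \<i> * of_int n * of_nat l / of_nat p)" for l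
        unfolding qpow_def exp_add[symmetric] by (rule arg_cong[of _ _ exp]) (use p0 in \<open>simp add: field_simps\<close>)
      have "(\<Sum>l<p. a n * qpow 3 n ((z + 3 * of_nat l) / of_nat p) / of_nat p) =
          a n * exp (2 * of_real pi * \<i> * of_int n * z / (3 * of_nat p)) / of_nat p * (if int p dvd n then of_nat p else 0)"
        unfolding q sum_roots_of_unity[OF p, symmetric] sum_distrib_left by (simp add: mult_ac)
      moreover have "exp (2 * of_real pi * \<i> * of_int n * z / (3 * of_nat p)) = qpow 3 (n div int p) z" if pn: "int p dvd n"
      proof -
        obtain k where k: "n = int p * k" using pn by (elim dvdE)
        show ?thesis unfolding qpow_def k using p by (intro arg_cong[of _ _ exp]) (simp add: field_simps)
      qed
      ultimately show ?thesis using p0 by simp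
    qed
    ultimately have s1: "((\<lambda>n. if int p dvd n then a n * qpow 3 (n div int p) z else 0) has_sum
        (\<Sum>l<p. slash 2 (1, 3 * int l, 0, int p) f z)) UNIV" by simp
    have s1': "((\<lambda>m. a (int p * m) * qpow 3 m z) has_sum (\<Sum>l<p. slash 2 (1, 3 * int l, 0, int p) f z)) UNIV"
    proof -
      have "((\<lambda>n. a n * qpow 3 (n div int p) z) has_sum (\<Sum>l<p. slash 2 (1, 3 * int l, 0, int p) f z)) {n. int p dvd n}
          \<longleftrightarrow> ((\<lambda>n. if int p dvd n then a n * qpow 3 (n div int p) z else 0) has_sum
        (\<Sum>l<p. slash 2 (1, 3 * int l, 0, int p) f z)) UNIV"
        by (rule has_sum_cong_neutral) auto
      with s1 have "((\<lambda>n. a n * qpow 3 (n div int p) z) has_sum (\<Sum>l<p. slash 2 (1, 3 * int l, 0, int p) f z)) {n. int p dvd n}"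
        by (simp only:)
      thus ?thesis using p
        by (subst has_sum_reindex_bij_witness[of _ "\<lambda>n. n div int p" "\<lambda>m. int p * m" "{n. int p dvd n}"]) auto
    qed
    have s2: "((\<lambda>m. of_nat p * (if int p dvd m then a (m div int p) else 0) * qpow 3 m z) has_sum slash 2 (int p, 0, 0, 1) f z) UNIV"
    proof -
      have "of_nat p * z \<in> upper_half" using z p by (simp add: upper_half_def)
      from has_sum_cmult_right[OF sum[OF this], of "of_nat p"]
      have "((\<lambda>n. of_nat p * (a n * qpow 3 n (of_nat p * z))) has_sum slash 2 (int p, 0, 0, 1) f z) UNIV"
        using p by (simp add: slash_2)
      moreover have "qpow 3 n (of_nat p * z) = qpow 3 (int p * n) z" for n
        unfolding qpow_def by (intro arg_cong[of _ _ exp]) simp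
      ultimately have "((\<lambda>n. of_nat p * (a n * qpow 3 (int p * n) z)) has_sum slash 2 (int p, 0, 0, 1) f z) UNIV" by simp
      hence "((\<lambda>m. of_nat p * (a (m div int p) * qpow 3 m z)) has_sum slash 2 (int p, 0, 0, 1) f z) {m. int p dvd m}"
        using p by (subst has_sum_reindex_bij_witness[of _ "\<lambda>m. int p * m" "\<lambda>n. n div int p" UNIV
           "\<lambda>n. of_nat p * (a n * qpow 3 (int p * n) z)"]) auto
      moreover have "((\<lambda>m. of_nat p * (a (m div int p) * qpow 3 m z)) has_sum slash 2 (int p, 0, 0, 1) f z) {m. int p dvd m} \<longleftrightarrow>
         ((\<lambda>m. of_nat p * (if int p dvd m then a (m div int p) else 0) * qpow 3 m z) has_sum slash 2 (int p, 0, 0, 1) f z) UNIV"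
        by (rule has_sum_cong_neutral) auto
      ultimately show ?thesis by (simp only:)
    qed
    from has_sum_add[OF s1' s2] show ?thesis unfolding hecke_p_eq[OF p] by (simp add: distrib_right)
  qed
  moreover have "finite {m. m < 0 \<and> ?A m \<noteq> 0}"
  proof (rule finite_subset)
    let ?S = "{n. n < 0 \<and> a n \<noteq> 0}"
    have fin: "finite ?S" using f by (simp add: has_qexp3_def)
    have "inj (\<lambda>m. int p * m)" using p by (auto simp: inj_on_def)
    thus "finite ((\<lambda>m. int p * m) -` ?S \<union> (\<lambda>m. int p * m) ` ?S)"
      using fin by (intro finite_UnI finite_vimageI finite_imageI)
    show "{m. m < 0 \<and> ?A m \<noteq> 0} \<subseteq> (\<lambda>m. int p * m) -` ?S \<union> (\<lambda>m. int p * m) ` ?S"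
    proof
      fix m assume m: "m \<in> {m. m < 0 \<and> ?A m \<noteq> 0}"
      show "m \<in> (\<lambda>m. int p * m) -` ?S \<union> (\<lambda>m. int p * m) ` ?S"
      proof (cases "a (int p * m) = 0")
        case False
        thus ?thesis using m p by (auto simp: mult_less_0_iff)
      next
        case True
        with m have pm: "int p dvd m" "a (m div int p) \<noteq> 0" by (auto split: if_splits)
        hence "m = int p * (m div int p)" by simp
        moreover from this have "m div int p < 0" using m p by (metis (no_types, lifting) mem_Collect_eq mult_less_0_iff of_nat_less_0_iff)
        ultimately show ?thesis using pm by blast
      qed
    qed
  qed
  ultimately show ?thesis by (simp add: has_qexp3_def)
qed

section \<open>Hecke operators and the Fricke group\<close>

lemma prime_neq_3_not_dvd:
  assumes "prime (p::nat)" "p \<noteq> 3"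
  shows "\<not> p dvd 3" "\<not> 3 dvd p"
proof -
  have "prime (3::nat)" by simp
  thus "\<not> p dvd 3" "\<not> 3 dvd p" using assms primes_dvd_imp_eq by blast+
qed

lemma prime_square_mod_3:
  assumes "prime (p::nat)" "p \<noteq> 3"
  shows "(int p * int p) mod 3 = 1"
proof -
  have "p mod 3 = 1 \<or> p mod 3 = 2" using prime_neq_3_not_dvd(2)[OF assms] by presburger
  hence "int p mod 3 = 1 \<or> int p mod 3 = 2" by presburger
  hence "((int p mod 3) * (int p mod 3)) mod 3 = 1" by auto
  thus ?thesis by (simp only: mod_mult_eq)
qed

text \<open>\<open>W3\<close> permutes the representatives: it exchanges the two diagonal ones, and
  sends \<open>l\<close> to the solution \<open>\<mu> l\<close> of \<open>27 l \<mu> = -1\<close>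
  modulo \<open>p\<close>, up to a left factor \<open>\<gamma>\<close> in
  \<open>\<Gamma>_0(3)\<close> on which the character is trivial.\<close>

lemma hecke_p_fricke:
  assumes f: "fricke_equivariant r s f" and s: "s * s = 1" and p: "prime p" "p \<noteq> 3" and z: "z \<in> upper_half"
  shows "slash 2 W3 (hecke_p 2 3 p f) z = s * hecke_p 2 3 p f z"
proof -
  have p0: "p > 0" using p(1) prime_gt_0_nat by blast
  have W: "mdet W3 > 0" by (simp add: mdet_def W3_def)
  have fW: "slash 2 W3 f w = s * f w" if w: "w \<in> upper_half" for w
  proof -
    have "f (- 1 / (3 * w)) = s * (3 * w\<^sup>2) * f w" using f w unfolding fricke_equivariant_def by blast
    thus ?thesis unfolding slash_W3 using upper_half_nonzero[OF w] by simp
  qed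
  have comm: "slash 2 W3 (slash 2 g f) z = s * slash 2 h f z"
    if "mmul g W3 = mmul W3 h" "mdet g > 0" "mdet h > 0" for g h
  proof -
    have "slash 2 W3 (slash 2 g f) z = slash 2 (mmul g W3) f z" by (rule slash_2_mmul[OF that(2) W z, symmetric])
    also have "\<dots> = slash 2 h (slash 2 W3 f) z" unfolding that(1) by (rule slash_2_mmul[OF W that(3) z])
    also have "\<dots> = s * slash 2 h f z" by (rule slash_2_cong[OF that(3) z fW])
    finally show ?thesis .
  qed
  have rep0: "slash 2 W3 (slash 2 (1, 0, 0, int p) f) z = s * slash 2 (int p, 0, 0, 1) f z"
    by (rule comm) (use p0 in \<open>auto simp: mmul_def W3_def mdet_def\<close>)
  have repinf: "slash 2 W3 (slash 2 (int p, 0, 0, 1) f) z = s * slash 2 (1, 0, 0, int p) f z"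
    by (rule comm) (use p0 in \<open>auto simp: mmul_def W3_def mdet_def\<close>)
  have cop: "coprime (27 * l) (int p)" if "l \<in> {1..<int p}" for l
  proof -
    have "coprime p (3 ^ 3)"
      using prime_imp_coprime[OF p(1) prime_neq_3_not_dvd(1)[OF p]] by (simp only: coprime_power_right_iff) simp
    hence "coprime (int p) (int (3 ^ 3))" by (simp only: coprime_int_iff)
    hence "coprime 27 (int p)" by (simp add: coprime_commute)
    moreover have "\<not> int p dvd l" using that by (auto dest: zdvd_imp_le)
    hence "coprime l (int p)" using p(1) prime_imp_coprime[of "int p" l] by (simp add: coprime_commute)
    ultimately show ?thesis by simp
  qed
  have "\<exists>m. m \<in> {1..<int p} \<and> int p dvd 1 + 27 * l * m" if l: "l \<in> {1..<int p}" for l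
  proof -
    obtain u v where uv: "u * (27 * l) + v * int p = 1"
      using bezout_int[of "27 * l" "int p"] cop[OF l] by (auto simp: coprime_iff_gcd_eq_1)
    define m where "m = (- u) mod int p"
    define q where "q = - u div int p"
    have m: "m = - u - int p * q" by (simp add: m_def q_def minus_mult_div_eq_mod)
    have "1 - u * (27 * l) = v * int p" using uv by linarith
    moreover have "1 + 27 * l * m = (1 - u * (27 * l)) - 27 * l * (int p * q)" unfolding m by (simp add: algebra_simps)
    ultimately have "1 + 27 * l * m = int p * (v - 27 * l * q)" by (simp add: algebra_simps)
    hence dv: "int p dvd 1 + 27 * l * m" by simp
    have "m \<noteq> 0"
    proof
      assume "m = 0"
      with dv have "int p dvd 1" by simp
      thus False using p(1) by (simp add: prime_nat_iff)
    qed
    moreover have "0 \<le> m" "m < int p" using p0 by (simp_all add: m_def)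
    ultimately show ?thesis using dv by (intro exI[of _ m]) auto
  qed
  then obtain \<mu> where \<mu>: "\<And>l. l \<in> {1..<int p} \<Longrightarrow> \<mu> l \<in> {1..<int p}" "\<And>l. l \<in> {1..<int p} \<Longrightarrow> int p dvd 1 + 27 * l * \<mu> l"
    by metis
  \<comment> \<open>The congruence is symmetric in its two unknowns, so \<open>\<mu> l\<close>
    determines \<open>l\<close>.\<close>
  have "inj_on \<mu> {1..<int p}"
  proof (rule inj_onI)
    fix l l' assume l: "l \<in> {1..<int p}" "l' \<in> {1..<int p}" "\<mu> l = \<mu> l'"
    have "int p dvd (1 + 27 * l * \<mu> l) - (1 + 27 * l' * \<mu> l')" by (rule dvd_diff[OF \<mu>(2)[OF l(1)] \<mu>(2)[OF l(2)]])
    hence "int p dvd 27 * \<mu> l * (l - l')" using l(3) by (simp add: algebra_simps)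
    hence "int p dvd l - l'" using cop[OF \<mu>(1)[OF l(1)]] by (simp add: coprime_dvd_mult_right_iff coprime_commute)
    thus "l = l'" using l(1,2) zdvd_imp_le[of "int p" "l - l'"] zdvd_imp_le[of "int p" "l' - l"]
      by (cases l l' rule: linorder_cases) (auto simp: dvd_diff_commute)
  qed
  hence bij: "bij_betw \<mu> {1..<int p} {1..<int p}"
    using \<mu>(1) by (intro bij_betw_imageI endo_inj_surj) auto
  have rep: "slash 2 W3 (slash 2 (1, 3 * l, 0, int p) f) z = s * slash 2 (1, 3 * \<mu> l, 0, int p) f z"
    if l: "l \<in> {1..<int p}" for l
  proof -
    obtain e where e: "1 + 27 * l * \<mu> l = int p * e" using \<mu>(2)[OF l] by (elim dvdE)
    \<comment> \<open>Both \<open>b\<close> and \<open>c/3\<close> are multiples of 3 because the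
      shifts are \<open>3 l\<close> instead of \<open>l\<close>; this is what makes the character
      value 1.\<close>
    define \<gamma> where "\<gamma> = (int p, - 3 * \<mu> l, 3 * (- 3 * l), e)"
    have \<gamma>: "\<gamma> \<in> Gamma0_3" using e by (simp add: \<gamma>_def Gamma0_3_def algebra_simps)
    have h: "(int p, 0, - 9 * l, 1) = mmul \<gamma> (1, 3 * \<mu> l, 0, int p)"
      using e by (simp add: \<gamma>_def mmul_def algebra_simps)
    have "slash 2 W3 (slash 2 (1, 3 * l, 0, int p) f) z = s * slash 2 (int p, 0, - 9 * l, 1) f z"
      by (rule comm) (use p0 in \<open>auto simp: mmul_def W3_def mdet_def\<close>)
    also have "slash 2 (int p, 0, - 9 * l, 1) f z = slash 2 (1, 3 * \<mu> l, 0, int p) (slash 2 \<gamma> f) z"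
      unfolding h by (rule slash_2_mmul) (use \<gamma> z p0 Gamma0_3_mdet[OF \<gamma>] in \<open>auto simp: mdet_def\<close>)
    also have "\<dots> = 1 * slash 2 (1, 3 * \<mu> l, 0, int p) f z"
    proof (rule slash_2_cong)
      fix w assume w: "w \<in> upper_half"
      have "3 * (- 3 * l) div 3 = - 3 * l" by (rule nonzero_mult_div_cancel_left) simp
      hence "nu_exp \<gamma> = e * (- 3 * \<mu> l - (- 3 * l))" unfolding nu_exp_def \<gamma>_def prod.case by (simp only:)
      hence "nu_exp \<gamma> = 3 * (e * (l - \<mu> l))" by (simp add: algebra_simps)
      hence "zeta3 powi (r * nu_exp \<gamma>) = 1" unfolding zeta3_powi_eq_1_iff by simp
      thus "slash 2 \<gamma> f w = 1 * f w"
        using fricke_equivariant_imp_nu_equivariant[OF f s \<gamma>] w by (simp add: nu_equivariant_def)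
    qed (use z p0 in \<open>auto simp: mdet_def\<close>)
    finally show ?thesis by simp
  qed
  have split: "(\<Sum>l<p. F (int l)) = F 0 + (\<Sum>l\<in>{1..<int p}. F l)" for F :: "int \<Rightarrow> complex"
  proof -
    have "(\<Sum>l<p. F (int l)) = (\<Sum>l\<in>{0..<int p}. F l)"
      by (rule sum.reindex_bij_witness[of _ nat int]) auto
    also have "{0..<int p} = insert 0 {1..<int p}" using p0 by auto
    finally show ?thesis by simp
  qed
  have "slash 2 W3 (hecke_p 2 3 p f) z =
      (\<Sum>l<p. slash 2 W3 (slash 2 (1, 3 * int l, 0, int p) f) z) + slash 2 W3 (slash 2 (int p, 0, 0, 1) f) z"
    unfolding slash_W3 hecke_p_eq[OF p0] by (simp add: distrib_left sum_distrib_left)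
  also have "\<dots> = s * slash 2 (int p, 0, 0, 1) f z + (\<Sum>l\<in>{1..<int p}. s * slash 2 (1, 3 * \<mu> l, 0, int p) f z)
      + s * slash 2 (1, 0, 0, int p) f z"
    unfolding split[of "\<lambda>l. slash 2 W3 (slash 2 (1, 3 * l, 0, int p) f) z"] repinf using rep0 rep by simp
  also have "(\<Sum>l\<in>{1..<int p}. s * slash 2 (1, 3 * \<mu> l, 0, int p) f z) = (\<Sum>l\<in>{1..<int p}. s * slash 2 (1, 3 * l, 0, int p) f z)"
    by (rule sum.reindex_bij_betw[OF bij])
  finally show ?thesis
    unfolding hecke_p_eq[OF p0] split[of "\<lambda>l. slash 2 (1, 3 * l, 0, int p) f z"]
    by (simp add: distrib_left sum_distrib_left)
qed

text \<open>Exponents are multiplied or divided by \<open>p\<close>, which is the same modulo 3 as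
  \<open>p^2 = 1\<close> there. Hence both parts of the operator multiply the residue class by
  \<open>p\<close>.\<close>

lemma fricke_equivariant_hecke_p:
  assumes f: "fricke_equivariant r s f" and s: "s * s = 1" and a: "has_qexp3 f a" and p: "prime p" "p \<noteq> 3"
  shows "fricke_equivariant (r * int p) s (hecke_p 2 3 p f)"
  unfolding fricke_equivariant_def
proof (intro conjI)
  have p0: "p > 0" using p(1) prime_gt_0_nat by blast
  have supp: "a n \<noteq> 0 \<Longrightarrow> n mod 3 = r mod 3" for n
    using translation_iff_support[OF a, of r] f by (simp add: fricke_equivariant_def)
  note pp = prime_square_mod_3[OF p]
  show "\<forall>z\<in>upper_half. hecke_p 2 3 p f (z + 1) = zeta3 powi (r * int p) * hecke_p 2 3 p f z"
  proof (subst translation_iff_support[OF has_qexp3_hecke_p[OF a p0]], intro allI impI)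
    fix m assume "a (int p * m) + of_nat p * (if int p dvd m then a (m div int p) else 0) \<noteq> 0"
    then consider "a (int p * m) \<noteq> 0" | "int p dvd m" "a (m div int p) \<noteq> 0"
      by (cases "a (int p * m) = 0"; cases "int p dvd m") auto
    thus "m mod 3 = (r * int p) mod 3"
    proof cases
      case 1
      have "(int p * m) mod 3 = r mod 3" by (rule supp[OF 1])
      hence "(int p * (int p * m)) mod 3 = (int p * r) mod 3" by (metis mod_mult_right_eq)
      moreover have "(int p * (int p * m)) mod 3 = m mod 3"
        using pp by (metis mult.assoc mod_mult_left_eq mult_1)
      ultimately show ?thesis by (simp add: mult.commute)
    next
      case 2
      have "(m div int p) mod 3 = r mod 3" by (rule supp[OF 2(2)])
      hence "(int p * (m div int p)) mod 3 = (r * int p) mod 3" by (metis mod_mult_right_eq mult.commute)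
      thus ?thesis using 2(1) by simp
    qed
  qed
  show "\<forall>z\<in>upper_half. hecke_p 2 3 p f (- 1 / (3 * z)) = s * (3 * z\<^sup>2) * hecke_p 2 3 p f z"
  proof
    fix z assume z: "z \<in> upper_half"
    from hecke_p_fricke[OF f s p z] show "hecke_p 2 3 p f (- 1 / (3 * z)) = s * (3 * z\<^sup>2) * hecke_p 2 3 p f z"
      unfolding slash_W3 using upper_half_nonzero[OF z] by (simp add: field_simps)
  qed
qed

text \<open>The coefficients of \<open>f | T(p\<^sup>n)\<close>, satisfying a one-step recursion instead of the two-step one
  that defines the operators.\<close>
fun hecke_coeff :: "nat \<Rightarrow> (int \<Rightarrow> complex) \<Rightarrow> nat \<Rightarrow> int \<Rightarrow> complex" where
  "hecke_coeff p a 0 m = a m"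
| "hecke_coeff p a (Suc n) m = a (int p ^ Suc n * m) + of_nat p * (if int p dvd m then hecke_coeff p a n (m div int p) else 0)"

text \<open>The two terms of the recursion lie in the same space, because \<open>p^(n+2)\<close> and
  \<open>p^n\<close> agree modulo 3.\<close>

lemma hecke_pp_equivariant:
  assumes f: "fricke_equivariant r s f" and s: "s * s = 1" and a: "has_qexp3 f a" and p: "prime p" "p \<noteq> 3"
  shows "fricke_equivariant (r * int p ^ n) s (hecke_pp 2 3 p n f) \<and> has_qexp3 (hecke_pp 2 3 p n f) (hecke_coeff p a n)"
proof (induction n rule: induct_nat_012)
  case 0
  thus ?case using f a by (simp add: hecke_coeff.simps(1)[abs_def])
next
  case 1
  have p0: "p > 0" using p(1) prime_gt_0_nat by blast
  have "hecke_coeff p a (Suc 0) = (\<lambda>m. a (int p * m) + of_nat p * (if int p dvd m then a (m div int p) else 0))"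
    by (rule ext) simp
  thus ?case using fricke_equivariant_hecke_p[OF f s a p] has_qexp3_hecke_p[OF a p0] by simp
next
  case (ge2 n)
  have p0: "p > 0" using p(1) prime_gt_0_nat by blast
  let ?F = "\<lambda>n. hecke_pp 2 3 p n f" and ?A = "hecke_coeff p a"
  have F: "?F (Suc (Suc n)) = (\<lambda>z. hecke_p 2 3 p (?F (Suc n)) z - of_nat p * ?F n z)"
    using p0 by (simp add: powr_one)
  have IH: "fricke_equivariant (r * int p ^ n) s (?F n)" "has_qexp3 (?F n) (?A n)"
    "fricke_equivariant (r * int p ^ Suc n) s (?F (Suc n))" "has_qexp3 (?F (Suc n)) (?A (Suc n))"
    using ge2 by blast+
  note pp = prime_square_mod_3[OF p]
  have "(r * int p ^ n) mod 3 = (r * int p ^ Suc (Suc n)) mod 3"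
  proof -
    have "r * int p ^ Suc (Suc n) = (int p * int p) * (r * int p ^ n)" by simp
    thus ?thesis using pp by (metis mod_mult_left_eq mult_1)
  qed
  hence "fricke_equivariant (r * int p ^ Suc (Suc n)) s (?F n)"
    using IH(1) fricke_equivariant_cong by blast
  moreover have "fricke_equivariant (r * int p ^ Suc (Suc n)) s (hecke_p 2 3 p (?F (Suc n)))"
    using fricke_equivariant_hecke_p[OF IH(3) s IH(4) p] by (simp add: mult_ac)
  ultimately have 1: "fricke_equivariant (r * int p ^ Suc (Suc n)) s (?F (Suc (Suc n)))"
    unfolding F by (intro fricke_equivariant_diff fricke_equivariant_cmult)
  have "has_qexp3 (?F (Suc (Suc n))) (\<lambda>m. ?A (Suc n) (int p * m) +
      of_nat p * (if int p dvd m then ?A (Suc n) (m div int p) else 0) - of_nat p * ?A n m)"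
    unfolding F by (intro has_qexp3_diff has_qexp3_cmult has_qexp3_hecke_p IH p0)
  also have "(\<lambda>m. ?A (Suc n) (int p * m) +
      of_nat p * (if int p dvd m then ?A (Suc n) (m div int p) else 0) - of_nat p * ?A n m) = ?A (Suc (Suc n))"
  proof
    fix m
    \<comment> \<open>The extra summand \<open>p * ?A n m\<close> is exactly what the two-step
      recursion subtracts.\<close>
    have "?A (Suc n) (int p * m) = a (int p ^ Suc (Suc n) * m) + of_nat p * ?A n m"
      using p0 by (simp add: mult_ac)
    thus "?A (Suc n) (int p * m) + of_nat p * (if int p dvd m then ?A (Suc n) (m div int p) else 0) - of_nat p * ?A n m = ?A (Suc (Suc n)) m"
      by (simp only: hecke_coeff.simps(2)[of p a "Suc n" m]) simp
  qed
  finally show ?case using 1 by blast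
qed

text \<open>The exponent \<open>p^(n+1) m\<close> is never -1, so the first summand vanishes at each
  step; the second carries the pole from -1 to \<open>-p^n\<close>, gaining a factor
  \<open>p\<close> each time.\<close>

lemma hecke_coeff_nonpos:
  assumes "prime p" "a (- 1) = 1" "\<And>m. m \<le> 0 \<Longrightarrow> m \<noteq> - 1 \<Longrightarrow> a m = 0" "m \<le> 0"
  shows "hecke_coeff p a n m = (if m = - (int p ^ n) then of_nat (p ^ n) else 0)"
  using assms(4)
proof (induction n arbitrary: m)
  case 0
  thus ?case using assms(2,3) by auto
next
  case (Suc n)
  have p: "int p > 1" using assms(1) prime_gt_1_nat by auto
  have "int p ^ Suc n * m \<noteq> - 1"
  proof
    assume "int p ^ Suc n * m = - 1"
    hence "int p * (int p ^ n * m) = - 1" by simp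
    hence "int p dvd - 1" by (metis dvd_triv_left)
    thus False using p by simp
  qed
  moreover have "int p ^ Suc n * m \<le> 0" using Suc.prems p by (intro mult_nonneg_nonpos) auto
  ultimately have a0: "a (int p ^ Suc n * m) = 0" by (intro assms(3))
  show ?case
  proof (cases "int p dvd m")
    case True
    then obtain k where k: "m = int p * k" by (elim dvdE)
    have "k \<le> 0" using Suc.prems p k by (simp add: mult_le_0_iff)
    moreover have "int p * k = - (int p ^ Suc n) \<longleftrightarrow> k = - (int p ^ n)"
    proof -
      have "- (int p ^ Suc n) = int p * - (int p ^ n)" by simp
      thus ?thesis using p by (simp only: mult_cancel_left) simp
    qed
    ultimately show ?thesis using a0 p Suc.IH[of k] by (simp add: k)
  next
    case False
    hence "m \<noteq> - (int p ^ Suc n)" by auto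
    thus ?thesis using False a0 by simp
  qed
qed

text \<open>Since \<open>p\<close> does not divide 1, only the first summand survives. In the
  exceptional case this value is the multiple of \<open>h3\<close> to be added.\<close>

lemma hecke_coeff_1:
  assumes "prime p" "n \<ge> 1"
  shows "hecke_coeff p a n 1 = a (int p ^ n)"
proof -
  obtain k where "n = Suc k" using assms(2) by (cases n) auto
  moreover have "int p > 1" using assms(1) prime_gt_1_nat by auto
  ultimately show ?thesis by simp
qed

text \<open>All three cases of the Hecke statement at once: both sides lie in the same space and
  have the same principal part, so only the coefficient at exponent 1 can still distinguish
  them.\<close>

lemma hecke_image:
  assumes p: "prime p" "p \<ge> 5" and n: "n \<ge> 1" and s: "s = 1 \<or> s = -1" and z: "z \<in> upper_half"
  shows "hecke_pp 2 3 p n (f_d 1 s) z = of_nat (p ^ n) * f_d (p ^ n) s z +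
     (if s = -1 \<and> p ^ n mod 3 = 2 then qcoeff3 (f_d 1 s) (int (p ^ n)) else 0) * h3 z"
proof -
  let ?d = "p ^ n"
  have p3: "p \<noteq> 3" using p by simp
  have "\<not> 3 dvd p ^ n" using prime_neq_3_not_dvd(2)[OF p(1) p3] prime_dvd_power[of 3 p n] by auto
  hence d: "?d mod 3 = 1 \<or> ?d mod 3 = 2" by presburger
  have sc: "of_int s * of_int s = (1::complex)" "of_int s = (1::complex) \<or> of_int s = (-1::complex)" using s by auto
  obtain a where a: "fricke_equivariant (char_index 1) (of_int s) (f_d 1 s)" "has_qexp3 (f_d 1 s) a" "a (- 1) = 1"
    "\<And>n. n \<noteq> - 1 \<Longrightarrow> \<not> exps_d 1 s n \<Longrightarrow> a n = 0"
    using f_d_props[of 1 s] s by auto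
  obtain b where b: "fricke_equivariant (char_index ?d) (of_int s) (f_d ?d s)" "has_qexp3 (f_d ?d s) b" "b (- int ?d) = 1"
    "\<And>n. n \<noteq> - int ?d \<Longrightarrow> \<not> exps_d ?d s n \<Longrightarrow> b n = 0"
    using f_d_props[OF d s] by blast
  obtain h where h: "has_qexp3 h3 h" "\<And>n. n < 1 \<Longrightarrow> h n = 0" "h 1 = 1" using h3_has_qexp3 by blast
  \<comment> \<open>For the other characters and signs \<open>h3\<close> does not belong to the
    space, so its multiple has to be 0.\<close>
  define c where "c = (if s = -1 \<and> ?d mod 3 = 2 then a (int ?d) else 0)"
  define G where "G = (\<lambda>z. of_nat ?d * f_d ?d s z + c * h3 z)"
  have r: "(char_index 1 * int p ^ n) mod 3 = char_index ?d mod 3"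
  proof -
    have "int p ^ n mod 3 = (if ?d mod 3 = 1 then 1 else 2)"
      using d by (metis of_nat_mod of_nat_power of_nat_1 of_nat_numeral)
    thus ?thesis unfolding char_index_def by simp presburger
  qed
  have "fricke_equivariant (char_index ?d) (of_int s) (\<lambda>z. c * h3 z)"
  proof (cases "s = -1 \<and> ?d mod 3 = 2")
    case True
    thus ?thesis using fricke_equivariant_cmult[OF fricke_equivariant_h3, of c] by (simp add: char_index_def)
  next
    case False
    hence "c = 0" by (auto simp: c_def)
    thus ?thesis by (simp add: fricke_equivariant_def)
  qed
  hence G: "fricke_equivariant (char_index ?d) (of_int s) G"
    unfolding G_def by (rule fricke_equivariant_add[OF fricke_equivariant_cmult[OF b(1)]])
  have Gq: "has_qexp3 G (\<lambda>n. of_nat ?d * b n + c * h n)"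
    unfolding G_def by (intro has_qexp3_add has_qexp3_cmult b h)
  note F = hecke_pp_equivariant[OF a(1) sc(1) a(2) p(1) p3, of n]
  have F1: "fricke_equivariant (char_index ?d) (of_int s) (hecke_pp 2 3 p n (f_d 1 s))"
    using F fricke_equivariant_cong[OF r] by blast
  have nonpos: "\<not> exps_d k s m" if "m \<le> 0" for k m using that by (auto simp: exps_d_def)
  have "hecke_pp 2 3 p n (f_d 1 s) z = G z"
  proof (rule fricke_equivariant_unique[OF F1 G sc(2) conjunct2[OF F] Gq _ _ z])
    fix m :: int assume m: "m \<le> 0"
    have "hecke_coeff p a n m = (if m = - (int p ^ n) then of_nat (p ^ n) else 0)"
      by (rule hecke_coeff_nonpos[of p a m n]) (use p(1) m a(3,4) nonpos in auto)
    also have "\<dots> = of_nat ?d * b m" using b(3) b(4)[OF _ nonpos[OF m]] by auto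
    finally show "hecke_coeff p a n m = of_nat ?d * b m + c * h m" using h(2) m by simp
  next
    show "char_index ?d mod 3 \<noteq> 1 \<or> of_int s = (1::complex) \<or> hecke_coeff p a n 1 = of_nat ?d * b 1 + c * h 1"
    proof (cases "s = -1 \<and> ?d mod 3 = 2")
      case True
      have "1 \<noteq> - int ?d" by linarith
      hence "b 1 = 0" by (rule b(4)) (use True in \<open>auto simp: exps_d_def\<close>)
      thus ?thesis using True h(3) by (simp add: hecke_coeff_1[OF p(1) n] c_def)
    next
      case False
      thus ?thesis using s d by (auto simp: char_index_def)
    qed
  qed
  thus ?thesis unfolding G_def c_def qcoeff3_eq[OF a(2)] by simp
qed

text \<open>The character and the admissible exponents are parameters, so that the three existence
  and uniqueness claims, each written with its own explicit condition, are instances.\<close>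

lemma exists_unique_form:
  assumes d: "d mod 3 = 1 \<or> d mod 3 = (2::nat)" and s: "s = 1 \<or> s = -1"
    and chi: "\<And>g. g \<in> Gamma0_3 \<Longrightarrow> chi g = zeta3 powi (char_index d * nu_exp g)"
    and E: "\<And>n. E n \<longleftrightarrow> exps_d d s n"
  shows "\<exists>f. wmf_star3 2 chi (of_int s) f \<and>
           (\<exists>a. has_qexp3 f a \<and> a (- int d) = 1 \<and> (\<forall>n. n \<noteq> - int d \<and> \<not> E n \<longrightarrow> a n = 0)) \<and>
        (\<forall>g. wmf_star3 2 chi (of_int s) g \<and>
           (\<exists>a. has_qexp3 g a \<and> a (- int d) = 1 \<and> (\<forall>n. n \<noteq> - int d \<and> \<not> E n \<longrightarrow> a n = 0))
           \<longrightarrow> (\<forall>z\<in>upper_half. g z = f z))"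
proof -
  have sc: "of_int s * of_int s = (1::complex)" "of_int s = (1::complex) \<or> of_int s = (-1::complex)" using s by auto
  obtain f a where f: "fricke_equivariant (char_index d) (of_int s) f" "has_qexp3 f a" "a (- int d) = 1"
     "\<forall>n. n \<noteq> - int d \<and> \<not> exps_d d s n \<longrightarrow> a n = 0" using exists_form[OF d s] by blast
  show ?thesis
  proof (intro exI[of _ f] conjI allI impI)
    show "wmf_star3 2 chi (of_int s) f" using f(1) wmf_star3_iff[OF sc(1) f(2) chi] by blast
    show "\<exists>a. has_qexp3 f a \<and> a (- int d) = 1 \<and> (\<forall>n. n \<noteq> - int d \<and> \<not> E n \<longrightarrow> a n = 0)" using f unfolding E by blast
    fix g assume "wmf_star3 2 chi (of_int s) g \<and> (\<exists>a. has_qexp3 g a \<and> a (- int d) = 1 \<and> (\<forall>n. n \<noteq> - int d \<and> \<not> E n \<longrightarrow> a n = 0))"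
    then obtain b where g: "wmf_star3 2 chi (of_int s) g" "has_qexp3 g b" "b (- int d) = 1"
       "\<forall>n. n \<noteq> - int d \<and> \<not> exps_d d s n \<longrightarrow> b n = 0" unfolding E by blast
    have g1: "fricke_equivariant (char_index d) (of_int s) g" using g(1) wmf_star3_iff[OF sc(1) g(2) chi] by blast
    show "\<forall>z\<in>upper_half. g z = f z"
    proof
      fix z assume z: "z \<in> upper_half"
      show "g z = f z"
      proof (rule fricke_equivariant_unique[OF g1 f(1) sc(2) g(2) f(2) _ _ z])
        fix n :: int assume "n \<le> 0"
        hence "\<not> exps_d d s n" by (auto simp: exps_d_def)
        thus "b n = a n" using f(3,4) g(3,4) by (cases "n = - int d") auto
      next
        \<comment> \<open>In the exceptional case the admissible exponents start at 4, so both
          coefficients at 1 are 0.\<close>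
        show "char_index d mod 3 \<noteq> 1 \<or> of_int s = (1::complex) \<or> b 1 = a 1"
        proof (cases "d mod 3 = 1 \<or> s = 1")
          case True
          thus ?thesis by (auto simp: char_index_def)
        next
          case False
          hence "\<not> exps_d d s 1" by (simp add: exps_d_def)
          moreover have "1 \<noteq> - int d" by linarith
          ultimately show ?thesis using f(4) g(4) by simp
        qed
      qed
    qed
  qed
qed

theorem theorem5p1:
  shows
  \<comment> \<open>(a)\<close>
  "(\<forall>d::nat. \<forall>s::int. d > 0 \<and> d mod 3 = 1 \<and> s \<in> {1, -1} \<longrightarrow>
      (\<exists>f. wmf_star3 2 (\<lambda>g. cnj (nu0 g)) (of_int s) f \<and>
           (\<exists>a. has_qexp3 f a \<and> a (- int d) = 1 \<and>
                (\<forall>n. n \<noteq> - int d \<and> \<not> (n > 0 \<and> n mod 3 = 2) \<longrightarrow> a n = 0)) \<and>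
        (\<forall>g. wmf_star3 2 (\<lambda>g. cnj (nu0 g)) (of_int s) g \<and>
           (\<exists>a. has_qexp3 g a \<and> a (- int d) = 1 \<and>
                (\<forall>n. n \<noteq> - int d \<and> \<not> (n > 0 \<and> n mod 3 = 2) \<longrightarrow> a n = 0))
           \<longrightarrow> (\<forall>z\<in>upper_half. g z = f z))))
   \<and>
   \<comment> \<open>(b), sign +\<close>
   (\<forall>d::nat. d > 0 \<and> d mod 3 = 2 \<longrightarrow>
      (\<exists>f. wmf_star3 2 nu0 1 f \<and>
           (\<exists>a. has_qexp3 f a \<and> a (- int d) = 1 \<and>
                (\<forall>n. n \<noteq> - int d \<and> \<not> (n > 0 \<and> n mod 3 = 1) \<longrightarrow> a n = 0)) \<and>
        (\<forall>g. wmf_star3 2 nu0 1 g \<and>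
           (\<exists>a. has_qexp3 g a \<and> a (- int d) = 1 \<and>
                (\<forall>n. n \<noteq> - int d \<and> \<not> (n > 0 \<and> n mod 3 = 1) \<longrightarrow> a n = 0))
           \<longrightarrow> (\<forall>z\<in>upper_half. g z = f z))))
   \<and>
   \<comment> \<open>(b), sign -\<close>
   (\<forall>d::nat. d > 0 \<and> d mod 3 = 2 \<longrightarrow>
      (\<exists>f. wmf_star3 2 nu0 (-1) f \<and>
           (\<exists>a. has_qexp3 f a \<and> a (- int d) = 1 \<and>
                (\<forall>n. n \<noteq> - int d \<and> \<not> (n \<ge> 4 \<and> n mod 3 = 1) \<longrightarrow> a n = 0)) \<and>
        (\<forall>g. wmf_star3 2 nu0 (-1) g \<and>
           (\<exists>a. has_qexp3 g a \<and> a (- int d) = 1 \<and>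
                (\<forall>n. n \<noteq> - int d \<and> \<not> (n \<ge> 4 \<and> n mod 3 = 1) \<longrightarrow> a n = 0))
           \<longrightarrow> (\<forall>z\<in>upper_half. g z = f z))))
   \<and>
   \<comment> \<open>(c)\<close>
   (\<forall>p::nat. \<forall>n::nat. prime p \<and> p \<ge> 5 \<and> n \<ge> 1 \<longrightarrow>
      (\<forall>z\<in>upper_half.
         hecke_pp 2 3 p n (f_d 1 1) z = of_nat (p ^ n) * f_d (p ^ n) 1 z) \<and>
      (p ^ n mod 3 = 1 \<longrightarrow> (\<forall>z\<in>upper_half.
         hecke_pp 2 3 p n (f_d 1 (-1)) z = of_nat (p ^ n) * f_d (p ^ n) (-1) z)) \<and>
      (p ^ n mod 3 = 2 \<longrightarrow> (\<forall>z\<in>upper_half.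
         hecke_pp 2 3 p n (f_d 1 (-1)) z = of_nat (p ^ n) * f_d (p ^ n) (-1) z
           + qcoeff3 (f_d 1 (-1)) (int (p ^ n)) * h3 z)))"
proof (intro conjI)
  show "\<forall>d::nat. \<forall>s::int. d > 0 \<and> d mod 3 = 1 \<and> s \<in> {1, -1} \<longrightarrow>
      (\<exists>f. wmf_star3 2 (\<lambda>g. cnj (nu0 g)) (of_int s) f \<and>
           (\<exists>a. has_qexp3 f a \<and> a (- int d) = 1 \<and>
                (\<forall>n. n \<noteq> - int d \<and> \<not> (n > 0 \<and> n mod 3 = 2) \<longrightarrow> a n = 0)) \<and>
        (\<forall>g. wmf_star3 2 (\<lambda>g. cnj (nu0 g)) (of_int s) g \<and>
           (\<exists>a. has_qexp3 g a \<and> a (- int d) = 1 \<and>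
                (\<forall>n. n \<noteq> - int d \<and> \<not> (n > 0 \<and> n mod 3 = 2) \<longrightarrow> a n = 0))
           \<longrightarrow> (\<forall>z\<in>upper_half. g z = f z)))"
  proof (intro allI impI)
    fix d :: nat and s :: int assume d: "d > 0 \<and> d mod 3 = 1 \<and> s \<in> {1, -1}"
    have chi: "cnj (nu0 g) = zeta3 powi (char_index d * nu_exp g)" if "g \<in> Gamma0_3" for g
      using chi_d_eq[OF that, of d] d by (simp add: chi_d_def)
    show "\<exists>f. wmf_star3 2 (\<lambda>g. cnj (nu0 g)) (of_int s) f \<and>
           (\<exists>a. has_qexp3 f a \<and> a (- int d) = 1 \<and>
                (\<forall>n. n \<noteq> - int d \<and> \<not> (n > 0 \<and> n mod 3 = 2) \<longrightarrow> a n = 0)) \<and>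
        (\<forall>g. wmf_star3 2 (\<lambda>g. cnj (nu0 g)) (of_int s) g \<and>
           (\<exists>a. has_qexp3 g a \<and> a (- int d) = 1 \<and>
                (\<forall>n. n \<noteq> - int d \<and> \<not> (n > 0 \<and> n mod 3 = 2) \<longrightarrow> a n = 0))
           \<longrightarrow> (\<forall>z\<in>upper_half. g z = f z))"
      by (rule exists_unique_form[OF _ _ chi]) (use d in \<open>auto simp: exps_d_def\<close>)
  qed
next
  have chi: "nu0 g = zeta3 powi (char_index d * nu_exp g)" if "g \<in> Gamma0_3" "d mod 3 = 2" for g d
    using chi_d_eq[OF that(1), of d] that(2) by (simp add: chi_d_def)
  show "\<forall>d::nat. d > 0 \<and> d mod 3 = 2 \<longrightarrow>
      (\<exists>f. wmf_star3 2 nu0 1 f \<and>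
           (\<exists>a. has_qexp3 f a \<and> a (- int d) = 1 \<and>
                (\<forall>n. n \<noteq> - int d \<and> \<not> (n > 0 \<and> n mod 3 = 1) \<longrightarrow> a n = 0)) \<and>
        (\<forall>g. wmf_star3 2 nu0 1 g \<and>
           (\<exists>a. has_qexp3 g a \<and> a (- int d) = 1 \<and>
                (\<forall>n. n \<noteq> - int d \<and> \<not> (n > 0 \<and> n mod 3 = 1) \<longrightarrow> a n = 0))
           \<longrightarrow> (\<forall>z\<in>upper_half. g z = f z)))"
  proof (intro allI impI)
    fix d :: nat assume d: "d > 0 \<and> d mod 3 = 2"
    have "n > 0 \<and> n mod 3 = 1 \<longleftrightarrow> exps_d d 1 n" for n using d by (simp add: exps_d_def)
    from exists_unique_form[of d 1 nu0, OF _ _ chi this] show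
      "\<exists>f. wmf_star3 2 nu0 1 f \<and>
           (\<exists>a. has_qexp3 f a \<and> a (- int d) = 1 \<and>
                (\<forall>n. n \<noteq> - int d \<and> \<not> (n > 0 \<and> n mod 3 = 1) \<longrightarrow> a n = 0)) \<and>
        (\<forall>g. wmf_star3 2 nu0 1 g \<and>
           (\<exists>a. has_qexp3 g a \<and> a (- int d) = 1 \<and>
                (\<forall>n. n \<noteq> - int d \<and> \<not> (n > 0 \<and> n mod 3 = 1) \<longrightarrow> a n = 0))
           \<longrightarrow> (\<forall>z\<in>upper_half. g z = f z))" using d unfolding of_int_1 by blast
  qed
  show "\<forall>d::nat. d > 0 \<and> d mod 3 = 2 \<longrightarrow>
      (\<exists>f. wmf_star3 2 nu0 (-1) f \<and>
           (\<exists>a. has_qexp3 f a \<and> a (- int d) = 1 \<and>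
                (\<forall>n. n \<noteq> - int d \<and> \<not> (n \<ge> 4 \<and> n mod 3 = 1) \<longrightarrow> a n = 0)) \<and>
        (\<forall>g. wmf_star3 2 nu0 (-1) g \<and>
           (\<exists>a. has_qexp3 g a \<and> a (- int d) = 1 \<and>
                (\<forall>n. n \<noteq> - int d \<and> \<not> (n \<ge> 4 \<and> n mod 3 = 1) \<longrightarrow> a n = 0))
           \<longrightarrow> (\<forall>z\<in>upper_half. g z = f z)))"
  proof (intro allI impI)
    fix d :: nat assume d: "d > 0 \<and> d mod 3 = 2"
    have "n \<ge> 4 \<and> n mod 3 = 1 \<longleftrightarrow> exps_d d (-1) n" for n using d by (simp add: exps_d_def)
    from exists_unique_form[of d "-1" nu0, OF _ _ chi this] show
      "\<exists>f. wmf_star3 2 nu0 (-1) f \<and>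
           (\<exists>a. has_qexp3 f a \<and> a (- int d) = 1 \<and>
                (\<forall>n. n \<noteq> - int d \<and> \<not> (n \<ge> 4 \<and> n mod 3 = 1) \<longrightarrow> a n = 0)) \<and>
        (\<forall>g. wmf_star3 2 nu0 (-1) g \<and>
           (\<exists>a. has_qexp3 g a \<and> a (- int d) = 1 \<and>
                (\<forall>n. n \<noteq> - int d \<and> \<not> (n \<ge> 4 \<and> n mod 3 = 1) \<longrightarrow> a n = 0))
           \<longrightarrow> (\<forall>z\<in>upper_half. g z = f z))" using d unfolding of_int_minus of_int_1 by blast
  qed
next
  show "\<forall>p::nat. \<forall>n::nat. prime p \<and> p \<ge> 5 \<and> n \<ge> 1 \<longrightarrow>
      (\<forall>z\<in>upper_half.
         hecke_pp 2 3 p n (f_d 1 1) z = of_nat (p ^ n) * f_d (p ^ n) 1 z) \<and>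
      (p ^ n mod 3 = 1 \<longrightarrow> (\<forall>z\<in>upper_half.
         hecke_pp 2 3 p n (f_d 1 (-1)) z = of_nat (p ^ n) * f_d (p ^ n) (-1) z)) \<and>
      (p ^ n mod 3 = 2 \<longrightarrow> (\<forall>z\<in>upper_half.
         hecke_pp 2 3 p n (f_d 1 (-1)) z = of_nat (p ^ n) * f_d (p ^ n) (-1) z
           + qcoeff3 (f_d 1 (-1)) (int (p ^ n)) * h3 z))"
  proof (intro allI impI conjI ballI)
    fix p n :: nat and z assume p: "prime p \<and> p \<ge> 5 \<and> n \<ge> 1" and z: "z \<in> upper_half"
    note image = hecke_image[of p n _ z]
    show "hecke_pp 2 3 p n (f_d 1 1) z = of_nat (p ^ n) * f_d (p ^ n) 1 z"
      using image[of 1] p z by simp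
    show "hecke_pp 2 3 p n (f_d 1 (-1)) z = of_nat (p ^ n) * f_d (p ^ n) (-1) z" if "p ^ n mod 3 = 1"
      using image[of "-1"] p z that by simp
    show "hecke_pp 2 3 p n (f_d 1 (-1)) z = of_nat (p ^ n) * f_d (p ^ n) (-1) z
           + qcoeff3 (f_d 1 (-1)) (int (p ^ n)) * h3 z" if "p ^ n mod 3 = 2"
      using image[of "-1"] p z that by simp
  qed
qed

end
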